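(* Let $\Bbbk$ be a unital commutative ring, $(A,\Delta)$ a $\Bbbk$-free cocommutative $\Bbbk$-algebra, and $V$ a $\Bbbk$-free $A$-module. Let $\lambda : A\otimes V\to A$ and $\kappa=\kappa_V\oplus\kappa_A : V\wedge V\to V\oplus A$ be $\Bbbk$-linear, and let $\mathscr{H}_{\lambda,\kappa}$ be the corresponding deformed smash product algebra. Suppose $A=\Bbbk\cdot 1\oplus A'$ for a free $\Bbbk$-submodule $A'\subset A$. Then the following are equivalent: (1) $\mathscr{H}_{\lambda,\kappa}$ has the PBW property (for a $\Bbbk$-basis of $V$ and a $\Bbbk$-basis of $A$ containing $1$). (2) The natural map $A\oplus (V\otimes A)\to \mathscr{H}_{\lambda,\kappa}$ (sending $a\mapsto a$ and $v\otimes a\mapsto va$) is injective. (3) $\lambda$ and $\kappa$ satisfy all of the following conditions (where $\sum_\circlearrowright$ denotes the sum over the three cyclic permutations of $(v_1,v_2,v_3)$): (a) For all $a,a'\in A$, $v\in V$, in $A$: $$\lambda(aa',v)=a\,\lambda(a',v)+\sum\lambda(a,a'_{(1)}(v))\,a'_{(2)}.$$ (b) For all $a\in A$, $v,v'\in V$, in $A$: $$a\,\kappa_A(v,v')-\sum\kappa_A(a_{(1)}(v),a_{(2)}(v'))\,a_{(3)}=\lambda(\lambda(a,v),v')-\lambda(\lambda(a,v'),v)-\lambda(a,\kappa_V(v,v')),$$ and in $V\otimes A$: $$\sum a_{(1)}(\kappa_V(v,v'))\otimes a_{(2)}-\sum\kappa_V(a_{(1)}(v),a_{(2)}(v'))\otimes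 a_{(3)}$$ $$=\sum\lambda(a,v)_{(1)}(v')\otimes\lambda(a,v)_{(2)}-\sum\lambda(a,v')_{(1)}(v)\otimes\lambda(a,v')_{(2)}+\sum a_{(1)}(v)\otimes\lambda(a_{(2)},v')-\sum a_{(1)}(v')\otimes\lambda(a_{(2)},v).$$ (c) For all $v_1,v_2,v_3\in V$, in $A$: $$\sum_\circlearrowright\lambda(\kappa_A(v_1,v_2),v_3)=\sum_\circlearrowright\kappa_A(v_1,\kappa_V(v_2,v_3)),$$ and in $V\otimes A$: $$\sum_\circlearrowright\kappa_V(\kappa_V(v_1,v_2),v_3)\otimes 1_A=\sum_\circlearrowright v_1\otimes\kappa_A(v_2,v_3)-\sum_\circlearrowright\kappa_A(v_1,v_2)_{(1)}(v_3)\otimes\kappa_A(v_1,v_2)_{(2)}.$$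
   Context: $\Bbbk$ is a unital commutative ring; all tensor products are over $\Bbbk$. A cocommutative $\Bbbk$-algebra $(A,\Delta)$ is a unital associative $\Bbbk$-algebra $A$ with a $\Bbbk$-algebra map $\Delta:A\to A\otimes A$ satisfying $\Delta(1)=1\otimes 1$, coassociativity, and $\Delta=\Delta^{op}$ (no counit or antipode is assumed). Sweedler notation: $\Delta(a)=\sum a_{(1)}\otimes a_{(2)}$, and iterates. The action of $a\in A$ on $v\in V$ is written $a(v)$. $\wedge^2V=V\wedge V\subset V\otimes V$ is the $\Bbbk$-span of the $v\wedge v':=v\otimes v'-v'\otimes v$; write $\kappa(v,v')=\kappa(v\wedge v')$. $\kappa_V,\kappa_A$ are the components of $\kappa$ in $V$ and $A$. Deformed smash product algebra: $\mathscr{H}_{\lambda,\kappa}$ is the quotient of the tensor algebra $T(V\oplus A)$ by the multiplication in $A$ (with $1_A$ identified with the unit) and by the relations $$av-\sum a_{(1)}(v)a_{(2)}=\lambda(a,v),\qquad vv'-v'v=\kappa(v,v')\qquad(a\in A,\ v,v'\in V).$$ $\mathscr{H}_{0,0}=\mathrm{Sym}(V)\rtimes A$ is the smash product: as a $\Bbbk$-module it is $\mathrm{Sym}(V)\otimes A$, with $A$ acting on $\mathrm{Sym}^n(V)$, $n\ge1$, via iterated coproducts and with product $(f'\otimes a')(f\otimes a)=\sum f'\,a'_{(1)}(f)\otimes a'_{(2)}a$ for $f\in\mathrm{Sym}^{\ge1}(V)$, and $(f'\otimes a')(1\otimes a)=f'\otimes a'a$. $\mathscr{H}_{\lambda,\kappa}$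 is filtered by $\deg A=0$, $\deg V=1$. It has the PBW property if the natural surjection from $\mathscr{H}_{0,0}$ onto the associated graded algebra of $\mathscr{H}_{\lambda,\kappa}$ is an isomorphism; equivalently, for a totally ordered $\Bbbk$-basis $\{x_i\}$ of $V$ and a $\Bbbk$-basis $J_1$ of $A$, the elements $X\cdot a$, with $X$ a word in the $x_i$ in non-decreasing order and $a\in J_1$, form a $\Bbbk$-basis of $\mathscr{H}_{\lambda,\kappa}$. *)

theory Defs
  imports Complex_Main "HOL-Library.Poly_Mapping" "HOL-Library.Product_Plus"
begin

section \<open>Free modules and their quotients\<close>

text \<open>
  Throughout, \<open>'k\<close> is the ground ring and a module is a type with a scalar multiplication
  \<open>s\<close> satisfying \<^term>\<open>module s\<close>. The free module on a set \<open>'x\<close> is the type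
  \<open>'x \<Rightarrow>\<^sub>0 'k\<close> of finitely supported functions.
\<close>

definition fscale :: "'k::comm_ring_1 \<Rightarrow> ('x \<Rightarrow>\<^sub>0 'k) \<Rightarrow> ('x \<Rightarrow>\<^sub>0 'k)" where
  "fscale c p = Poly_Mapping.map ((*) c) p"

lemma lookup_fscale: "Poly_Mapping.lookup (fscale c p) x = c * Poly_Mapping.lookup p x"
  unfolding fscale_def by transfer (simp add: when_def)

lemma module_fscale: "module fscale"
  by standard (auto intro!: poly_mapping_eqI simp: lookup_fscale lookup_add algebra_simps)

definition pt :: "'x \<Rightarrow> ('x \<Rightarrow>\<^sub>0 'k::comm_ring_1)" where
  "pt x = Poly_Mapping.single x 1"

text \<open>The linear map on the free module with prescribed values on the free generators.\<close>

definition lin_ext ::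
  "('k \<Rightarrow> 'm \<Rightarrow> 'm) \<Rightarrow> ('x \<Rightarrow> 'm) \<Rightarrow> ('x \<Rightarrow>\<^sub>0 'k::comm_ring_1) \<Rightarrow> 'm::ab_group_add" where
  "lin_ext s f p = (\<Sum>x\<in>Poly_Mapping.keys p. s (Poly_Mapping.lookup p x) (f x))"

text \<open>
  Elements of a quotient by a submodule (or ideal) \<open>N\<close> are the cosets \<^term>\<open>qcls N x\<close>;
  \<^term>\<open>qrep X\<close> is a chosen representative of the coset \<open>X\<close>. It is used only where the
  result does not depend on the choice.
\<close>

definition qcls :: "'m::ab_group_add set \<Rightarrow> 'm \<Rightarrow> 'm set" where
  "qcls N x = {y. y - x \<in> N}"

definition qrep :: "'m set \<Rightarrow> 'm" where
  "qrep X = (SOME x. x \<in> X)"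

text \<open>
  Linearity, over the scalar multiplications \<open>s\<close> and \<open>t\<close>, of a map defined on the image of the
  submodule \<open>W\<close> in the quotient by \<open>N\<close>. Values of \<open>f\<close> outside this image are irrelevant.
\<close>

definition quot_linear ::
  "('k \<Rightarrow> 'm \<Rightarrow> 'm) \<Rightarrow> ('k \<Rightarrow> 'n \<Rightarrow> 'n) \<Rightarrow> 'm::ab_group_add set \<Rightarrow> 'm set
    \<Rightarrow> ('m set \<Rightarrow> 'n::ab_group_add) \<Rightarrow> bool" where
  "quot_linear s t N W f \<longleftrightarrow>
     (\<forall>p\<in>W. \<forall>q\<in>W. f (qcls N (p + q)) = f (qcls N p) + f (qcls N q)) \<and>
     (\<forall>c. \<forall>p\<in>W. f (qcls N (s c p)) = t c (f (qcls N p)))"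

definition is_basis ::
  "('k::comm_ring_1 \<Rightarrow> 'm::ab_group_add \<Rightarrow> 'm) \<Rightarrow> 'm set \<Rightarrow> 'm set \<Rightarrow> bool" where
  "is_basis s W B \<longleftrightarrow> \<not> module.dependent s B \<and> module.span s B = W"

definition is_free ::
  "('k::comm_ring_1 \<Rightarrow> 'm::ab_group_add \<Rightarrow> 'm) \<Rightarrow> 'm set \<Rightarrow> bool" where
  "is_free s W \<longleftrightarrow> (\<exists>B. is_basis s W B)"

definition sum_scale ::
  "('k \<Rightarrow> 'm \<Rightarrow> 'm) \<Rightarrow> ('k \<Rightarrow> 'n \<Rightarrow> 'n) \<Rightarrow> 'k \<Rightarrow> 'm \<times> 'n \<Rightarrow> 'm \<times> 'n" where
  "sum_scale s t c = (\<lambda>(x, y). (s c x, t c y))"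


section \<open>Tensor products\<close>

text \<open>
  The tensor product is the quotient of the free module on the cartesian product by the
  submodule spanned by the (multi)linearity relations. \<open>lin_rels s g\<close> contains the relations
  saying that \<open>x \<mapsto> g x\<close> is linear.
\<close>

definition lin_rels ::
  "('k::comm_ring_1 \<Rightarrow> 'm::ab_group_add \<Rightarrow> 'm) \<Rightarrow> ('m \<Rightarrow> 'x) \<Rightarrow> ('x \<Rightarrow>\<^sub>0 'k) set" where
  "lin_rels s g = {pt (g (x + y)) - pt (g x) - pt (g y) | x y. True}
                \<union> {pt (g (s c x)) - fscale c (pt (g x)) | c x. True}"

definition tens_rel ::
  "('k::comm_ring_1 \<Rightarrow> 'm::ab_group_add \<Rightarrow> 'm) \<Rightarrow> ('k \<Rightarrow> 'n::ab_group_add \<Rightarrow> 'n)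
    \<Rightarrow> ('m \<times> 'n \<Rightarrow>\<^sub>0 'k) set" where
  "tens_rel s t = module.span fscale
     ((\<Union>y. lin_rels s (\<lambda>x. (x, y))) \<union> (\<Union>x. lin_rels t (\<lambda>y. (x, y))))"

text \<open>Relations of the threefold tensor power.\<close>

definition tens3_rel ::
  "('k::comm_ring_1 \<Rightarrow> 'm::ab_group_add \<Rightarrow> 'm) \<Rightarrow> ('m \<times> 'm \<times> 'm \<Rightarrow>\<^sub>0 'k) set" where
  "tens3_rel s = module.span fscale
     ((\<Union>y z. lin_rels s (\<lambda>x. (x, y, z))) \<union> (\<Union>x z. lin_rels s (\<lambda>y. (x, y, z)))
       \<union> (\<Union>x y. lin_rels s (\<lambda>z. (x, y, z))))"

definition tens_space ::
  "('k::comm_ring_1 \<Rightarrow> 'm::ab_group_add \<Rightarrow> 'm) \<Rightarrow> ('k \<Rightarrow> 'n::ab_group_add \<Rightarrow> 'n)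
    \<Rightarrow> ('m \<times> 'n \<Rightarrow>\<^sub>0 'k) set set" where
  "tens_space s t = range (qcls (tens_rel s t))"

definition tens ::
  "('k::comm_ring_1 \<Rightarrow> 'm::ab_group_add \<Rightarrow> 'm) \<Rightarrow> ('k \<Rightarrow> 'n::ab_group_add \<Rightarrow> 'n)
    \<Rightarrow> 'm \<Rightarrow> 'n \<Rightarrow> ('m \<times> 'n \<Rightarrow>\<^sub>0 'k) set" where
  "tens s t x y = qcls (tens_rel s t) (pt (x, y))"

text \<open>
  \<open>wedge s v v'\<close> is the element \<open>v \<otimes> v' - v' \<otimes> v\<close> of \<open>V \<otimes> V\<close>; the submodule
  \<open>V \<and> V\<close> spanned by these elements is the image of \<^term>\<open>wedge_span\<close>.
\<close>

definition wedge ::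
  "('k::comm_ring_1 \<Rightarrow> 'v::ab_group_add \<Rightarrow> 'v) \<Rightarrow> 'v \<Rightarrow> 'v \<Rightarrow> ('v \<times> 'v \<Rightarrow>\<^sub>0 'k) set" where
  "wedge s v v' = qcls (tens_rel s s) (pt (v, v') - pt (v', v))"

definition wedge_span :: "('v \<times> 'v \<Rightarrow>\<^sub>0 'k::comm_ring_1) set" where
  "wedge_span = module.span fscale {pt (v, v') - pt (v', v) | v v'. True}"


section \<open>Cocommutative algebras and their modules\<close>

locale algebra_over = module scale
  for scale :: "'k::comm_ring_1 \<Rightarrow> 'a::ring_1 \<Rightarrow> 'a" +
  assumes scale_mult_left: "scale c (a * b) = scale c a * b"
    and scale_mult_right: "scale c (a * b) = a * scale c b"

text \<open>
  Sweedler sums. For a bilinear \<open>f\<close>, \<open>sweedler2 s \<Delta> f a\<close> is \<open>\<Sum> f a\<^sub>(\<^sub>1\<^sub>) a\<^sub>(\<^sub>2\<^sub>)\<close> in the module with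
  scalar multiplication \<open>s\<close>, and similarly for \<open>sweedler3\<close>. If \<open>f\<close> takes values in a free module
  and is bilinear only modulo \<open>N\<close>, then the sum is well defined modulo \<open>N\<close>.
\<close>

definition sweedler2 ::
  "('k::comm_ring_1 \<Rightarrow> 'm \<Rightarrow> 'm) \<Rightarrow> ('a \<Rightarrow> ('a \<times> 'a \<Rightarrow>\<^sub>0 'k) set) \<Rightarrow> ('a \<Rightarrow> 'a \<Rightarrow> 'm) \<Rightarrow> 'a
    \<Rightarrow> 'm::ab_group_add" where
  "sweedler2 s \<Delta> f a = lin_ext s (\<lambda>(x, y). f x y) (qrep (\<Delta> a))"

definition coprod_left ::
  "('a \<Rightarrow> ('a \<times> 'a \<Rightarrow>\<^sub>0 'k::comm_ring_1) set) \<Rightarrow> ('a \<times> 'a \<Rightarrow>\<^sub>0 'k) \<Rightarrow> ('a \<times> 'a \<times> 'a \<Rightarrow>\<^sub>0 'k)" where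
  "coprod_left \<Delta> p = lin_ext fscale (\<lambda>(x, z). sweedler2 fscale \<Delta> (\<lambda>x' x''. pt (x', x'', z)) x) p"

definition coprod_right ::
  "('a \<Rightarrow> ('a \<times> 'a \<Rightarrow>\<^sub>0 'k::comm_ring_1) set) \<Rightarrow> ('a \<times> 'a \<Rightarrow>\<^sub>0 'k) \<Rightarrow> ('a \<times> 'a \<times> 'a \<Rightarrow>\<^sub>0 'k)" where
  "coprod_right \<Delta> p = lin_ext fscale (\<lambda>(x, z). sweedler2 fscale \<Delta> (\<lambda>z' z''. pt (x, z', z'')) z) p"

definition sweedler3 ::
  "('k::comm_ring_1 \<Rightarrow> 'm \<Rightarrow> 'm) \<Rightarrow> ('a \<Rightarrow> ('a \<times> 'a \<Rightarrow>\<^sub>0 'k) set) \<Rightarrow> ('a \<Rightarrow> 'a \<Rightarrow> 'a \<Rightarrow> 'm) \<Rightarrow> 'a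
    \<Rightarrow> 'm::ab_group_add" where
  "sweedler3 s \<Delta> f a = lin_ext s (\<lambda>(x, y, z). f x y z) (coprod_left \<Delta> (qrep (\<Delta> a)))"

text \<open>The product \<open>(x \<otimes> y) (x' \<otimes> y') = x x' \<otimes> y y'\<close> on representatives.\<close>

definition tens_mult ::
  "('a::times \<times> 'a \<Rightarrow>\<^sub>0 'k::comm_ring_1) \<Rightarrow> ('a \<times> 'a \<Rightarrow>\<^sub>0 'k) \<Rightarrow> ('a \<times> 'a \<Rightarrow>\<^sub>0 'k)" where
  "tens_mult p q =
     lin_ext fscale (\<lambda>(x, y). lin_ext fscale (\<lambda>(x', y'). pt (x * x', y * y')) q) p"

locale cocommutative_algebra = algebra_over scA
  for scA :: "'k::comm_ring_1 \<Rightarrow> 'a::ring_1 \<Rightarrow> 'a" +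
  fixes \<Delta> :: "'a \<Rightarrow> ('a \<times> 'a \<Rightarrow>\<^sub>0 'k) set"
  assumes \<Delta>_in: "\<Delta> a \<in> tens_space scA scA"
    and \<Delta>_add: "\<Delta> (a + b) = qcls (tens_rel scA scA) (qrep (\<Delta> a) + qrep (\<Delta> b))"
    and \<Delta>_scale: "\<Delta> (scA c a) = qcls (tens_rel scA scA) (fscale c (qrep (\<Delta> a)))"
    and \<Delta>_mult: "\<Delta> (a * b) = qcls (tens_rel scA scA) (tens_mult (qrep (\<Delta> a)) (qrep (\<Delta> b)))"
    and \<Delta>_one: "\<Delta> 1 = tens scA scA 1 1"
    and \<Delta>_coassoc: "qcls (tens3_rel scA) (coprod_left \<Delta> (qrep (\<Delta> a)))
                     = qcls (tens3_rel scA) (coprod_right \<Delta> (qrep (\<Delta> a)))"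
    and \<Delta>_cocomm: "\<Delta> a = qcls (tens_rel scA scA) (sweedler2 fscale \<Delta> (\<lambda>x y. pt (y, x)) a)"

locale algebra_module = A: algebra_over scA + V: module scV
  for scA :: "'k::comm_ring_1 \<Rightarrow> 'a::ring_1 \<Rightarrow> 'a"
    and scV :: "'k \<Rightarrow> 'v::ab_group_add \<Rightarrow> 'v" +
  fixes act :: "'a \<Rightarrow> 'v \<Rightarrow> 'v"
  assumes act_add_left: "act (a + b) v = act a v + act b v"
    and act_add_right: "act a (v + w) = act a v + act a w"
    and act_scale_left: "act (scA c a) v = scV c (act a v)"
    and act_scale_right: "act a (scV c v) = scV c (act a v)"
    and act_mult: "act (a * b) v = act a (act b v)"
    and act_one: "act 1 v = v"


section \<open>Free algebras and tensor algebras\<close>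

text \<open>
  The free monoid on \<open>'x\<close>, written additively so that \<open>'x fword \<Rightarrow>\<^sub>0 'k\<close> with the convolution
  product of \<open>Poly_Mapping\<close> is the free associative unital algebra on \<open>'x\<close>.
\<close>

datatype 'x fword = FWord "'x list"

instantiation fword :: (type) monoid_add
begin

definition zero_fword :: "'x fword" where
  "zero_fword = FWord []"

fun plus_fword :: "'x fword \<Rightarrow> 'x fword \<Rightarrow> 'x fword" where
  "plus_fword (FWord xs) (FWord ys) = FWord (xs @ ys)"

instance
proof
  fix a b c :: "'x fword"
  show "a + b + c = a + (b + c)" by (cases a; cases b; cases c) simp
  show "0 + a = a" by (cases a) (simp add: zero_fword_def)
  show "a + 0 = a" by (cases a) (simp add: zero_fword_def)
qed

end

definition gen :: "'x \<Rightarrow> ('x fword \<Rightarrow>\<^sub>0 'k::comm_ring_1)" where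
  "gen x = pt (FWord [x])"

text \<open>In the algebras used here, closure under scalars follows from closure under products.\<close>

definition two_sided_ideal :: "'r::ring_1 set \<Rightarrow> bool" where
  "two_sided_ideal I \<longleftrightarrow>
     0 \<in> I \<and> (\<forall>x\<in>I. \<forall>y\<in>I. x + y \<in> I) \<and> (\<forall>x\<in>I. \<forall>r. r * x \<in> I \<and> x * r \<in> I)"

text \<open>
  The tensor algebra \<open>T(M)\<close> is the free algebra on the set \<open>M\<close> modulo the ideal generated
  by these relations.
\<close>

definition tensor_algebra_rels ::
  "('k::comm_ring_1 \<Rightarrow> 'm::ab_group_add \<Rightarrow> 'm) \<Rightarrow> ('m fword \<Rightarrow>\<^sub>0 'k) set" where
  "tensor_algebra_rels s = lin_rels s (\<lambda>m. FWord [m])"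


section \<open>Deformed smash product algebras\<close>

definition inV :: "'v \<Rightarrow> (('v \<times> 'a::zero) fword \<Rightarrow>\<^sub>0 'k::comm_ring_1)" where
  "inV v = gen (v, 0)"

definition inA :: "'a \<Rightarrow> (('v::zero \<times> 'a) fword \<Rightarrow>\<^sub>0 'k::comm_ring_1)" where
  "inA a = gen (0, a)"

text \<open>
  The kernel of the map from the free algebra on the set \<open>V \<oplus> A\<close> onto
  \<open>H\<^sub>\<lambda>\<^sub>,\<^sub>\<kappa>\<close>: the first set of relations gives \<open>T(V \<oplus> A)\<close>. Here \<open>l\<close>, \<open>kV\<close>, \<open>kA\<close> are the maps
  \<open>(a, v) \<mapsto> \<lambda>(a, v)\<close>, \<open>(v, v') \<mapsto> \<kappa>\<^sub>V(v, v')\<close> and \<open>(v, v') \<mapsto> \<kappa>\<^sub>A(v, v')\<close>.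
\<close>

definition smash_ideal ::
  "('k::comm_ring_1 \<Rightarrow> 'a::ring_1 \<Rightarrow> 'a) \<Rightarrow> ('a \<Rightarrow> ('a \<times> 'a \<Rightarrow>\<^sub>0 'k) set)
    \<Rightarrow> ('k \<Rightarrow> 'v::ab_group_add \<Rightarrow> 'v) \<Rightarrow> ('a \<Rightarrow> 'v \<Rightarrow> 'v)
    \<Rightarrow> ('a \<Rightarrow> 'v \<Rightarrow> 'a) \<Rightarrow> ('v \<Rightarrow> 'v \<Rightarrow> 'v) \<Rightarrow> ('v \<Rightarrow> 'v \<Rightarrow> 'a)
    \<Rightarrow> (('v \<times> 'a) fword \<Rightarrow>\<^sub>0 'k) set" where
  "smash_ideal scA \<Delta> scV act l kV kA = two_sided_ideal hull
     (tensor_algebra_rels (sum_scale scV scA)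
      \<union> {inA (a * b) - inA a * inA b | a b. True} \<union> {inA 1 - 1}
      \<union> {inA a * inV v - sweedler2 fscale \<Delta> (\<lambda>x y. inV (act x v) * inA y) a - inA (l a v)
           | a v. True}
      \<union> {inV v * inV v' - inV v' * inV v - (inV (kV v v') + inA (kA v v')) | v v'. True})"

text \<open>
  \<open>words_deg n\<close>: span of the products of elements of \<open>V\<close> and \<open>A\<close> having exactly \<open>n\<close> factors from
  \<open>V\<close>; \<open>words_below n\<close>: the same with fewer than \<open>n\<close> factors from \<open>V\<close>.
\<close>

definition gen_word :: "('v::zero + 'a::zero) list \<Rightarrow> (('v \<times> 'a) fword \<Rightarrow>\<^sub>0 'k::comm_ring_1)" where
  "gen_word xs = prod_list (map (case_sum inV inA) xs)"

definition words_deg :: "nat \<Rightarrow> (('v::zero \<times> 'a::zero) fword \<Rightarrow>\<^sub>0 'k::comm_ring_1) set" where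
  "words_deg n = module.span fscale {gen_word xs | xs. length (filter isl xs) = n}"

definition words_below :: "nat \<Rightarrow> (('v::zero \<times> 'a::zero) fword \<Rightarrow>\<^sub>0 'k::comm_ring_1) set" where
  "words_below n = module.span fscale {gen_word xs | xs. length (filter isl xs) < n}"

definition cyclic_sum :: "('v \<Rightarrow> 'v \<Rightarrow> 'v \<Rightarrow> 'm::ab_group_add) \<Rightarrow> 'v \<Rightarrow> 'v \<Rightarrow> 'v \<Rightarrow> 'm" where
  "cyclic_sum f x y z = f x y z + f y z x + f z x y"

text \<open>
  \<open>lam\<close> is a linear map \<open>A \<otimes> V \<rightarrow> A\<close> and \<open>kap\<close> is a linear map \<open>V \<and> V \<rightarrow> V \<oplus> A\<close>, with
  \<open>V \<and> V \<subseteq> V \<otimes> V\<close>.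
\<close>

locale smash_deformation =
  cocommutative_algebra scA \<Delta> + algebra_module scA scV act
  for scA :: "'k::comm_ring_1 \<Rightarrow> 'a::ring_1 \<Rightarrow> 'a"
    and \<Delta> :: "'a \<Rightarrow> ('a \<times> 'a \<Rightarrow>\<^sub>0 'k) set"
    and scV :: "'k \<Rightarrow> 'v::ab_group_add \<Rightarrow> 'v"
    and act :: "'a \<Rightarrow> 'v \<Rightarrow> 'v" +
  fixes lam :: "('a \<times> 'v \<Rightarrow>\<^sub>0 'k) set \<Rightarrow> 'a"
    and kap :: "('v \<times> 'v \<Rightarrow>\<^sub>0 'k) set \<Rightarrow> 'v \<times> 'a"
  assumes lam_linear: "quot_linear fscale scA (tens_rel scA scV) UNIV lam"
    and kap_linear: "quot_linear fscale (sum_scale scV scA) (tens_rel scV scV) wedge_span kap"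
begin

definition l :: "'a \<Rightarrow> 'v \<Rightarrow> 'a" where
  "l a v = lam (tens scA scV a v)"

definition kV :: "'v \<Rightarrow> 'v \<Rightarrow> 'v" where
  "kV v v' = fst (kap (wedge scV v v'))"

definition kA :: "'v \<Rightarrow> 'v \<Rightarrow> 'a" where
  "kA v v' = snd (kap (wedge scV v v'))"

text \<open>\<open>H\<^sub>\<lambda>\<^sub>,\<^sub>\<kappa>\<close> and \<open>H\<^sub>0\<^sub>,\<^sub>0\<close> are the quotients by the following two ideals.\<close>

definition H_ideal :: "(('v \<times> 'a) fword \<Rightarrow>\<^sub>0 'k) set" where
  "H_ideal = smash_ideal scA \<Delta> scV act l kV kA"

definition H00_ideal :: "(('v \<times> 'a) fword \<Rightarrow>\<^sub>0 'k) set" where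
  "H00_ideal = smash_ideal scA \<Delta> scV act (\<lambda>_ _. 0) (\<lambda>_ _. 0) (\<lambda>_ _. 0)"

subsection \<open>The PBW property\<close>

text \<open>
  Let \<open>F\<^sub>n\<close> be the image of \<open>words_below (n + 1)\<close> in \<open>H\<^sub>\<lambda>\<^sub>,\<^sub>\<kappa>\<close>, so that \<open>F\<^sub>n / F\<^sub>n\<^sub>-\<^sub>1\<close> is the image of
  \<open>words_below (n + 1)\<close> in the quotient of the free algebra by \<open>H_ideal + words_below n\<close>. The algebra
  \<open>H\<^sub>0\<^sub>,\<^sub>0\<close> is graded by \<open>deg A = 0\<close>, \<open>deg V = 1\<close>, and the natural surjection onto the associated
  graded algebra is homogeneous: it sends the class of \<open>p \<in> words_deg n\<close> in \<open>H\<^sub>0\<^sub>,\<^sub>0\<close> to the class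
  of \<open>p\<close> in \<open>F\<^sub>n / F\<^sub>n\<^sub>-\<^sub>1\<close>. Hence it is an isomorphism iff it is bijective in every degree.
\<close>

definition gr_rel :: "nat \<Rightarrow> (('v \<times> 'a) fword \<Rightarrow>\<^sub>0 'k) set" where
  "gr_rel n = {x + y | x y. x \<in> H_ideal \<and> y \<in> words_below n}"

definition gr_component :: "nat \<Rightarrow> (('v \<times> 'a) fword \<Rightarrow>\<^sub>0 'k) set set" where
  "gr_component n = qcls (gr_rel n) ` words_below (Suc n)"

definition H00_component :: "nat \<Rightarrow> (('v \<times> 'a) fword \<Rightarrow>\<^sub>0 'k) set set" where
  "H00_component n = qcls H00_ideal ` words_deg n"

definition gr_map ::
  "nat \<Rightarrow> (('v \<times> 'a) fword \<Rightarrow>\<^sub>0 'k) set \<Rightarrow> (('v \<times> 'a) fword \<Rightarrow>\<^sub>0 'k) set" where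
  "gr_map n X = qcls (gr_rel n) (qrep (X \<inter> words_deg n))"

definition PBW_property :: bool where
  "PBW_property \<longleftrightarrow> (\<forall>n. bij_betw (gr_map n) (H00_component n) (gr_component n))"

text \<open>
  The PBW property for a basis \<open>B\<close> of \<open>V\<close>, totally ordered by \<open>r\<close>, and a basis \<open>J\<close> of \<open>A\<close>:
  the family of all \<open>X \<cdot> a\<close>, with \<open>X\<close> a non-decreasing word in \<open>B\<close> and \<open>a \<in> J\<close>, spans
  \<open>H\<^sub>\<lambda>\<^sub>,\<^sub>\<kappa>\<close> and is linearly independent in it.
\<close>

definition PBW_index :: "'v set \<Rightarrow> 'v rel \<Rightarrow> 'a set \<Rightarrow> ('v list \<times> 'a) set" where
  "PBW_index B r J = {(w, a). set w \<subseteq> B \<and> sorted_wrt (\<lambda>x y. (x, y) \<in> r) w \<and> a \<in> J}"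

definition PBW_comb :: "('v list \<times> 'a \<Rightarrow>\<^sub>0 'k) \<Rightarrow> (('v \<times> 'a) fword \<Rightarrow>\<^sub>0 'k)" where
  "PBW_comb c = lin_ext fscale (\<lambda>(w, a). prod_list (map inV w) * inA a) c"

definition PBW_for_bases :: "'v set \<Rightarrow> 'v rel \<Rightarrow> 'a set \<Rightarrow> bool" where
  "PBW_for_bases B r J \<longleftrightarrow>
     (\<forall>h\<in>range (qcls H_ideal). \<exists>c. Poly_Mapping.keys c \<subseteq> PBW_index B r J \<and> h = qcls H_ideal (PBW_comb c)) \<and>
     (\<forall>c. Poly_Mapping.keys c \<subseteq> PBW_index B r J \<longrightarrow> qcls H_ideal (PBW_comb c) = qcls H_ideal 0 \<longrightarrow> c = 0)"

subsection \<open>The natural map \<open>A \<oplus> (V \<otimes> A) \<rightarrow> H\<^sub>\<lambda>\<^sub>,\<^sub>\<kappa>\<close>\<close>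

definition natural_map :: "'a \<times> ('v \<times> 'a \<Rightarrow>\<^sub>0 'k) set \<Rightarrow> (('v \<times> 'a) fword \<Rightarrow>\<^sub>0 'k) set" where
  "natural_map = (\<lambda>(a, t). qcls H_ideal (inA a + lin_ext fscale (\<lambda>(v, b). inV v * inA b) (qrep t)))"

definition natural_map_injective :: bool where
  "natural_map_injective \<longleftrightarrow> inj_on natural_map (UNIV \<times> tens_space scV scA)"

subsection \<open>The compatibility conditions\<close>

text \<open>Equality in \<open>V \<otimes> A\<close> of two elements given by representatives.\<close>

definition eq_VA :: "('v \<times> 'a \<Rightarrow>\<^sub>0 'k) \<Rightarrow> ('v \<times> 'a \<Rightarrow>\<^sub>0 'k) \<Rightarrow> bool" where
  "eq_VA p q \<longleftrightarrow> qcls (tens_rel scV scA) p = qcls (tens_rel scV scA) q"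

definition cond_a :: bool where
  "cond_a \<longleftrightarrow> (\<forall>a a' v.
     l (a * a') v = a * l a' v + sweedler2 scA \<Delta> (\<lambda>x y. l a (act x v) * y) a')"

definition cond_b :: bool where
  "cond_b \<longleftrightarrow> (\<forall>a v v'.
     a * kA v v' - sweedler3 scA \<Delta> (\<lambda>x y z. kA (act x v) (act y v') * z) a
       = l (l a v) v' - l (l a v') v - l a (kV v v') \<and>
     eq_VA
       (sweedler2 fscale \<Delta> (\<lambda>x y. pt (act x (kV v v'), y)) a
         - sweedler3 fscale \<Delta> (\<lambda>x y z. pt (kV (act x v) (act y v'), z)) a)
       (sweedler2 fscale \<Delta> (\<lambda>x y. pt (act x v', y)) (l a v)
         - sweedler2 fscale \<Delta> (\<lambda>x y. pt (act x v, y)) (l a v')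
         + sweedler2 fscale \<Delta> (\<lambda>x y. pt (act x v, l y v')) a
         - sweedler2 fscale \<Delta> (\<lambda>x y. pt (act x v', l y v)) a))"

definition cond_c :: bool where
  "cond_c \<longleftrightarrow> (\<forall>v1 v2 v3.
     cyclic_sum (\<lambda>x y z. l (kA x y) z) v1 v2 v3
       = cyclic_sum (\<lambda>x y z. kA x (kV y z)) v1 v2 v3 \<and>
     eq_VA
       (cyclic_sum (\<lambda>x y z. pt (kV (kV x y) z, 1)) v1 v2 v3)
       (cyclic_sum (\<lambda>x y z. pt (x, kA y z)) v1 v2 v3
         - cyclic_sum (\<lambda>x y z. sweedler2 fscale \<Delta> (\<lambda>a b. pt (act a z, b)) (kA x y)) v1 v2 v3))"

end

end

theory Submission
  imports Defs
begin

text \<open>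
  Let \<open>F\<close> be the free algebra on \<open>V \<oplus> A\<close>. Leave out the relations
  \<open>vv' - v'v = \<kappa>(v, v')\<close> and let \<open>skew_ideal\<close> be the ideal of the others; they allow every
  element of \<open>A\<close> to be moved to the right past \<open>V\<close>. Write \<open>c(v, v') = vv' - v'v - \<kappa>(v, v')\<close>.
  Three elements can be reduced in two ways modulo \<open>skew_ideal\<close>: \<open>(aa')v\<close>, \<open>a c(v, v')\<close>, and the
  cyclic sum of \<open>[c(v\<^sub>1, v\<^sub>2), v\<^sub>3] + c(\<kappa>\<^sub>V(v\<^sub>1, v\<^sub>2), v\<^sub>3)\<close>, which is given by the Jacobi identity of the
  commutator. Comparing the results (\<open>skew_identity_a\<close>, \<open>skew_identity_b\<close>, \<open>skew_identity_c\<close>) shows that the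
  map \<open>a + v \<otimes> b \<mapsto> a + vb\<close> on representatives sends the difference of the two sides of (a), (b), (c) to
  \<open>skew_ideal\<close>, up to multiples of elements \<open>c(v, v')\<close>. So this difference becomes zero in \<open>H\<^sub>\<lambda>\<^sub>,\<^sub>\<kappa>\<close>, and if the natural map is
  injective, then (a), (b), (c) hold.

  For the converse, fix an ordered basis of \<open>V\<close> and let \<open>F\<close> act on the right \<open>A\<close>-module
  \<open>T(V) \<otimes> A\<close>: vectors act by prepending a letter, and the action of \<open>A\<close> is defined by
  recursion on words so that the relation for \<open>av\<close> holds. Condition (a) makes this an action of the
  algebra \<open>A\<close>, so that \<open>skew_ideal\<close> acts by zero (\<open>rep_skew\<close>). The remaining relations become a rewriting
  system that sorts words. All its rules are right \<open>A\<close>-linear, so it is resolved by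
  a linear form of Newman's lemma (\<open>diamond_lemma\<close>). Condition (b) makes the submodule spanned by the rules
  stable under \<open>A\<close> (\<open>L_relators\<close>), which is needed when two rules apply to disjoint parts of a word
  (\<open>confluent_disjoint\<close>), and condition (c) resolves the overlaps \<open>xyz\<close> (\<open>confluent_overlap\<close>). The resulting
  normal form map kills the image of the defining ideal of \<open>H\<^sub>\<lambda>\<^sub>,\<^sub>\<kappa>\<close> and fixes the sorted words, hence the ordered
  monomials are independent over \<open>A\<close> (\<open>conditions_imp_independent\<close>).

  Independence gives injectivity of the natural map by looking at words of length at most one
  (\<open>independent_imp_injective\<close>), and the PBW property for bases because the ordered monomials always span
  (\<open>PBW_for_bases_iff\<close>). For the associated graded algebra the same results are applied to
  \<open>H\<^sub>0\<^sub>,\<^sub>0\<close> as well, whose conditions (a), (b), (c) are trivial: the natural surjection identifies ordered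
  monomials with ordered monomials, because every word is sorted by the same steps in both algebras, up to terms of
  lower degree (\<open>words_deg_reducible\<close>).
\<close>

section \<open>Congruence modulo a subgroup\<close>

abbreviation (input) "single \<equiv> Poly_Mapping.single"
abbreviation (input) "keys \<equiv> Poly_Mapping.keys"
abbreviation (input) "lookup \<equiv> Poly_Mapping.lookup"

text \<open>
  The algebras are not types but quotients of free modules. All computations in them are therefore done
  with representatives, modulo a subgroup \<open>N\<close>; the case \<open>N = {0}\<close> is equality.
\<close>

definition cong_mod :: "'m::ab_group_add \<Rightarrow> 'm set \<Rightarrow> 'm \<Rightarrow> bool" (\<open>(_ \<approx>[_] _)\<close> [51, 0, 51] 50)
  where "x \<approx>[N] y \<longleftrightarrow> x - y \<in> N"

definition add_subgroup :: "'m::ab_group_add set \<Rightarrow> bool" where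
  "add_subgroup N \<longleftrightarrow> 0 \<in> N \<and> (\<forall>x\<in>N. \<forall>y\<in>N. x + y \<in> N) \<and> (\<forall>x\<in>N. - x \<in> N)"

lemma add_subgroup_zero: "add_subgroup {0}"
  by (simp add: add_subgroup_def)

lemma add_subgroup_diff: "add_subgroup N \<Longrightarrow> x \<in> N \<Longrightarrow> y \<in> N \<Longrightarrow> x - y \<in> N"
  unfolding add_subgroup_def by (metis diff_conv_add_uminus)

lemma cong_mod_zero [simp]: "x \<approx>[{0}] y \<longleftrightarrow> x = y"
  by (simp add: cong_mod_def)

context
  fixes N :: "'m::ab_group_add set"
  assumes N: "add_subgroup N"
begin

lemma cong_refl: "x \<approx>[N] x"
  using N by (simp add: cong_mod_def add_subgroup_def)

lemma cong_sym: "x \<approx>[N] y \<Longrightarrow> y \<approx>[N] x"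
  using N unfolding cong_mod_def add_subgroup_def by (metis minus_diff_eq)

lemma cong_trans: "x \<approx>[N] y \<Longrightarrow> y \<approx>[N] z \<Longrightarrow> x \<approx>[N] z"
  using N unfolding cong_mod_def add_subgroup_def by (metis diff_add_cancel add_diff_eq)

lemma cong_add: "x \<approx>[N] y \<Longrightarrow> x' \<approx>[N] y' \<Longrightarrow> x + x' \<approx>[N] y + y'"
  using N unfolding cong_mod_def add_subgroup_def by (metis add_diff_add)

lemma cong_minus: "x \<approx>[N] y \<Longrightarrow> - x \<approx>[N] - y"
  using N unfolding cong_mod_def add_subgroup_def by (metis minus_diff_minus)

lemma cong_diff: "x \<approx>[N] y \<Longrightarrow> x' \<approx>[N] y' \<Longrightarrow> x - x' \<approx>[N] y - y'"
  using cong_add[OF _ cong_minus] by fastforce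

lemma cong_sum: "(\<And>x. x \<in> S \<Longrightarrow> f x \<approx>[N] g x) \<Longrightarrow> sum f S \<approx>[N] sum g S"
  by (induction S rule: infinite_finite_induct) (auto intro: cong_refl cong_add)

lemma cong_mem_iff: "x \<approx>[N] y \<Longrightarrow> x \<in> N \<longleftrightarrow> y \<in> N"
  using N unfolding cong_mod_def add_subgroup_def
  by (metis add_diff_cancel_left' diff_add_cancel diff_conv_add_uminus minus_diff_eq)

lemma cong_0_iff: "x \<approx>[N] 0 \<longleftrightarrow> x \<in> N"
  by (simp add: cong_mod_def)

lemma cong_iff_mem: "x \<approx>[N] y \<longleftrightarrow> x - y \<in> N"
  by (simp add: cong_mod_def)

lemma qcls_eq_iff: "qcls N x = qcls N y \<longleftrightarrow> x \<approx>[N] y"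
proof
  assume "qcls N x = qcls N y"
  moreover have "x \<in> qcls N x" using cong_refl[of x] by (simp add: qcls_def cong_mod_def)
  ultimately show "x \<approx>[N] y" by (simp add: qcls_def cong_mod_def)
next
  assume xy: "x \<approx>[N] y"
  have "z - x \<in> N \<longleftrightarrow> z - y \<in> N" for z
    using cong_trans[of z x y] cong_trans[of z y x] cong_sym[OF xy] xy
    by (auto simp: cong_mod_def)
  then show "qcls N x = qcls N y" by (auto simp: qcls_def)
qed

lemma qrep_qcls: "qrep (qcls N x) \<approx>[N] x"
  unfolding qrep_def cong_mod_def
  by (rule someI2[of _ x]) (use cong_refl[of x] in \<open>auto simp: qcls_def cong_mod_def\<close>)

lemma additive_mod_zero:
  assumes "\<And>a b :: 'b::ab_group_add. g (a + b) \<approx>[N] g a + g b" shows "g 0 \<approx>[N] 0"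
  using cong_minus[OF assms[of 0 0]] N by (simp add: cong_mod_def add_subgroup_def)

end

text \<open>
  Extension of a family of functions of the coefficients to a function on finitely supported families. The coefficients
  may come from \<open>'k\<close> or from \<open>'a\<close>, and \<open>g x\<close> may be additive only modulo a subgroup.
\<close>

definition keys_sum :: "('x \<Rightarrow> 'b::zero \<Rightarrow> 'm::comm_monoid_add) \<Rightarrow> ('x \<Rightarrow>\<^sub>0 'b) \<Rightarrow> 'm" where
  "keys_sum g p = (\<Sum>x\<in>keys p. g x (lookup p x))"

lemma keys_sum_superset:
  assumes N: "add_subgroup N" and "\<And>x. g x 0 \<approx>[N] 0" "finite S" "keys p \<subseteq> S"
  shows "keys_sum g p \<approx>[N] (\<Sum>x\<in>S. g x (lookup p x))"
proof -
  have "(\<Sum>x\<in>S. g x (lookup p x)) =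
      (\<Sum>x\<in>S - keys p. g x (lookup p x)) + keys_sum g p"
    unfolding keys_sum_def by (rule sum.subset_diff) (use assms in auto)
  moreover have "(\<Sum>x\<in>S - keys p. g x (lookup p x)) \<approx>[N] (\<Sum>x\<in>S - keys p. 0)"
    by (rule cong_sum[OF N]) (use assms(2) in \<open>auto simp: in_keys_iff\<close>)
  ultimately show ?thesis
    using cong_sym[OF N cong_add[OF N _ cong_refl[OF N]]] by fastforce
qed

lemma keys_sum_add:
  assumes N: "add_subgroup N" and g: "\<And>x a b. g x (a + b) \<approx>[N] g x a + g x b"
  shows "keys_sum g (p + q) \<approx>[N] keys_sum g p + keys_sum g (q :: 'x \<Rightarrow>\<^sub>0 'b::ab_group_add)"
proof -
  have g0: "g x 0 \<approx>[N] 0" for x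
    by (rule additive_mod_zero[OF N, of "g x"]) (rule g)
  let ?S = "keys p \<union> keys q"
  note sup = keys_sum_superset[OF N, of g, OF g0, of ?S]
  have "keys_sum g (p + q) \<approx>[N] (\<Sum>x\<in>?S. g x (lookup (p + q) x))"
    by (rule sup) (use keys_add[of p q] in auto)
  moreover have "(\<Sum>x\<in>?S. g x (lookup (p + q) x)) \<approx>[N]
      (\<Sum>x\<in>?S. g x (lookup p x) + g x (lookup q x))"
    by (rule cong_sum[OF N]) (auto simp: lookup_add g)
  moreover have "(\<Sum>x\<in>?S. g x (lookup p x) + g x (lookup q x))
      \<approx>[N] keys_sum g p + keys_sum g q"
    unfolding sum.distrib by (rule cong_add[OF N]; rule cong_sym[OF N]; rule sup) auto
  ultimately show ?thesis using cong_trans[OF N] by blast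
qed

lemma keys_sum_single: "g x 0 = 0 \<Longrightarrow> keys_sum g (single x a) = g x a"
  by (cases "a = 0") (simp_all add: keys_sum_def)

lemma poly_mapping_sum_single:
  "(\<Sum>x\<in>keys p. single x (lookup p x)) = p"
  by (rule poly_mapping_eqI)
    (auto simp: lookup_sum lookup_single when_def in_keys_iff)

lemma poly_mapping_additive_induct [case_names zero single add]:
  assumes "P 0" "\<And>x a. P (single x a)" "\<And>p q. P p \<Longrightarrow> P q \<Longrightarrow> P (p + q)"
  shows "P (p :: 'x \<Rightarrow>\<^sub>0 'b::comm_monoid_add)"
proof -
  have "P (sum f S)" if "\<And>x. P (f x)" for S and f :: "'x \<Rightarrow> 'x \<Rightarrow>\<^sub>0 'b"
    by (induction S rule: infinite_finite_induct) (simp_all add: assms that)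
  from this[of "\<lambda>x. single x (lookup p x)" "keys p"]
  show ?thesis by (simp add: poly_mapping_sum_single assms)
qed

section \<open>Linear maps modulo a submodule\<close>

lemma subspace_add_subgroup: "module s \<Longrightarrow> module.subspace s N \<Longrightarrow> add_subgroup N"
  by (simp add: add_subgroup_def module.subspace_0 module.subspace_add module.subspace_neg)

text \<open>
  Maps into a free module, such as \<open>(v, b) \<mapsto> vb\<close>, are multilinear only modulo the relations.
\<close>

definition linear_mod ::
  "('k \<Rightarrow> 'm \<Rightarrow> 'm) \<Rightarrow> ('k \<Rightarrow> 'n \<Rightarrow> 'n) \<Rightarrow> 'n set \<Rightarrow> ('m::ab_group_add \<Rightarrow> 'n::ab_group_add) \<Rightarrow> bool" where
  "linear_mod s t N f \<longleftrightarrow>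
     (\<forall>x y. f (x + y) \<approx>[N] f x + f y) \<and> (\<forall>c x. f (s c x) \<approx>[N] t c (f x))"

definition bilinear_mod ::
  "('k \<Rightarrow> 'm \<Rightarrow> 'm) \<Rightarrow> ('k \<Rightarrow> 'm' \<Rightarrow> 'm') \<Rightarrow> ('k \<Rightarrow> 'n \<Rightarrow> 'n) \<Rightarrow> 'n set
    \<Rightarrow> ('m::ab_group_add \<Rightarrow> 'm'::ab_group_add \<Rightarrow> 'n::ab_group_add) \<Rightarrow> bool" where
  "bilinear_mod s s' t N f \<longleftrightarrow>
     (\<forall>y. linear_mod s t N (\<lambda>x. f x y)) \<and> (\<forall>x. linear_mod s' t N (f x))"

definition trilinear_mod ::
  "('k \<Rightarrow> 'm \<Rightarrow> 'm) \<Rightarrow> ('k \<Rightarrow> 'n \<Rightarrow> 'n) \<Rightarrow> 'n set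
    \<Rightarrow> ('m::ab_group_add \<Rightarrow> 'm \<Rightarrow> 'm \<Rightarrow> 'n::ab_group_add) \<Rightarrow> bool" where
  "trilinear_mod s t N f \<longleftrightarrow>
     (\<forall>y z. linear_mod s t N (\<lambda>x. f x y z)) \<and> (\<forall>x z. linear_mod s t N (\<lambda>y. f x y z))
     \<and> (\<forall>x y. linear_mod s t N (\<lambda>z. f x y z))"

lemma module_homI: "module s \<Longrightarrow> module t \<Longrightarrow> (\<And>x y. f (x + y) = f x + f y) \<Longrightarrow>
    (\<And>c x. f (s c x) = t c (f x)) \<Longrightarrow> module_hom s t f"
  by (simp add: module_hom_def module_hom_axioms_def)

lemma linear_modI:
  "(\<And>x y. f (x + y) \<approx>[N] f x + f y) \<Longrightarrow> (\<And>c x. f (s c x) \<approx>[N] t c (f x)) \<Longrightarrow> linear_mod s t N f"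
  by (simp add: linear_mod_def)

lemma linear_modD:
  assumes "linear_mod s t N f"
  shows "f (x + y) \<approx>[N] f x + f y" "f (s c x) \<approx>[N] t c (f x)"
  using assms by (auto simp: linear_mod_def)

lemma fscale_minus_1: "fscale (- 1) p = - p"
  by (rule poly_mapping_eqI) (simp add: lookup_fscale)

lemma fscale_pt: "fscale c (pt x) = single x c"
  by (rule poly_mapping_eqI) (simp add: lookup_fscale pt_def lookup_single when_def)

interpretation F: module fscale by (rule module_fscale)

context
  fixes t :: "'k::comm_ring_1 \<Rightarrow> 'n::ab_group_add \<Rightarrow> 'n"
  assumes t: "module t"
begin

interpretation t: module t by (rule t)

lemma lin_ext_eq_keys_sum: "lin_ext t f p = keys_sum (\<lambda>x c. t c (f x)) p"
  by (simp add: lin_ext_def keys_sum_def)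

lemma lin_ext_add: "lin_ext t f (p + q) = lin_ext t f p + lin_ext t f q"
  unfolding lin_ext_eq_keys_sum
  using keys_sum_add[OF add_subgroup_zero, of "\<lambda>x c. t c (f x)" p q]
  by (simp add: t.scale_left_distrib)

lemma lin_ext_zero [simp]: "lin_ext t f 0 = 0"
  by (simp add: lin_ext_def)

lemma lin_ext_single: "lin_ext t f (single x c) = t c (f x)"
  unfolding lin_ext_eq_keys_sum by (rule keys_sum_single) simp

lemma lin_ext_pt [simp]: "lin_ext t f (pt x) = f x"
  by (simp add: pt_def lin_ext_single)

lemma lin_ext_scale: "lin_ext t f (fscale c p) = t c (lin_ext t f p)"
proof (induction p rule: poly_mapping_additive_induct)
  case (single x a)
  have "fscale c (single x a) = single x (c * a)"
    by (rule poly_mapping_eqI) (simp add: lookup_fscale lookup_single when_def)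
  then show ?case by (simp add: lin_ext_single)
qed (simp_all add: F.scale_right_distrib lin_ext_add t.scale_right_distrib)

lemma lin_ext_hom: "module_hom fscale t (lin_ext t f)"
  by (rule module_homI) (auto simp: module_fscale t lin_ext_add lin_ext_scale)

lemma lin_ext_diff: "lin_ext t f (p - q) = lin_ext t f p - lin_ext t f q"
  using lin_ext_hom by (rule module_hom.diff)

lemma hom_lin_ext:
  assumes "module_hom t u h" shows "h (lin_ext t f p) = lin_ext u (\<lambda>x. h (f x)) p"
  unfolding lin_ext_def by (simp add: module_hom.sum[OF assms] module_hom.scale[OF assms])

lemma lin_ext_fun_add: "lin_ext t (\<lambda>x. f x + g x) p = lin_ext t f p + lin_ext t g p"
  by (simp add: lin_ext_def t.scale_right_distrib sum.distrib)

lemma lin_ext_fun_diff: "lin_ext t (\<lambda>x. f x - g x) p = lin_ext t f p - lin_ext t g p"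
  by (simp add: lin_ext_def t.scale_right_diff_distrib sum_subtractf)

lemma lin_ext_fun_scale: "lin_ext t (\<lambda>x. t c (f x)) p = t c (lin_ext t f p)"
  by (simp add: lin_ext_def t.scale_sum_right mult.commute)

lemma lin_ext_swap: "lin_ext t (\<lambda>x. lin_ext t (f x) q) p = lin_ext t (\<lambda>y. lin_ext t (\<lambda>x. f x y) p) q"
  unfolding lin_ext_def t.scale_sum_right
  by (subst sum.swap) (simp add: mult.commute)

lemma lin_ext_lin_ext: "lin_ext t f (lin_ext fscale g p) = lin_ext t (\<lambda>x. lin_ext t f (g x)) p"
  unfolding lin_ext_def[of fscale]
  by (simp add: module_hom.sum[OF lin_ext_hom] lin_ext_scale) (simp add: lin_ext_def)

lemma lin_ext_mem: "t.subspace N \<Longrightarrow> (\<And>x. f x \<in> N) \<Longrightarrow> lin_ext t f p \<in> N"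
  unfolding lin_ext_def by (intro t.subspace_sum t.subspace_scale) auto

lemma lin_ext_cong_mod:
  "t.subspace N \<Longrightarrow> (\<And>x. f x \<approx>[N] g x) \<Longrightarrow> lin_ext t f p \<approx>[N] lin_ext t g p"
  unfolding cong_mod_def using lin_ext_mem[of N "\<lambda>x. f x - g x" p] by (simp add: lin_ext_fun_diff)

text \<open>
  Used with generators \<open>S\<close> of the relations of a tensor product: a multilinear map modulo \<open>N\<close> sends all
  relations to \<open>N\<close>, and so it is defined on the tensor product.
\<close>

lemma lin_ext_mem_span:
  assumes "\<And>x. x \<in> S \<Longrightarrow> lin_ext t f x \<in> N" "t.subspace N" "p \<in> F.span S"
  shows "lin_ext t f p \<in> N"
proof -
  have "F.subspace (lin_ext t f -` N)"
    using assms(2) by (auto simp: F.subspace_def t.subspace_def lin_ext_add lin_ext_scale)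
  then show ?thesis using F.span_minimal[of S "lin_ext t f -` N"] assms by auto
qed

lemma cong_scale: "t.subspace N \<Longrightarrow> x \<approx>[N] y \<Longrightarrow> t c x \<approx>[N] t c y"
  unfolding cong_mod_def by (metis t.scale_right_diff_distrib t.subspace_scale)

lemma linear_mod_lin_ext:
  fixes p :: "'x \<Rightarrow>\<^sub>0 'k"
  assumes s: "module s" and N: "t.subspace N" and h: "linear_mod s t N h"
  shows "h (lin_ext s f p) \<approx>[N] lin_ext t (\<lambda>x. h (f x)) p"
proof -
  interpret s: module s by (rule s)
  have G: "add_subgroup N" using subspace_add_subgroup[OF t N] .
  have h0: "h 0 \<approx>[N] 0" by (rule additive_mod_zero[OF G]) (rule linear_modD(1)[OF h])
  have "h (sum g S) \<approx>[N] sum (\<lambda>x. h (g x)) S" for g and S :: "'x set"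
  proof (induction S rule: infinite_finite_induct)
    case (insert x S)
    then show ?case
      by (auto intro: cong_trans[OF G] linear_modD(1)[OF h] cong_add[OF G] cong_refl[OF G])
  qed (simp_all add: h0)
  then show ?thesis
    unfolding lin_ext_def
    by (blast intro: cong_trans[OF G] cong_sum[OF G] linear_modD(2)[OF h])
qed

lemma lin_rels_mem:
  assumes "linear_mod s t N (\<lambda>x. f (g x))" "p \<in> lin_rels s g"
  shows "lin_ext t f p \<in> N"
  using assms unfolding lin_rels_def linear_mod_def cong_mod_def diff_diff_eq[symmetric]
  by (auto simp: lin_ext_diff lin_ext_scale)

lemma tens_rel_mem:
  assumes "bilinear_mod s s' t N f" "t.subspace N" "p \<in> tens_rel s s'"
  shows "lin_ext t (\<lambda>(x, y). f x y) p \<in> N"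
  using _ assms(2) assms(3)[unfolded tens_rel_def]
proof (rule lin_ext_mem_span)
  fix q assume "q \<in> (\<Union>y. lin_rels s (\<lambda>x. (x, y))) \<union> (\<Union>x. lin_rels s' (\<lambda>y. (x, y)))"
  then consider y where "q \<in> lin_rels s (\<lambda>x. (x, y))" | x where "q \<in> lin_rels s' (\<lambda>y. (x, y))"
    by blast
  then show "lin_ext t (\<lambda>(x, y). f x y) q \<in> N"
    by cases (rule lin_rels_mem, use assms(1) in \<open>auto simp: bilinear_mod_def\<close>)+
qed

lemma tens3_rel_mem:
  assumes "trilinear_mod s t N f" "t.subspace N" "p \<in> tens3_rel s"
  shows "lin_ext t (\<lambda>(x, y, z). f x y z) p \<in> N"
  using _ assms(2) assms(3)[unfolded tens3_rel_def]
proof (rule lin_ext_mem_span)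
  fix q assume "q \<in> (\<Union>y z. lin_rels s (\<lambda>x. (x, y, z))) \<union> (\<Union>x z. lin_rels s (\<lambda>y. (x, y, z)))
       \<union> (\<Union>x y. lin_rels s (\<lambda>z. (x, y, z)))"
  then consider y z where "q \<in> lin_rels s (\<lambda>x. (x, y, z))" | x z where "q \<in> lin_rels s (\<lambda>y. (x, y, z))"
    | x y where "q \<in> lin_rels s (\<lambda>z. (x, y, z))"
    by blast
  then show "lin_ext t (\<lambda>(x, y, z). f x y z) q \<in> N"
    by cases (rule lin_rels_mem, use assms(1) in \<open>auto simp: trilinear_mod_def\<close>)+
qed

end

lemma subspace_tens_rel: "F.subspace (tens_rel s t)"
  by (simp add: tens_rel_def)

lemma subspace_tens3_rel: "F.subspace (tens3_rel s)"
  by (simp add: tens3_rel_def)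

lemma lin_rels_linear_mod:
  assumes "lin_rels s g \<subseteq> N" shows "linear_mod s fscale N (\<lambda>x. pt (g x))"
proof (rule linear_modI)
  show "pt (g (x + y)) \<approx>[N] pt (g x) + pt (g y)" for x y
    unfolding cong_mod_def diff_diff_eq[symmetric] using assms by (auto simp: lin_rels_def)
  show "pt (g (s c x)) \<approx>[N] fscale c (pt (g x))" for c x
    unfolding cong_mod_def using assms by (auto simp: lin_rels_def)
qed

lemma bilinear_mod_pt: "bilinear_mod s t fscale (tens_rel s t) (\<lambda>x y. pt (x, y))"
  unfolding bilinear_mod_def tens_rel_def
  by (intro conjI allI lin_rels_linear_mod order.trans[OF _ F.span_superset]) auto

section \<open>Sweedler sums of maps that are multilinear modulo a submodule\<close>

context cocommutative_algebra
begin

context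
  fixes t :: "'k \<Rightarrow> 'n::ab_group_add \<Rightarrow> 'n" and N :: "'n set"
  assumes t: "module t" and N: "module.subspace t N"
begin

interpretation t: module t by (rule t)

private lemma G: "add_subgroup N"
  using subspace_add_subgroup[OF t N] .

text \<open>
  A Sweedler sum may be computed from any representative of \<open>\<Delta> a\<close>. All laws below come from this and from the
  corresponding axiom on \<open>\<Delta>\<close>.
\<close>

lemma sweedler2_rep:
  assumes "bilinear_mod scA scA t N f" "\<Delta> a = qcls (tens_rel scA scA) p"
  shows "sweedler2 t \<Delta> f a \<approx>[N] lin_ext t (\<lambda>(x, y). f x y) p"
proof -
  have "qrep (\<Delta> a) - p \<in> tens_rel scA scA"
    using assms(2) qrep_qcls[OF subspace_add_subgroup[OF module_fscale subspace_tens_rel]]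
    by (simp add: cong_mod_def)
  from tens_rel_mem[OF t assms(1) N this] show ?thesis
    by (simp add: sweedler2_def cong_mod_def lin_ext_diff[OF t])
qed

lemma sweedler2_linear:
  assumes f: "bilinear_mod scA scA t N f"
  shows "linear_mod scA t N (sweedler2 t \<Delta> f)"
proof (rule linear_modI)
  show "sweedler2 t \<Delta> f (a + b) \<approx>[N] sweedler2 t \<Delta> f a + sweedler2 t \<Delta> f b" for a b
    using sweedler2_rep[OF f \<Delta>_add] by (simp add: sweedler2_def lin_ext_add[OF t])
  show "sweedler2 t \<Delta> f (scA c a) \<approx>[N] t c (sweedler2 t \<Delta> f a)" for c a
    using sweedler2_rep[OF f \<Delta>_scale] by (simp add: sweedler2_def lin_ext_scale[OF t])
qed

lemma sweedler2_one:
  assumes f: "bilinear_mod scA scA t N f"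
  shows "sweedler2 t \<Delta> f 1 \<approx>[N] f 1 1"
  using sweedler2_rep[OF f \<Delta>_one[unfolded tens_def]] by (simp add: lin_ext_pt[OF t])

lemma sweedler2_mult:
  assumes f: "bilinear_mod scA scA t N f"
  shows "sweedler2 t \<Delta> f (a * b) \<approx>[N]
    sweedler2 t \<Delta> (\<lambda>x y. sweedler2 t \<Delta> (\<lambda>x' y'. f (x * x') (y * y')) b) a"
  using sweedler2_rep[OF f \<Delta>_mult]
  by (simp add: sweedler2_def tens_mult_def case_prod_unfold lin_ext_lin_ext[OF t] lin_ext_pt[OF t])

lemma sweedler2_commute:
  assumes f: "bilinear_mod scA scA t N f"
  shows "sweedler2 t \<Delta> f a \<approx>[N] sweedler2 t \<Delta> (\<lambda>x y. f y x) a"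
  using sweedler2_rep[OF f \<Delta>_cocomm]
  by (simp add: sweedler2_def case_prod_unfold lin_ext_lin_ext[OF t] lin_ext_pt[OF t])

lemma sweedler2_cong:
  "(\<And>x y. f x y \<approx>[N] g x y) \<Longrightarrow> sweedler2 t \<Delta> f a \<approx>[N] sweedler2 t \<Delta> g a"
  unfolding sweedler2_def by (rule lin_ext_cong_mod[OF t N]) auto

lemma sweedler2_mem: "(\<And>x y. f x y \<in> N) \<Longrightarrow> sweedler2 t \<Delta> f a \<in> N"
  unfolding sweedler2_def by (rule lin_ext_mem[OF t N]) auto

lemma sweedler2_param_linear:
  assumes "\<And>x y. linear_mod s t N (\<lambda>w. f w x y)"
  shows "linear_mod s t N (\<lambda>w. sweedler2 t \<Delta> (f w) a)"
proof (rule linear_modI)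
  fix w w' c
  have "sweedler2 t \<Delta> (f (w + w')) a \<approx>[N] sweedler2 t \<Delta> (\<lambda>x y. f w x y + f w' x y) a"
    by (rule sweedler2_cong) (rule linear_modD(1)[OF assms])
  then show "sweedler2 t \<Delta> (f (w + w')) a \<approx>[N] sweedler2 t \<Delta> (f w) a + sweedler2 t \<Delta> (f w') a"
    by (simp add: sweedler2_def case_prod_unfold lin_ext_fun_add[OF t])
  have "sweedler2 t \<Delta> (f (s c w)) a \<approx>[N] sweedler2 t \<Delta> (\<lambda>x y. t c (f w x y)) a"
    by (rule sweedler2_cong) (rule linear_modD(2)[OF assms])
  then show "sweedler2 t \<Delta> (f (s c w)) a \<approx>[N] t c (sweedler2 t \<Delta> (f w) a)"
    by (simp add: sweedler2_def case_prod_unfold lin_ext_fun_scale[OF t])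
qed

lemma sweedler2_fun_add:
  "sweedler2 t \<Delta> (\<lambda>x y. f x y + g x y) a = sweedler2 t \<Delta> f a + sweedler2 t \<Delta> g a"
  by (simp add: sweedler2_def case_prod_unfold lin_ext_fun_add[OF t])

lemma hom_sweedler2:
  assumes "module_hom s t h"
  shows "h (sweedler2 s \<Delta> f a) = sweedler2 t \<Delta> (\<lambda>x y. h (f x y)) a"
  using assms unfolding sweedler2_def
  by (subst hom_lin_ext[OF module_hom.axioms(1)]) (auto simp: case_prod_unfold)

lemma linear_mod_sweedler2:
  assumes "module s" "linear_mod s t N h"
  shows "h (sweedler2 s \<Delta> f a) \<approx>[N] sweedler2 t \<Delta> (\<lambda>x y. h (f x y)) a"
  using linear_mod_lin_ext[OF t assms(1) N assms(2)]
  unfolding sweedler2_def case_prod_unfold .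

lemma sweedler2_swap:
  "sweedler2 t \<Delta> (\<lambda>x y. sweedler2 t \<Delta> (f x y) b) a =
   sweedler2 t \<Delta> (\<lambda>x' y'. sweedler2 t \<Delta> (\<lambda>x y. f x y x' y') a) b"
  unfolding sweedler2_def case_prod_unfold by (rule lin_ext_swap[OF t])

lemma sweedler3_eq:
  "sweedler3 t \<Delta> f a = sweedler2 t \<Delta> (\<lambda>x z. sweedler2 t \<Delta> (\<lambda>x' x''. f x' x'' z) x) a"
  by (simp add: sweedler3_def sweedler2_def coprod_left_def case_prod_unfold
      lin_ext_lin_ext[OF t] lin_ext_pt[OF t])

lemma sweedler3_coassoc:
  assumes f: "trilinear_mod scA t N f"
  shows "sweedler3 t \<Delta> f a \<approx>[N] sweedler2 t \<Delta> (\<lambda>x z. sweedler2 t \<Delta> (\<lambda>z' z''. f x z' z'') z) a"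
proof -
  have "coprod_left \<Delta> (qrep (\<Delta> a)) - coprod_right \<Delta> (qrep (\<Delta> a)) \<in> tens3_rel scA"
    using \<Delta>_coassoc[of a] qcls_eq_iff[OF subspace_add_subgroup[OF module_fscale subspace_tens3_rel[of scA]]]
    by (simp add: cong_mod_def)
  from tens3_rel_mem[OF t f N this] show ?thesis
    by (simp add: sweedler3_def sweedler2_def coprod_right_def case_prod_unfold cong_mod_def
      lin_ext_diff[OF t] lin_ext_lin_ext[OF t] lin_ext_pt[OF t])
qed

lemma sweedler3_commute:
  assumes f: "trilinear_mod scA t N f"
  shows "sweedler3 t \<Delta> f a \<approx>[N] sweedler3 t \<Delta> (\<lambda>x y z. f y x z) a"
  unfolding sweedler3_eq
proof (rule sweedler2_cong)
  fix x z
  have "bilinear_mod scA scA t N (\<lambda>x' x''. f x' x'' z)"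
    using f by (simp add: trilinear_mod_def bilinear_mod_def)
  from sweedler2_commute[OF this]
  show "sweedler2 t \<Delta> (\<lambda>x' x''. f x' x'' z) x \<approx>[N] sweedler2 t \<Delta> (\<lambda>x' x''. f x'' x' z) x" .
qed

lemma sweedler3_cong:
  "(\<And>x y z. f x y z \<approx>[N] g x y z) \<Longrightarrow> sweedler3 t \<Delta> f a \<approx>[N] sweedler3 t \<Delta> g a"
  unfolding sweedler3_eq by (intro sweedler2_cong)

lemma sweedler3_mem: "(\<And>x y z. f x y z \<in> N) \<Longrightarrow> sweedler3 t \<Delta> f a \<in> N"
  unfolding sweedler3_eq by (intro sweedler2_mem)

lemma sweedler3_fun_add:
  "sweedler3 t \<Delta> (\<lambda>x y z. f x y z + g x y z) a = sweedler3 t \<Delta> f a + sweedler3 t \<Delta> g a"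
  by (simp add: sweedler3_def case_prod_unfold lin_ext_fun_add[OF t])

lemma sweedler3_fun_diff:
  "sweedler3 t \<Delta> (\<lambda>x y z. f x y z - g x y z) a = sweedler3 t \<Delta> f a - sweedler3 t \<Delta> g a"
  by (simp add: sweedler3_def case_prod_unfold lin_ext_fun_diff[OF t])

lemma hom_sweedler3:
  assumes "module_hom s t h"
  shows "h (sweedler3 s \<Delta> f a) = sweedler3 t \<Delta> (\<lambda>x y z. h (f x y z)) a"
  using assms unfolding sweedler3_def
  by (subst hom_lin_ext[OF module_hom.axioms(1)]) (auto simp: case_prod_unfold)

lemma linear_mod_sweedler3:
  assumes "module s" "linear_mod s t N h"
  shows "h (sweedler3 s \<Delta> f a) \<approx>[N] sweedler3 t \<Delta> (\<lambda>x y z. h (f x y z)) a"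
  using linear_mod_lin_ext[OF t assms(1) N assms(2)]
  unfolding sweedler3_def case_prod_unfold .

end

end

section \<open>Ideals of free algebras and automation for linearity\<close>

lemma fscale_conv_mult: "fscale c p = single 0 c * (p :: 'x::monoid_add \<Rightarrow>\<^sub>0 'k::comm_ring_1)"
  by (simp add: fscale_def mult_map_scale_conv_mult)

lemma single_0_commute:
  "single 0 c * p = p * single 0 (c :: 'k::comm_ring_1)"
  by (induction p rule: poly_mapping_additive_induct)
    (simp_all add: mult_single mult.commute algebra_simps)

lemma fscale_mult_left: "fscale c p * q = fscale c (p * (q :: 'x::monoid_add \<Rightarrow>\<^sub>0 'k::comm_ring_1))"
  by (simp add: fscale_conv_mult mult.assoc)

lemma fscale_mult_right: "p * fscale c q = fscale c (p * (q :: 'x::monoid_add \<Rightarrow>\<^sub>0 'k::comm_ring_1))"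
  by (simp add: fscale_conv_mult) (metis mult.assoc single_0_commute)

lemma hom_fscale_mult_left: "module_hom fscale fscale (\<lambda>q. p * (q :: 'x::monoid_add \<Rightarrow>\<^sub>0 'k::comm_ring_1))"
  by (rule module_homI) (simp_all add: module_fscale algebra_simps fscale_mult_right)

lemma hom_fscale_mult_right: "module_hom fscale fscale (\<lambda>q. (q :: 'x::monoid_add \<Rightarrow>\<^sub>0 'k::comm_ring_1) * p)"
  by (rule module_homI) (simp_all add: module_fscale algebra_simps fscale_mult_left)

lemma two_sided_ideal_hull: "two_sided_ideal (two_sided_ideal hull S)"
  by (rule hull_in) (auto simp: two_sided_ideal_def)

lemma two_sided_ideal_subspace:
  "two_sided_ideal I \<Longrightarrow> F.subspace (I :: ('x::monoid_add \<Rightarrow>\<^sub>0 'k::comm_ring_1) set)"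
  unfolding F.subspace_def two_sided_ideal_def fscale_conv_mult by blast

lemma cong_mult:
  assumes I: "two_sided_ideal I" and "add_subgroup I" "x \<approx>[I] x'" "y \<approx>[I] y'"
  shows "x * y \<approx>[I] x' * y'"
proof -
  have "x * y - x' * y' = (x - x') * y + x' * (y - y')" by (simp add: algebra_simps)
  then show ?thesis using assms by (auto simp: cong_mod_def two_sided_ideal_def)
qed

text \<open>
  Rules that prove \<open>linear_mod\<close> by recursion over the term. The rules for maps between \<open>A\<close> and \<open>V\<close> are
  exact (modulo \<open>{0}\<close>), and each has one varying argument, so that at most one of them applies.
\<close>

named_theorems linear_intros

lemma linear_id [linear_intros]: "linear_mod s s {0} (\<lambda>x. x)"
  by (simp add: linear_mod_def)

lemma linear_mod_comp:
  assumes N: "add_subgroup N" and f: "linear_mod t u N f" and g: "linear_mod s t {0} g"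
  shows "linear_mod s u N (\<lambda>x. f (g x))"
  using g linear_modD[OF f] by (auto simp: linear_mod_def)

context algebra_module
begin

lemma linear_act_left [linear_intros]:
  "linear_mod s scA {0} g \<Longrightarrow> linear_mod s scV {0} (\<lambda>x. act (g x) v)"
  by (simp add: linear_mod_def act_add_left act_scale_left)

lemma linear_act_right [linear_intros]:
  "linear_mod s scV {0} g \<Longrightarrow> linear_mod s scV {0} (\<lambda>x. act a (g x))"
  by (simp add: linear_mod_def act_add_right act_scale_right)

lemma linear_times_left [linear_intros]:
  "linear_mod s scA {0} g \<Longrightarrow> linear_mod s scA {0} (\<lambda>x. g x * b)"
  by (simp add: linear_mod_def distrib_right A.scale_mult_left)

lemma linear_times_right [linear_intros]:
  "linear_mod s scA {0} g \<Longrightarrow> linear_mod s scA {0} (\<lambda>x. a * g x)"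
  by (simp add: linear_mod_def distrib_left A.scale_mult_right)

end

section \<open>Bilinearity of \<open>\<lambda>\<close> and \<open>\<kappa>\<close>\<close>

context smash_deformation
begin

lemma l_add_left: "l (a + b) v = l a v + l b v"
  and l_add_right: "l a (v + w) = l a v + l a w"
  and l_scale_left: "l (scA c a) v = scA c (l a v)"
  and l_scale_right: "l a (scV c v) = scA c (l a v)"
proof -
  let ?N = "tens_rel scA scV"
  have G: "add_subgroup ?N"
    using subspace_add_subgroup[OF module_fscale subspace_tens_rel] .
  have add: "lam (qcls ?N (p + q)) = lam (qcls ?N p) + lam (qcls ?N q)"
    and scale: "lam (qcls ?N (fscale c p)) = scA c (lam (qcls ?N p))" for p q c
    using lam_linear by (simp_all add: quot_linear_def)
  have B: "linear_mod scA fscale ?N (\<lambda>x. pt (x, w))" "linear_mod scV fscale ?N (\<lambda>y. pt (x, y))" for x w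
    using bilinear_mod_pt[of scA scV] by (simp_all add: bilinear_mod_def)
  show "l (a + b) v = l a v + l b v" "l a (v + w) = l a v + l a w"
    "l (scA c a) v = scA c (l a v)" "l a (scV c v) = scA c (l a v)"
    unfolding l_def tens_def add[symmetric] scale[symmetric]
    by (simp_all only: linear_modD[OF B(1), THEN qcls_eq_iff[OF G, THEN iffD2]]
        linear_modD[OF B(2), THEN qcls_eq_iff[OF G, THEN iffD2]])
qed

text \<open>
  The map \<open>kap\<close> is linear on \<open>wedge_span\<close> only, so that laws for \<open>\<kappa>\<close> need representatives in this submodule.
\<close>

lemma wedge_add: "wedge scV (v + v') w =
    qcls (tens_rel scV scV) ((pt (v, w) - pt (w, v)) + (pt (v', w) - pt (w, v')))"
  and wedge_scale: "wedge scV (scV c v) w = qcls (tens_rel scV scV) (fscale c (pt (v, w) - pt (w, v)))"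
  and wedge_commute: "wedge scV w v = qcls (tens_rel scV scV) (fscale (- 1) (pt (v, w) - pt (w, v)))"
proof -
  let ?N = "tens_rel scV scV"
  have G: "add_subgroup ?N"
    using subspace_add_subgroup[OF module_fscale subspace_tens_rel] .
  have B: "linear_mod scV fscale ?N (\<lambda>x. pt (x, w))" "linear_mod scV fscale ?N (\<lambda>y. pt (x, y))" for x w
    using bilinear_mod_pt[of scV scV] by (simp_all add: bilinear_mod_def)
  show "wedge scV (v + v') w = qcls ?N ((pt (v, w) - pt (w, v)) + (pt (v', w) - pt (w, v')))"
    unfolding wedge_def qcls_eq_iff[OF G]
    using cong_diff[OF G linear_modD(1)[OF B(1)] linear_modD(1)[OF B(2)], of v v' w w v v']
    by (simp add: algebra_simps)
  show "wedge scV (scV c v) w = qcls ?N (fscale c (pt (v, w) - pt (w, v)))"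
    unfolding wedge_def qcls_eq_iff[OF G] F.scale_right_diff_distrib
    by (rule cong_diff[OF G linear_modD(2)[OF B(1)] linear_modD(2)[OF B(2)]])
  show "wedge scV w v = qcls ?N (fscale (- 1) (pt (v, w) - pt (w, v)))"
    by (simp add: wedge_def fscale_minus_1)
qed

lemma kap_linear_wedge: "kap (wedge scV (v + v') w) = kap (wedge scV v w) + kap (wedge scV v' w)"
  "kap (wedge scV (scV c v) w) = sum_scale scV scA c (kap (wedge scV v w))"
  "kap (wedge scV w v) = - kap (wedge scV v w)"
  "kap (wedge scV v v) = 0"
proof -
  let ?N = "tens_rel scV scV"
  have W: "pt (v, w) - pt (w, v) \<in> wedge_span" for v w :: 'v
    unfolding wedge_span_def by (rule F.span_base) blast
  note k = kap_linear[unfolded quot_linear_def]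
  have add: "kap (qcls ?N ((pt (v, w) - pt (w, v)) + (pt (v', w') - pt (w', v')))) =
      kap (qcls ?N (pt (v, w) - pt (w, v))) + kap (qcls ?N (pt (v', w') - pt (w', v')))" for v w v' w'
    using k W by blast
  have scale: "kap (qcls ?N (fscale c (pt (v, w) - pt (w, v)))) =
      sum_scale scV scA c (kap (qcls ?N (pt (v, w) - pt (w, v))))" for c v w
    using k W by blast
  show "kap (wedge scV (v + v') w) = kap (wedge scV v w) + kap (wedge scV v' w)"
    unfolding wedge_add add by (simp add: wedge_def)
  show "kap (wedge scV (scV c v) w) = sum_scale scV scA c (kap (wedge scV v w))"
    unfolding wedge_scale scale by (simp add: wedge_def)
  show "kap (wedge scV w v) = - kap (wedge scV v w)"
    unfolding wedge_commute[of w v] scale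
    by (simp add: wedge_def sum_scale_def case_prod_unfold uminus_prod_def)
  show "kap (wedge scV v v) = 0"
    using add[of v v v v] by (simp add: wedge_def)
qed

lemma kap_components:
  shows kV_add_left: "kV (v + v') w = kV v w + kV v' w"
    and kA_add_left: "kA (v + v') w = kA v w + kA v' w"
    and kV_scale_left: "kV (scV c v) w = scV c (kV v w)"
    and kA_scale_left: "kA (scV c v) w = scA c (kA v w)"
    and kV_swap: "kV w v = - kV v w" and kA_swap: "kA w v = - kA v w"
    and kV_same: "kV v v = 0" and kA_same: "kA v v = 0"
  unfolding kV_def kA_def
  by (simp_all add: kap_linear_wedge(1,2,4) kap_linear_wedge(3)[where w = w and v = v]
      sum_scale_def case_prod_unfold)

lemma kap_components_right:
  shows kV_add_right: "kV w (v + v') = kV w v + kV w v'"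
    and kA_add_right: "kA w (v + v') = kA w v + kA w v'"
    and kV_scale_right: "kV w (scV c v) = scV c (kV w v)"
    and kA_scale_right: "kA w (scV c v) = scA c (kA w v)"
  using kV_add_left[of v v' w] kA_add_left[of v v' w] kV_scale_left[of c v w] kA_scale_left[of c v w]
  unfolding kV_swap[where w = w and v = "v + v'"] kV_swap[where w = w and v = v] kV_swap[where w = w and v = v']
    kV_swap[where w = w and v = "scV c v"] kA_swap[where w = w and v = "v + v'"] kA_swap[where w = w and v = v]
    kA_swap[where w = w and v = v'] kA_swap[where w = w and v = "scV c v"]
  by simp_all

lemma linear_l_left [linear_intros]: "linear_mod s scA {0} g \<Longrightarrow> linear_mod s scA {0} (\<lambda>x. l (g x) v)"
  and linear_l_right [linear_intros]: "linear_mod s scV {0} h \<Longrightarrow> linear_mod s scA {0} (\<lambda>x. l a (h x))"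
  and linear_kV_left [linear_intros]: "linear_mod s scV {0} h \<Longrightarrow> linear_mod s scV {0} (\<lambda>x. kV (h x) w)"
  and linear_kV_right [linear_intros]: "linear_mod s scV {0} h \<Longrightarrow> linear_mod s scV {0} (\<lambda>x. kV w (h x))"
  and linear_kA_left [linear_intros]: "linear_mod s scV {0} h \<Longrightarrow> linear_mod s scA {0} (\<lambda>x. kA (h x) w)"
  and linear_kA_right [linear_intros]: "linear_mod s scV {0} h \<Longrightarrow> linear_mod s scA {0} (\<lambda>x. kA w (h x))"
  by (simp_all add: linear_mod_def l_add_left l_add_right l_scale_left l_scale_right
    kV_add_left kA_add_left kV_scale_left kA_scale_left kap_components_right)

section \<open>The free algebra modulo the relations other than the commutators\<close>

text \<open>
  The relations of \<open>T(V) \<rtimes>\<^sub>\<lambda> A\<close>: those of the deformed smash product except for the commutators of vectors.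
\<close>

definition skew_rels :: "(('v \<times> 'a) fword \<Rightarrow>\<^sub>0 'k) set" where
  "skew_rels = tensor_algebra_rels (sum_scale scV scA)
      \<union> {inA (a * b) - inA a * inA b | a b. True} \<union> {inA 1 - 1}
      \<union> {inA a * inV v - sweedler2 fscale \<Delta> (\<lambda>x y. inV (act x v) * inA y) a - inA (l a v)
           | a v. True}"

definition skew_ideal :: "(('v \<times> 'a) fword \<Rightarrow>\<^sub>0 'k) set" where
  "skew_ideal = two_sided_ideal hull skew_rels"

definition commutator :: "'v \<Rightarrow> 'v \<Rightarrow> (('v \<times> 'a) fword \<Rightarrow>\<^sub>0 'k)" where
  "commutator v v' = inV v * inV v' - inV v' * inV v - (inV (kV v v') + inA (kA v v'))"

lemma H_ideal_eq: "H_ideal = two_sided_ideal hull (skew_rels \<union> {commutator v v' | v v'. True})"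
  by (simp add: H_ideal_def smash_ideal_def skew_rels_def commutator_def)

abbreviation skew_cong (infix \<open>\<doteq>\<close> 50) where
  "p \<doteq> q \<equiv> p \<approx>[skew_ideal] q"

lemma ideal_skew: "two_sided_ideal skew_ideal"
  by (simp add: skew_ideal_def two_sided_ideal_hull)

lemma ideal_H: "two_sided_ideal H_ideal"
  by (simp add: H_ideal_eq two_sided_ideal_hull)

lemma subspace_skew: "F.subspace skew_ideal"
  by (rule two_sided_ideal_subspace[OF ideal_skew])

lemma subspace_H: "F.subspace H_ideal"
  by (rule two_sided_ideal_subspace[OF ideal_H])

lemma group_skew: "add_subgroup skew_ideal"
  by (rule subspace_add_subgroup[OF module_fscale subspace_skew])

lemma group_H: "add_subgroup H_ideal"
  by (rule subspace_add_subgroup[OF module_fscale subspace_H])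

lemma skew_subset_H: "skew_ideal \<subseteq> H_ideal"
  unfolding skew_ideal_def H_ideal_eq by (rule hull_mono) blast

lemma commutator_in_H: "commutator v v' \<in> H_ideal"
  unfolding H_ideal_eq by (rule hull_inc) blast

lemma skew_imp_H_cong: "p \<doteq> q \<Longrightarrow> p \<approx>[H_ideal] q"
  using skew_subset_H by (auto simp: cong_mod_def)

lemmas skew_refl = cong_refl[OF group_skew]
lemmas skew_sym = cong_sym[OF group_skew]
lemma skew_eq_trans [trans]: "p = q \<Longrightarrow> q \<doteq> r \<Longrightarrow> p \<doteq> r" "p \<doteq> q \<Longrightarrow> q = r \<Longrightarrow> p \<doteq> r"
  by simp_all

lemmas skew_trans [trans] = cong_trans[OF group_skew]
lemmas skew_add = cong_add[OF group_skew]
lemmas skew_diff = cong_diff[OF group_skew]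
lemmas skew_mult = cong_mult[OF ideal_skew group_skew]
lemmas skew_sweedler2 = sweedler2_cong[OF module_fscale subspace_skew]
lemmas skew_sweedler3 = sweedler3_cong[OF module_fscale subspace_skew]

lemma rel_skew: "p \<in> skew_rels \<Longrightarrow> p \<in> skew_ideal"
  unfolding skew_ideal_def by (rule hull_inc)

lemma inA_mult: "inA (a * b) \<doteq> inA a * inA b"
  unfolding cong_mod_def by (rule rel_skew) (auto simp: skew_rels_def)

lemma inA_one: "inA 1 \<doteq> 1"
  unfolding cong_mod_def by (rule rel_skew) (auto simp: skew_rels_def)

lemma inA_inV: "inA a * inV v \<doteq>
    sweedler2 fscale \<Delta> (\<lambda>x y. inV (act x v) * inA y) a + inA (l a v)"
  unfolding cong_mod_def diff_diff_eq[symmetric] by (rule rel_skew) (auto simp: skew_rels_def)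

lemma linear_generators:
  assumes "tensor_algebra_rels (sum_scale scV scA) \<subseteq> I"
  shows "linear_mod (sum_scale scV scA) fscale I (\<lambda>m. pt (FWord [m]))"
    and "linear_mod scV fscale I inV" and "linear_mod scA fscale I inA"
proof -
  show gen: "linear_mod (sum_scale scV scA) fscale I (\<lambda>m. pt (FWord [m]))"
    using assms by (intro lin_rels_linear_mod) (simp add: tensor_algebra_rels_def)
  show "linear_mod scV fscale I inV"
    using linear_modD(1)[OF gen, of "(v, 0)" "(w, 0)" for v w] linear_modD(2)[OF gen, of c "(v, 0)" for v c]
    by (intro linear_modI) (simp_all add: inV_def gen_def sum_scale_def)
  show "linear_mod scA fscale I inA"
    using linear_modD(1)[OF gen, of "(0, v)" "(0, w)" for v w] linear_modD(2)[OF gen, of c "(0, v)" for v c]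
    by (intro linear_modI) (simp_all add: inA_def gen_def sum_scale_def)
qed

lemma tensor_rels_skew: "tensor_algebra_rels (sum_scale scV scA) \<subseteq> skew_ideal"
  using rel_skew by (auto simp: skew_rels_def)

lemmas linear_gen = linear_generators(1)[OF tensor_rels_skew]
lemmas linear_inV = linear_generators(2)[OF tensor_rels_skew]
lemmas linear_inA = linear_generators(3)[OF tensor_rels_skew]

lemma gen_eq: "gen (v, a) \<doteq> inV v + inA a"
  using linear_modD(1)[OF linear_gen, of "(v, 0)" "(0, a)"] by (simp add: inV_def inA_def gen_def)

lemma linear_inV_comp [linear_intros]:
  "linear_mod s scV {0} g \<Longrightarrow> linear_mod s fscale skew_ideal (\<lambda>x. inV (g x))"
  by (rule linear_mod_comp[OF group_skew linear_inV])

lemma linear_inA_comp [linear_intros]: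
  "linear_mod s scA {0} g \<Longrightarrow> linear_mod s fscale skew_ideal (\<lambda>x. inA (g x))"
  by (rule linear_mod_comp[OF group_skew linear_inA])

lemma linear_skew_mult_left [linear_intros]:
  assumes "linear_mod s fscale skew_ideal f"
  shows "linear_mod s fscale skew_ideal (\<lambda>x. f x * p)"
proof (rule linear_modI)
  show "f (x + y) * p \<doteq> f x * p + f y * p" for x y
    using skew_mult[OF linear_modD(1)[OF assms] skew_refl] by (simp add: distrib_right)
  show "f (s c x) * p \<doteq> fscale c (f x * p)" for c x
    using skew_mult[OF linear_modD(2)[OF assms] skew_refl] by (simp add: fscale_mult_left)
qed

lemma linear_skew_mult_right [linear_intros]:
  assumes "linear_mod s fscale skew_ideal f"
  shows "linear_mod s fscale skew_ideal (\<lambda>x. p * f x)"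
proof (rule linear_modI)
  show "p * f (x + y) \<doteq> p * f x + p * f y" for x y
    using skew_mult[OF skew_refl linear_modD(1)[OF assms]] by (simp add: distrib_left)
  show "p * f (s c x) \<doteq> fscale c (p * f x)" for c x
    using skew_mult[OF skew_refl linear_modD(2)[OF assms]] by (simp add: fscale_mult_right)
qed

lemma linear_skew_diff [linear_intros]:
  assumes "linear_mod s fscale skew_ideal f" "linear_mod s fscale skew_ideal g"
  shows "linear_mod s fscale skew_ideal (\<lambda>x. f x - g x)"
proof (rule linear_modI)
  show "f (x + y) - g (x + y) \<doteq> (f x - g x) + (f y - g y)" for x y
    using skew_diff[OF assms[THEN linear_modD(1)], of x y x y] by (simp add: algebra_simps)
  show "f (s c x) - g (s c x) \<doteq> fscale c (f x - g x)" for c x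
    using skew_diff[OF assms[THEN linear_modD(2)], of c x c x]
    by (simp add: F.scale_right_diff_distrib)
qed

lemma bilinear_skew_VA: "bilinear_mod scV scA fscale skew_ideal (\<lambda>v b. inV v * inA b)"
  unfolding bilinear_mod_def by (intro conjI allI linear_intros)

text \<open>The second component of the natural map, on representatives; \<open>embVA_tens_rel\<close> says that it descends to \<open>V \<otimes> A\<close>.\<close>

definition embVA :: "('v \<times> 'a \<Rightarrow>\<^sub>0 'k) \<Rightarrow> (('v \<times> 'a) fword \<Rightarrow>\<^sub>0 'k)" where
  "embVA = lin_ext fscale (\<lambda>(v, b). inV v * inA b)"

lemma hom_embVA: "module_hom fscale fscale embVA"
  unfolding embVA_def by (rule lin_ext_hom[OF module_fscale])

lemmas embVA_add = module_hom.add[OF hom_embVA]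
lemmas embVA_diff = module_hom.diff[OF hom_embVA]

lemma embVA_pt [simp]: "embVA (pt (v, b)) = inV v * inA b"
  by (simp add: embVA_def lin_ext_pt[OF module_fscale])

lemma embVA_sweedler2:
  "embVA (sweedler2 fscale \<Delta> f a) = sweedler2 fscale \<Delta> (\<lambda>x y. embVA (f x y)) a"
  by (rule hom_sweedler2[OF module_fscale subspace_skew hom_embVA])

lemma embVA_sweedler3:
  "embVA (sweedler3 fscale \<Delta> f a) = sweedler3 fscale \<Delta> (\<lambda>x y z. embVA (f x y z)) a"
  by (rule hom_sweedler3[OF module_fscale subspace_skew hom_embVA])

lemma embVA_tens_rel: "\<tau> \<in> tens_rel scV scA \<Longrightarrow> embVA \<tau> \<in> skew_ideal"
  unfolding embVA_def by (rule tens_rel_mem[OF module_fscale bilinear_skew_VA subspace_skew])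

lemma inA_sweedler2:
  "inA (sweedler2 scA \<Delta> f a) \<doteq> sweedler2 fscale \<Delta> (\<lambda>x y. inA (f x y)) a"
  by (rule linear_mod_sweedler2[OF module_fscale subspace_skew module_axioms linear_inA])

lemma inA_sweedler3:
  "inA (sweedler3 scA \<Delta> f a) \<doteq> sweedler3 fscale \<Delta> (\<lambda>x y z. inA (f x y z)) a"
  by (rule linear_mod_sweedler3[OF module_fscale subspace_skew module_axioms linear_inA])

lemmas mult_sweedler2 = hom_sweedler2[OF module_fscale subspace_skew hom_fscale_mult_left]
lemmas sweedler2_mult_right = hom_sweedler2[OF module_fscale subspace_skew hom_fscale_mult_right]
lemmas inA_add = linear_modD(1)[OF linear_inA]

lemma linear_mod_diff:
  assumes "linear_mod s t N f" "add_subgroup N"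
  shows "f (x - y) \<approx>[N] f x - f y"
  using cong_diff[OF assms(2) cong_sym[OF assms(2) linear_modD(1)[OF assms(1), of "x - y" y]]
      cong_refl[OF assms(2), of "f y"]]
    cong_sym[OF assms(2)] by fastforce

lemmas inA_diff = linear_mod_diff[OF linear_inA group_skew]

section \<open>Three identities behind the conditions (a), (b), (c)\<close>

lemma bilinear_act_VA: "bilinear_mod scA scA fscale skew_ideal (\<lambda>x y. inV (act x v) * inA y)"
  unfolding bilinear_mod_def by (intro conjI allI linear_intros)

text \<open>
  Expand \<open>(aa')v\<close> and \<open>a(a'v)\<close>. Since \<open>\<Delta>\<close> is multiplicative, the parts in \<open>VA\<close> agree, and what remains are the
  two sides of (a).
\<close>

lemma skew_identity_a:
  "inA (l (a * a') v) \<doteq> inA (a * l a' v + sweedler2 scA \<Delta> (\<lambda>x y. l a (act x v) * y) a')"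
proof -
  define f :: "'a \<Rightarrow> 'a \<Rightarrow> (('v \<times> 'a) fword \<Rightarrow>\<^sub>0 'k)" where "f = (\<lambda>x y. inV (act x v) * inA y)"
  let ?S = "sweedler2 fscale \<Delta>"
  have *: "inA a * f x y \<doteq> ?S (\<lambda>p q. f (p * x) (q * y)) a + inA (l a (act x v) * y)" for x y
  proof -
    have "inA a * f x y = (inA a * inV (act x v)) * inA y"
      by (simp add: f_def mult.assoc)
    also have "\<dots> \<doteq> (?S (\<lambda>p q. inV (act p (act x v)) * inA q) a + inA (l a (act x v))) * inA y"
      by (rule skew_mult[OF inA_inV skew_refl])
    also have "\<dots> = ?S (\<lambda>p q. inV (act (p * x) v) * (inA q * inA y)) a + inA (l a (act x v)) * inA y"
      by (simp add: distrib_right sweedler2_mult_right act_mult mult.assoc)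
    also have "\<dots> \<doteq> ?S (\<lambda>p q. f (p * x) (q * y)) a + inA (l a (act x v) * y)"
      unfolding f_def
      by (intro skew_add skew_sweedler2 skew_mult skew_refl skew_sym[OF inA_mult])
    finally show ?thesis .
  qed
  have "?S f (a * a') + inA (l (a * a') v) \<doteq> inA (a * a') * inV v"
    unfolding f_def by (rule skew_sym[OF inA_inV])
  also have "\<dots> \<doteq> inA a * inA a' * inV v"
    by (rule skew_mult[OF inA_mult skew_refl])
  also have "\<dots> = inA a * (inA a' * inV v)" by (simp add: mult.assoc)
  also have "\<dots> \<doteq> inA a * (?S f a' + inA (l a' v))"
    unfolding f_def by (rule skew_mult[OF skew_refl inA_inV])
  also have "\<dots> = ?S (\<lambda>x y. inA a * f x y) a' + inA a * inA (l a' v)"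
    by (simp add: distrib_left mult_sweedler2)
  also have "\<dots> \<doteq> ?S (\<lambda>x y. ?S (\<lambda>p q. f (p * x) (q * y)) a + inA (l a (act x v) * y)) a' + inA (a * l a' v)"
    by (intro skew_add skew_sweedler2 * skew_sym[OF inA_mult])
  also have "\<dots> = ?S (\<lambda>p q. ?S (\<lambda>x y. f (p * x) (q * y)) a') a
      + (?S (\<lambda>x y. inA (l a (act x v) * y)) a' + inA (a * l a' v))"
    unfolding sweedler2_fun_add[OF module_fscale subspace_skew]
    by (subst sweedler2_swap[OF module_fscale subspace_skew]) simp
  also have "\<dots> \<doteq> ?S f (a * a')
      + (inA (sweedler2 scA \<Delta> (\<lambda>x y. l a (act x v) * y) a') + inA (a * l a' v))"
    unfolding f_def
    by (intro skew_add skew_refl skew_sym[OF inA_sweedler2]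
        skew_sym[OF sweedler2_mult[OF module_fscale subspace_skew bilinear_act_VA]])
  also have "\<dots> \<doteq> ?S f (a * a') + inA (a * l a' v + sweedler2 scA \<Delta> (\<lambda>x y. l a (act x v) * y) a')"
    unfolding add.commute[of "a * l a' v"] by (intro skew_add skew_refl skew_sym[OF inA_add])
  finally show ?thesis by (simp add: cong_mod_def)
qed

lemma trilinear_act_act:
  "trilinear_mod scA fscale skew_ideal (\<lambda>x y z. inV (act x v) * inV (act y w) * inA z)"
  unfolding trilinear_mod_def by (intro conjI allI linear_intros)

text \<open>
  Moving \<open>a\<close> past two vectors. The leading term has one factor \<open>a\<^sub>(\<^sub>1\<^sub>)\<close> and expands \<open>a\<^sub>(\<^sub>2\<^sub>)\<close> again; coassociativity brings it
  to the form with \<open>sweedler3\<close>, whose first two factors can be exchanged by cocommutativity.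
\<close>

lemma inA_inV_inV:
  "inA a * (inV v * inV w) \<doteq>
    sweedler3 fscale \<Delta> (\<lambda>x y z. inV (act x v) * inV (act y w) * inA z) a
    + (embVA (sweedler2 fscale \<Delta> (\<lambda>x y. pt (act x v, l y w)) a
        + sweedler2 fscale \<Delta> (\<lambda>x y. pt (act x w, y)) (l a v))
      + inA (l (l a v) w))"
proof -
  let ?S = "sweedler2 fscale \<Delta>"
  have "inA a * (inV v * inV w) = (inA a * inV v) * inV w" by (simp add: mult.assoc)
  also have "\<dots> \<doteq> (?S (\<lambda>x y. inV (act x v) * inA y) a + inA (l a v)) * inV w"
    by (rule skew_mult[OF inA_inV skew_refl])
  also have "\<dots> = ?S (\<lambda>x y. inV (act x v) * (inA y * inV w)) a + inA (l a v) * inV w"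
    by (simp add: distrib_right sweedler2_mult_right mult.assoc)
  also have "\<dots> \<doteq> ?S (\<lambda>x y. inV (act x v) * (?S (\<lambda>p q. inV (act p w) * inA q) y + inA (l y w))) a
      + (?S (\<lambda>x y. inV (act x w) * inA y) (l a v) + inA (l (l a v) w))"
    by (intro skew_add skew_sweedler2 skew_mult skew_refl inA_inV)
  also have "\<dots> = ?S (\<lambda>x y. ?S (\<lambda>p q. inV (act x v) * inV (act p w) * inA q) y) a
      + (embVA (?S (\<lambda>x y. pt (act x v, l y w)) a + ?S (\<lambda>x y. pt (act x w, y)) (l a v))
        + inA (l (l a v) w))"
    by (simp add: distrib_left mult_sweedler2 sweedler2_fun_add[OF module_fscale subspace_skew]
        embVA_add embVA_sweedler2 mult.assoc add.assoc)
  also have "\<dots> \<doteq> sweedler3 fscale \<Delta> (\<lambda>x y z. inV (act x v) * inV (act y w) * inA z) a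
      + (embVA (?S (\<lambda>x y. pt (act x v, l y w)) a + ?S (\<lambda>x y. pt (act x w, y)) (l a v))
        + inA (l (l a v) w))"
    by (intro skew_add skew_refl
        skew_sym[OF sweedler3_coassoc[OF module_fscale subspace_skew trilinear_act_act]])
  finally show ?thesis .
qed

text \<open>Right side minus left side of the two equations of condition (b).\<close>

definition b_defect_A :: "'a \<Rightarrow> 'v \<Rightarrow> 'v \<Rightarrow> 'a" where
  "b_defect_A a v w = (l (l a v) w - l (l a w) v - l a (kV v w))
     - (a * kA v w - sweedler3 scA \<Delta> (\<lambda>x y z. kA (act x v) (act y w) * z) a)"

definition b_defect_VA :: "'a \<Rightarrow> 'v \<Rightarrow> 'v \<Rightarrow> ('v \<times> 'a \<Rightarrow>\<^sub>0 'k)" where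
  "b_defect_VA a v w =
     (sweedler2 fscale \<Delta> (\<lambda>x y. pt (act x w, y)) (l a v)
       - sweedler2 fscale \<Delta> (\<lambda>x y. pt (act x v, y)) (l a w)
       + sweedler2 fscale \<Delta> (\<lambda>x y. pt (act x v, l y w)) a
       - sweedler2 fscale \<Delta> (\<lambda>x y. pt (act x w, l y v)) a)
     - (sweedler2 fscale \<Delta> (\<lambda>x y. pt (act x (kV v w), y)) a
       - sweedler3 fscale \<Delta> (\<lambda>x y z. pt (kV (act x v) (act y w), z)) a)"

lemma cond_b_iff: "cond_b \<longleftrightarrow>
    (\<forall>a v w. b_defect_A a v w = 0 \<and> b_defect_VA a v w \<in> tens_rel scV scA)"
proof -
  have G: "add_subgroup (tens_rel scV scA)"
    by (rule subspace_add_subgroup[OF module_fscale subspace_tens_rel])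
  show ?thesis
    unfolding cond_b_def b_defect_A_def b_defect_VA_def eq_VA_def qcls_eq_iff[OF G]
    unfolding right_minus_eq cong_iff_mem[OF G, symmetric]
    by (metis cong_sym[OF G])
qed

text \<open>
  Take \<open>a(vw) - a(wv)\<close> from \<open>inA_inV_inV\<close>. By cocommutativity the leading terms combine to the commutators of
  \<open>a\<^sub>(\<^sub>1\<^sub>)(v)\<close> and \<open>a\<^sub>(\<^sub>2\<^sub>)(w)\<close>; replacing these by \<open>commutator\<close> and \<open>\<kappa>\<close> leaves the defects of (b).
\<close>

lemma skew_identity_b:
  "inA a * commutator v w \<doteq>
    sweedler3 fscale \<Delta> (\<lambda>x y z. commutator (act x v) (act y w) * inA z) a
    + (embVA (b_defect_VA a v w) + inA (b_defect_A a v w))"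
proof -
  let ?S = "sweedler2 fscale \<Delta>" and ?T = "sweedler3 fscale \<Delta>"
  let ?Q = "\<lambda>v w x y z. inV (act x v) * inV (act y w) * inA z"
  have 1: "?T (?Q v w) a - ?T (?Q w v) a \<doteq> ?T (\<lambda>x y z. commutator (act x v) (act y w) * inA z) a
      + (embVA (?T (\<lambda>x y z. pt (kV (act x v) (act y w), z)) a)
        + inA (sweedler3 scA \<Delta> (\<lambda>x y z. kA (act x v) (act y w) * z) a))"
  proof -
    have "?T (?Q v w) a - ?T (?Q w v) a \<doteq> ?T (?Q v w) a - ?T (\<lambda>x y z. ?Q w v y x z) a"
      by (intro skew_diff skew_refl sweedler3_commute[OF module_fscale subspace_skew trilinear_act_act])
    also have "\<dots> = ?T (\<lambda>x y z. commutator (act x v) (act y w) * inA z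
        + (inV (kV (act x v) (act y w)) * inA z + inA (kA (act x v) (act y w)) * inA z)) a"
      unfolding sweedler3_fun_diff[OF module_fscale subspace_skew, symmetric]
      by (simp add: commutator_def algebra_simps)
    also have "\<dots> \<doteq> ?T (\<lambda>x y z. commutator (act x v) (act y w) * inA z
        + (inV (kV (act x v) (act y w)) * inA z + inA (kA (act x v) (act y w) * z))) a"
      by (intro skew_add skew_sweedler3 skew_refl skew_sym[OF inA_mult])
    also have "\<dots> = ?T (\<lambda>x y z. commutator (act x v) (act y w) * inA z) a
      + (embVA (?T (\<lambda>x y z. pt (kV (act x v) (act y w), z)) a)
        + ?T (\<lambda>x y z. inA (kA (act x v) (act y w) * z)) a)"
      by (simp add: sweedler3_fun_add[OF module_fscale subspace_skew] embVA_sweedler3)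
    also have "\<dots> \<doteq> ?T (\<lambda>x y z. commutator (act x v) (act y w) * inA z) a
      + (embVA (?T (\<lambda>x y z. pt (kV (act x v) (act y w), z)) a)
        + inA (sweedler3 scA \<Delta> (\<lambda>x y z. kA (act x v) (act y w) * z) a))"
      by (intro skew_add skew_refl skew_sym[OF inA_sweedler3])
    finally show ?thesis .
  qed
  have 2: "inA a * inV (kV v w) \<doteq> embVA (?S (\<lambda>x y. pt (act x (kV v w), y)) a) + inA (l a (kV v w))"
    using inA_inV by (simp add: embVA_sweedler2)
  \<comment> \<open>Leading terms, parts in \<open>VA\<close>, and parts in \<open>A\<close>.\<close>
  have regroup: "(x + (y + z)) - (x' + (y' + z')) - ((p + q) + r)
      = (x - x') + ((y - y' - p) + (z - z' - q - r))"
    for x y z x' y' z' p q r :: "('v \<times> 'a) fword \<Rightarrow>\<^sub>0 'k"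
    by (simp add: algebra_simps)
  have "inA a * commutator v w = inA a * (inV v * inV w) - inA a * (inV w * inV v)
      - (inA a * inV (kV v w) + inA a * inA (kA v w))"
    by (simp add: commutator_def algebra_simps)
  also have "\<dots> \<doteq>
     (?T (?Q v w) a + (embVA (?S (\<lambda>x y. pt (act x v, l y w)) a + ?S (\<lambda>x y. pt (act x w, y)) (l a v))
       + inA (l (l a v) w)))
     - (?T (?Q w v) a + (embVA (?S (\<lambda>x y. pt (act x w, l y v)) a + ?S (\<lambda>x y. pt (act x v, y)) (l a w))
       + inA (l (l a w) v)))
     - ((embVA (?S (\<lambda>x y. pt (act x (kV v w), y)) a) + inA (l a (kV v w))) + inA (a * kA v w))"
    by (rule skew_diff[OF skew_diff[OF inA_inV_inV inA_inV_inV] skew_add[OF 2 skew_sym[OF inA_mult]]])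
  also have "\<dots> = (?T (?Q v w) a - ?T (?Q w v) a)
     + (embVA (?S (\<lambda>x y. pt (act x v, l y w)) a + ?S (\<lambda>x y. pt (act x w, y)) (l a v)
         - (?S (\<lambda>x y. pt (act x w, l y v)) a + ?S (\<lambda>x y. pt (act x v, y)) (l a w))
         - ?S (\<lambda>x y. pt (act x (kV v w), y)) a)
       + (inA (l (l a v) w) - inA (l (l a w) v) - inA (l a (kV v w)) - inA (a * kA v w)))"
    unfolding embVA_diff by (rule regroup)
  also have "\<dots> \<doteq> (?T (\<lambda>x y z. commutator (act x v) (act y w) * inA z) a
      + (embVA (?T (\<lambda>x y z. pt (kV (act x v) (act y w), z)) a)
        + inA (sweedler3 scA \<Delta> (\<lambda>x y z. kA (act x v) (act y w) * z) a)))
     + (embVA (?S (\<lambda>x y. pt (act x v, l y w)) a + ?S (\<lambda>x y. pt (act x w, y)) (l a v)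
         - (?S (\<lambda>x y. pt (act x w, l y v)) a + ?S (\<lambda>x y. pt (act x v, y)) (l a w))
         - ?S (\<lambda>x y. pt (act x (kV v w), y)) a)
       + inA (l (l a v) w - l (l a w) v - l a (kV v w) - a * kA v w))"
    by (intro skew_add skew_refl 1 skew_sym[OF skew_trans[OF inA_diff skew_diff]] inA_diff
        skew_trans[OF inA_diff skew_diff])
  also have "\<dots> = ?T (\<lambda>x y z. commutator (act x v) (act y w) * inA z) a
     + (embVA (b_defect_VA a v w)
       + (inA (sweedler3 scA \<Delta> (\<lambda>x y z. kA (act x v) (act y w) * z) a)
         + inA (l (l a v) w - l (l a w) v - l a (kV v w) - a * kA v w)))"
    by (simp add: b_defect_VA_def embVA_add embVA_diff algebra_simps)
  also have "\<dots> \<doteq> ?T (\<lambda>x y z. commutator (act x v) (act y w) * inA z) a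
     + (embVA (b_defect_VA a v w)
       + inA (sweedler3 scA \<Delta> (\<lambda>x y z. kA (act x v) (act y w) * z) a
         + (l (l a v) w - l (l a w) v - l a (kV v w) - a * kA v w)))"
    by (intro skew_add skew_refl skew_sym[OF inA_add])
  also have "sweedler3 scA \<Delta> (\<lambda>x y z. kA (act x v) (act y w) * z) a
         + (l (l a v) w - l (l a w) v - l a (kV v w) - a * kA v w) = b_defect_A a v w"
    by (simp add: b_defect_A_def algebra_simps)
  finally show ?thesis .
qed

text \<open>Right side minus left side of the two equations of condition (c).\<close>

definition c_defect_A :: "'v \<Rightarrow> 'v \<Rightarrow> 'v \<Rightarrow> 'a" where
  "c_defect_A u v w = cyclic_sum (\<lambda>x y z. kA x (kV y z)) u v w - cyclic_sum (\<lambda>x y z. l (kA x y) z) u v w"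

definition c_defect_VA :: "'v \<Rightarrow> 'v \<Rightarrow> 'v \<Rightarrow> ('v \<times> 'a \<Rightarrow>\<^sub>0 'k)" where
  "c_defect_VA u v w =
     (cyclic_sum (\<lambda>x y z. pt (x, kA y z)) u v w
       - cyclic_sum (\<lambda>x y z. sweedler2 fscale \<Delta> (\<lambda>a b. pt (act a z, b)) (kA x y)) u v w)
     - cyclic_sum (\<lambda>x y z. pt (kV (kV x y) z, 1)) u v w"

lemma cond_c_iff: "cond_c \<longleftrightarrow>
    (\<forall>u v w. c_defect_A u v w = 0 \<and> c_defect_VA u v w \<in> tens_rel scV scA)"
proof -
  have G: "add_subgroup (tens_rel scV scA)"
    by (rule subspace_add_subgroup[OF module_fscale subspace_tens_rel])
  show ?thesis
    unfolding cond_c_def c_defect_A_def c_defect_VA_def eq_VA_def qcls_eq_iff[OF G]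
    unfolding right_minus_eq cong_iff_mem[OF G, symmetric]
    by (metis cong_sym[OF G])
qed

lemma inV_inA_one: "inV v \<doteq> inV v * inA 1"
  using skew_mult[OF skew_refl[of "inV v"] skew_sym[OF inA_one]] by simp

text \<open>
  The bracket of \<open>\<kappa>(x, y)\<close> with \<open>z\<close>: its part in \<open>V\<close> gives a commutator of vectors, its part in \<open>A\<close> is moved past
  \<open>z\<close>. The summand in \<open>V\<close> is written with a factor \<open>1\<close> to make it an element of \<open>VA\<close>.
\<close>

lemma kap_bracket:
  "(inV (kV x y) + inA (kA x y)) * inV z - inV z * (inV (kV x y) + inA (kA x y)) \<doteq>
    commutator (kV x y) z + (inA (kA (kV x y) z) + inA (l (kA x y) z))
    + embVA (pt (kV (kV x y) z, 1) + sweedler2 fscale \<Delta> (\<lambda>a b. pt (act a z, b)) (kA x y) - pt (z, kA x y))"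
proof -
  have "(inV (kV x y) + inA (kA x y)) * inV z - inV z * (inV (kV x y) + inA (kA x y)) =
    commutator (kV x y) z + (inV (kV (kV x y) z) + inA (kA (kV x y) z))
      + inA (kA x y) * inV z - inV z * inA (kA x y)"
    by (simp add: commutator_def algebra_simps)
  also have "\<dots> \<doteq> commutator (kV x y) z + (inV (kV (kV x y) z) * inA 1 + inA (kA (kV x y) z))
      + (sweedler2 fscale \<Delta> (\<lambda>a b. inV (act a z) * inA b) (kA x y) + inA (l (kA x y) z))
      - inV z * inA (kA x y)"
    by (intro skew_diff skew_add skew_refl inV_inA_one inA_inV)
  also have "\<dots> = commutator (kV x y) z + (inA (kA (kV x y) z) + inA (l (kA x y) z))
    + embVA (pt (kV (kV x y) z, 1) + sweedler2 fscale \<Delta> (\<lambda>a b. pt (act a z, b)) (kA x y) - pt (z, kA x y))"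
    by (simp add: embVA_add embVA_diff embVA_sweedler2 algebra_simps)
  finally show ?thesis .
qed

lemma inA_zero: "inA 0 \<doteq> 0"
  by (rule additive_mod_zero[OF group_skew, of inA]) (rule inA_add)

lemma inA_minus: "inA (- a) \<doteq> - inA a"
  using skew_trans[OF inA_diff[of 0 a] skew_diff[OF inA_zero skew_refl]] by simp

text \<open>
  By the Jacobi identity in the free algebra the cyclic sum of the brackets of \<open>xy - yx\<close> with \<open>z\<close> vanishes, so the cyclic sum of
  \<open>[commutator x y, z]\<close> is minus that of \<open>[\<kappa>(x, y), z]\<close>, which \<open>kap_bracket\<close> computes.
\<close>

lemma skew_identity_c:
  "cyclic_sum (\<lambda>x y z. commutator x y * inV z - inV z * commutator x y + commutator (kV x y) z) u v w
    \<doteq> inA (c_defect_A u v w) + embVA (c_defect_VA u v w)"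
proof -
  let ?k = "\<lambda>x y. inV (kV x y) + inA (kA x y)"
  let ?A = "\<lambda>x y z. inA (kA (kV x y) z) + inA (l (kA x y) z)"
  let ?V = "\<lambda>x y z. pt (kV (kV x y) z, 1)
    + sweedler2 fscale \<Delta> (\<lambda>a b. pt (act a z, b)) (kA x y) - pt (z, kA x y)"
  define D where "D = cyclic_sum (\<lambda>x y z. commutator (kV x y) z) u v w"
  have c: "commutator x y = inV x * inV y - inV y * inV x - ?k x y" for x y
    by (simp add: commutator_def)
  have "cyclic_sum (\<lambda>x y z. commutator x y * inV z - inV z * commutator x y + commutator (kV x y) z) u v w
      = D - cyclic_sum (\<lambda>x y z. ?k x y * inV z - inV z * ?k x y) u v w"
    unfolding D_def cyclic_sum_def c[of u v] c[of v w] c[of w u] by (simp add: algebra_simps)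
  also have "\<dots> \<doteq> D - cyclic_sum (\<lambda>x y z. commutator (kV x y) z + ?A x y z + embVA (?V x y z)) u v w"
    unfolding cyclic_sum_def by (intro skew_diff skew_add skew_refl kap_bracket)
  also have "\<dots> = embVA (c_defect_VA u v w) - cyclic_sum ?A u v w"
    by (simp add: D_def cyclic_sum_def c_defect_VA_def embVA_add embVA_diff algebra_simps)
  also have "\<dots> \<doteq> embVA (c_defect_VA u v w)
      - inA (cyclic_sum (\<lambda>x y z. kA (kV x y) z + l (kA x y) z) u v w)"
    unfolding cyclic_sum_def
    by (intro skew_diff skew_refl skew_sym[OF skew_trans[OF inA_add skew_add[OF skew_trans[OF inA_add
      skew_add[OF inA_add inA_add]] inA_add]]])
  also have "\<dots> \<doteq> embVA (c_defect_VA u v w)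
      + inA (- cyclic_sum (\<lambda>x y z. kA (kV x y) z + l (kA x y) z) u v w)"
    unfolding diff_conv_add_uminus by (intro skew_add skew_refl skew_sym[OF inA_minus])
  also have "- cyclic_sum (\<lambda>x y z. kA (kV x y) z + l (kA x y) z) u v w = c_defect_A u v w"
    unfolding cyclic_sum_def c_defect_A_def
    by (simp add: kA_swap[of u "kV v w"] kA_swap[of v "kV w u"] kA_swap[of w "kV u v"])
  finally show ?thesis by (simp add: add.commute)
qed

section \<open>Injectivity implies the conditions\<close>

text \<open>
  Injectivity in terms of representatives and of the kernel: the natural map is additive.
\<close>

lemma natural_map_injective_iff:
  "natural_map_injective \<longleftrightarrow>
    (\<forall>a \<tau>. inA a + embVA \<tau> \<in> H_ideal \<longrightarrow> a = 0 \<and> \<tau> \<in> tens_rel scV scA)"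
proof -
  let ?N = "tens_rel scV scA"
  have G: "add_subgroup ?N"
    by (rule subspace_add_subgroup[OF module_fscale subspace_tens_rel])
  have nm: "natural_map (a, qcls ?N \<tau>) = qcls H_ideal (inA a + embVA \<tau>)" for a \<tau>
  proof -
    have "embVA (qrep (qcls ?N \<tau>)) \<doteq> embVA \<tau>"
      using embVA_tens_rel[of "qrep (qcls ?N \<tau>) - \<tau>"] qrep_qcls[OF G, of \<tau>]
      by (simp add: cong_mod_def embVA_diff)
    then have "inA a + embVA (qrep (qcls ?N \<tau>)) \<approx>[H_ideal] inA a + embVA \<tau>"
      by (intro skew_imp_H_cong skew_add skew_refl)
    then show ?thesis
      by (simp add: natural_map_def qcls_eq_iff[OF group_H] embVA_def)
  qed
  have d: "inA a + embVA \<tau> \<approx>[H_ideal] inA b + embVA \<sigma> \<longleftrightarrow> inA (a - b) + embVA (\<tau> - \<sigma>) \<in> H_ideal"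
    for a b \<tau> \<sigma>
  proof -
    have "(inA a + embVA \<tau>) - (inA b + embVA \<sigma>) = (inA a - inA b) + embVA (\<tau> - \<sigma>)"
      by (simp add: embVA_diff)
    also have "\<dots> \<approx>[H_ideal] inA (a - b) + embVA (\<tau> - \<sigma>)"
      by (intro skew_imp_H_cong skew_add skew_refl skew_sym[OF inA_diff])
    finally show ?thesis using cong_mem_iff[OF group_H] by (simp add: cong_mod_def)
  qed
  have eq: "qcls ?N \<tau> = qcls ?N \<sigma> \<longleftrightarrow> \<tau> - \<sigma> \<in> ?N" for \<tau> \<sigma>
    unfolding qcls_eq_iff[OF G] by (simp add: cong_mod_def)
  have "natural_map_injective \<longleftrightarrow> (\<forall>a \<tau> b \<sigma>. natural_map (a, qcls ?N \<tau>) = natural_map (b, qcls ?N \<sigma>)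
      \<longrightarrow> a = b \<and> qcls ?N \<tau> = qcls ?N \<sigma>)"
    unfolding natural_map_injective_def inj_on_def tens_space_def by auto
  also have "\<dots> \<longleftrightarrow> (\<forall>a \<tau> b \<sigma>. inA (a - b) + embVA (\<tau> - \<sigma>) \<in> H_ideal \<longrightarrow> a - b = 0 \<and> \<tau> - \<sigma> \<in> ?N)"
    by (simp add: nm qcls_eq_iff[OF group_H] d eq)
  also have "\<dots> \<longleftrightarrow> (\<forall>a \<tau>. inA a + embVA \<tau> \<in> H_ideal \<longrightarrow> a = 0 \<and> \<tau> \<in> ?N)"
    by (metis diff_zero)
  finally show ?thesis .
qed

lemma embVA_zero: "embVA 0 = 0"
  by (rule module_hom.zero[OF hom_embVA])

lemma H_ideal_closed:
  "p \<in> H_ideal \<Longrightarrow> q \<in> H_ideal \<Longrightarrow> p + q \<in> H_ideal"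
  "p \<in> H_ideal \<Longrightarrow> q \<in> H_ideal \<Longrightarrow> p - q \<in> H_ideal"
  "p \<in> H_ideal \<Longrightarrow> r * p \<in> H_ideal" "p \<in> H_ideal \<Longrightarrow> p * r \<in> H_ideal"
  using ideal_H add_subgroup_diff[OF group_H] by (auto simp: two_sided_ideal_def)

text \<open>
  Commutators of vectors vanish in \<open>H\<^sub>\<lambda>\<^sub>,\<^sub>\<kappa>\<close>, so that the three identities put the defects of (a), (b), (c) into the kernel of the
  natural map.
\<close>

lemma injective_imp_conditions:
  assumes natural_map_injective shows "cond_a \<and> cond_b \<and> cond_c"
proof (intro conjI)
  note inj = assms[unfolded natural_map_injective_iff, rule_format]
  show cond_a
    unfolding cond_a_def
  proof (intro allI)
    fix a a' v
    let ?d = "l (a * a') v - (a * l a' v + sweedler2 scA \<Delta> (\<lambda>x y. l a (act x v) * y) a')"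
    have "inA ?d \<doteq> inA (l (a * a') v) - inA (a * l a' v + sweedler2 scA \<Delta> (\<lambda>x y. l a (act x v) * y) a')"
      by (rule inA_diff)
    then have "inA ?d + embVA 0 \<in> H_ideal"
      using skew_identity_a[of a a' v] cong_mem_iff[OF group_skew] skew_subset_H
      by (auto simp: cong_iff_mem[OF group_skew, of "inA (l (a * a') v)"] embVA_zero)
    from inj[OF this] show "l (a * a') v = a * l a' v + sweedler2 scA \<Delta> (\<lambda>x y. l a (act x v) * y) a'"
      by simp
  qed
  show cond_b
    unfolding cond_b_iff
  proof (intro allI)
    fix a v w
    let ?T = "sweedler3 fscale \<Delta> (\<lambda>x y z. commutator (act x v) (act y w) * inA z) a"
    have "?T \<in> H_ideal"
      by (intro sweedler3_mem[OF module_fscale subspace_H] H_ideal_closed commutator_in_H)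
    moreover have "?T + (embVA (b_defect_VA a v w) + inA (b_defect_A a v w)) \<in> H_ideal"
      using cong_mem_iff[OF group_H skew_imp_H_cong[OF skew_identity_b]]
        H_ideal_closed(3)[OF commutator_in_H] by blast
    ultimately have "?T + (embVA (b_defect_VA a v w) + inA (b_defect_A a v w)) - ?T \<in> H_ideal"
      by (rule H_ideal_closed(2)[rotated])
    then have "inA (b_defect_A a v w) + embVA (b_defect_VA a v w) \<in> H_ideal"
      by (simp add: add.commute)
    then show "b_defect_A a v w = 0 \<and> b_defect_VA a v w \<in> tens_rel scV scA"
      by (rule inj)
  qed
  show cond_c
    unfolding cond_c_iff
  proof (intro allI)
    fix u v w
    have "cyclic_sum (\<lambda>x y z. commutator x y * inV z - inV z * commutator x y + commutator (kV x y) z) u v w \<in> H_ideal"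
      unfolding cyclic_sum_def by (intro H_ideal_closed commutator_in_H)
    then have "inA (c_defect_A u v w) + embVA (c_defect_VA u v w) \<in> H_ideal"
      using cong_mem_iff[OF group_H skew_imp_H_cong[OF skew_identity_c]] by blast
    then show "c_defect_A u v w = 0 \<and> c_defect_VA u v w \<in> tens_rel scV scA"
      by (rule inj)
  qed
qed

end

section \<open>Words with coefficients\<close>

lemma poly_mapping_support_induct [consumes 1, case_names zero single add]:
  fixes p :: "'x \<Rightarrow>\<^sub>0 'b::comm_monoid_add"
  assumes "keys p \<subseteq> S" "P 0" "\<And>x a. x \<in> S \<Longrightarrow> P (single x a)"
    "\<And>p q. P p \<Longrightarrow> P q \<Longrightarrow> P (p + q)"
  shows "P p"
proof -
  have "P (\<Sum>x\<in>T. single x (lookup p x))" if "T \<subseteq> S" for T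
    using that by (induction T rule: infinite_finite_induct) (auto intro: assms)
  from this[of "keys p"] assms(1) show ?thesis by (simp add: poly_mapping_sum_single)
qed

primrec letters :: "'x fword \<Rightarrow> 'x list" where "letters (FWord xs) = xs"

lemma FWord_letters [simp]: "FWord (letters w) = w"
  by (cases w) simp

lemma letters_plus [simp]: "letters (u + w) = letters u @ letters w"
  by (cases u; cases w) simp

lemma letters_zero [simp]: "letters 0 = []"
  by (simp add: zero_fword_def)

definition coeff :: "'b::semiring_1 \<Rightarrow> ('x::monoid_add \<Rightarrow>\<^sub>0 'b)" where
  "coeff a = single 0 a"

lemma coeff_simps [simp]: "coeff 0 = 0" "coeff 1 = 1" "coeff (a + b) = coeff a + coeff b"
  "coeff (a * b) = coeff a * coeff b"
  by (simp_all add: coeff_def single_add mult_single)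

lemma single_times_coeff: "single w a * coeff b = single w (a * b)"
  by (simp add: coeff_def mult_single)

lemma keys_times_coeff: "keys (n * coeff b) \<subseteq> keys n"
  using keys_mult[of n "coeff b"] by (auto simp: coeff_def split: if_splits)

text \<open>
  Elements with a representation of a given kind, such as a normal form, are a submodule if the elements that they
  are represented by depend linearly on the data.
\<close>

lemma subspace_cong_image:
  assumes s: "module s" and t: "module t" and N: "module.subspace t N"
    and f: "linear_mod s t N f" and W: "module.subspace s W"
  shows "module.subspace t {p. \<exists>m\<in>W. p \<approx>[N] f m}"
proof -
  interpret s: module s by (rule s)
  interpret t: module t by (rule t)
  note G = subspace_add_subgroup[OF t N]
  show ?thesis
  proof (rule t.subspaceI)
    have "0 \<approx>[N] f 0"
      by (rule cong_sym[OF G additive_mod_zero[OF G, of f]]) (rule linear_modD(1)[OF f])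
    then show "0 \<in> {p. \<exists>m\<in>W. p \<approx>[N] f m}" using s.subspace_0[OF W] by blast
    fix p assume "p \<in> {p. \<exists>m\<in>W. p \<approx>[N] f m}"
    then obtain m where m: "m \<in> W" "p \<approx>[N] f m" by blast
    show "t c p \<in> {p. \<exists>m\<in>W. p \<approx>[N] f m}" for c
      using cong_trans[OF G cong_scale[OF t N m(2)] cong_sym[OF G linear_modD(2)[OF f]]]
        s.subspace_scale[OF W m(1)] by blast
    fix q assume "q \<in> {p. \<exists>m\<in>W. p \<approx>[N] f m}"
    then obtain n where n: "n \<in> W" "q \<approx>[N] f n" by blast
    show "p + q \<in> {p. \<exists>m\<in>W. p \<approx>[N] f m}"
      using cong_trans[OF G cong_add[OF G m(2) n(2)] cong_sym[OF G linear_modD(1)[OF f]]]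
        s.subspace_add[OF W m(1) n(1)] by blast
  qed
qed

lemma basis_linear_memI:
  assumes B: "is_basis s UNIV B" and s: "module s" and t: "module t" and N: "module.subspace t N"
    and f: "linear_mod s t N f" and U: "module.subspace t U" "N \<subseteq> U"
    and on_basis: "\<And>b. b \<in> B \<Longrightarrow> f b \<in> U"
  shows "f v \<in> U"
proof -
  interpret s: module s by (rule s)
  interpret t: module t by (rule t)
  note G = subspace_add_subgroup[OF t N]
  note cong_U = cong_mem_iff[OF subspace_add_subgroup[OF t U(1)]]
  have to_U: "x \<approx>[N] y \<Longrightarrow> x \<approx>[U] y" for x y using U(2) by (auto simp: cong_mod_def)
  have "s.subspace {v. f v \<in> U}"
  proof (rule s.subspaceI; unfold mem_Collect_eq)
    have "f 0 \<approx>[N] 0"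
      by (rule additive_mod_zero[OF G]) (rule linear_modD(1)[OF f])
    then show "f 0 \<in> U" using U(2) by (auto simp: cong_mod_def)
    show "f (x + y) \<in> U" if "f x \<in> U" "f y \<in> U" for x y
      using cong_U[OF to_U[OF linear_modD(1)[OF f]]] t.subspace_add[OF U(1) that] by blast
    show "f (s c x) \<in> U" if "f x \<in> U" for c x
      using cong_U[OF to_U[OF linear_modD(2)[OF f]]] t.subspace_scale[OF U(1) that] by blast
  qed
  then have "s.span B \<subseteq> {v. f v \<in> U}" using on_basis by (intro s.span_minimal) auto
  then show ?thesis using B by (auto simp: is_basis_def)
qed

text \<open>
  Any total order on the basis will do: sorting a word only permutes its letters, so the rewriting below terminates
  because of the number of inversions.
\<close>

locale smash_basis = smash_deformation scA \<Delta> scV act lam kap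
  for scA :: "'k::comm_ring_1 \<Rightarrow> 'a::ring_1 \<Rightarrow> 'a"
    and \<Delta> :: "'a \<Rightarrow> ('a \<times> 'a \<Rightarrow>\<^sub>0 'k) set"
    and scV :: "'k \<Rightarrow> 'v::ab_group_add \<Rightarrow> 'v"
    and act :: "'a \<Rightarrow> 'v \<Rightarrow> 'v"
    and lam kap +
  fixes B :: "'v set" and r :: "'v rel"
  assumes B: "is_basis scV UNIV B" and r: "linear_order_on B r"
begin

section \<open>The model \<open>T(V) \<otimes> A\<close>\<close>

text \<open>
  Elements of \<open>T(V) \<otimes> A\<close> are families of elements of \<open>A\<close> indexed by words of basis vectors, i.e. elements of
  the monoid ring \<open>'v fword \<Rightarrow>\<^sub>0 'a\<close>. Its multiplication is not that of the deformed algebra, but it is convenient: left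
  multiplication by a word prepends it, and right multiplication by \<open>coeff b\<close> is the right action of
  \<open>b \<in> A\<close>. Letters outside \<open>B\<close> are allowed in words; \<open>T(V) \<otimes> A\<close> itself is the part supported on words in \<open>B\<close>
  (\<open>tens_B\<close>). The scalar \<open>c\<close> acts as the
  central coefficient \<open>c \<cdot> 1\<close>.
\<close>

definition scN :: "'k \<Rightarrow> ('v fword \<Rightarrow>\<^sub>0 'a) \<Rightarrow> ('v fword \<Rightarrow>\<^sub>0 'a)" where
  "scN c n = n * coeff (scA c 1)"

lemma scA_one_commute: "scA c 1 * a = a * scA c 1"
  by (metis mult_1 mult_1_right scale_mult_left scale_mult_right)

lemma coeff_scalar_commute: "coeff (scA c 1) * n = n * coeff (scA c 1)"
  by (induction n rule: poly_mapping_additive_induct)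
    (simp_all add: coeff_def mult_single scA_one_commute algebra_simps)

lemma module_scN: "module scN"
proof
  show "scN a (scN b n) = scN (a * b) n" for a b n
    unfolding scN_def mult.assoc coeff_simps(4)[symmetric] scale_mult_left[symmetric]
    by (simp add: mult.commute)
  show "scN (a + b) n = scN a n + scN b n" for a b n
    by (simp add: scN_def scale_left_distrib distrib_left)
qed (simp_all add: scN_def distrib_right)

sublocale scN: module scN
  by (rule module_scN)

lemma scN_mult_left: "scN c m * n = scN c (m * n)"
  by (simp add: scN_def mult.assoc coeff_scalar_commute)

lemma scN_mult_right: "m * scN c n = scN c (m * n)"
  by (simp add: scN_def mult.assoc)

lemma scN_single: "scN c (single w a) = single w (scA c a)"
  by (simp add: scN_def single_times_coeff flip: scale_mult_right)

lemma scN_coeff: "coeff (scA c a) = scN c (coeff a)"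
  unfolding coeff_def by (simp add: scN_single)

lemma lookup_scN: "lookup (scN c n) w = scA c (lookup n w)"
  by (induction n rule: poly_mapping_additive_induct)
    (simp_all add: scN_single lookup_single when_def lookup_add scale_right_distrib
      scN.scale_right_distrib scN.scale_zero_right)

lemma hom_scN_mult_right: "module_hom scN scN (\<lambda>n. n * m)"
  by (rule module_homI) (simp_all add: module_scN algebra_simps scN_mult_left)

lemma linear_scN_mult_left [linear_intros]:
  "linear_mod s scN {0} f \<Longrightarrow> linear_mod s scN {0} (\<lambda>x. f x * n)"
  by (simp add: linear_mod_def distrib_right scN_mult_left)

lemma linear_scN_mult_right [linear_intros]:
  "linear_mod s scN {0} f \<Longrightarrow> linear_mod s scN {0} (\<lambda>x. n * f x)"
  by (simp add: linear_mod_def distrib_left scN_mult_right)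

lemma linear_scN_add [linear_intros]:
  "linear_mod s scN {0} f \<Longrightarrow> linear_mod s scN {0} g \<Longrightarrow> linear_mod s scN {0} (\<lambda>x. f x + g x)"
  using scN.scale_right_distrib by (simp add: linear_mod_def)

lemma linear_scN_diff [linear_intros]:
  "linear_mod s scN {0} f \<Longrightarrow> linear_mod s scN {0} g \<Longrightarrow> linear_mod s scN {0} (\<lambda>x. f x - g x)"
  using scN.scale_right_diff_distrib by (simp add: linear_mod_def)

lemma subspace_zero: "scN.subspace {0}"
  using module_scN by (rule module.subspace_single_0)

definition vec :: "'v \<Rightarrow> ('v fword \<Rightarrow>\<^sub>0 'a)" where
  "vec v = (\<Sum>b | V.representation B v b \<noteq> 0.
     single (FWord [b]) (scA (V.representation B v b) 1))"

lemma independent_B: "\<not> V.dependent B" and span_B: "v \<in> V.span B"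
  using B by (auto simp: is_basis_def)

lemma lookup_vec: "lookup (vec v) w =
    (case letters w of [b] \<Rightarrow> scA (V.representation B v b) 1 | _ \<Rightarrow> 0)"
proof (cases "\<exists>b. w = FWord [b]")
  case True
  then obtain b where w: "w = FWord [b]" by blast
  have "lookup (vec v) w = (\<Sum>b' | V.representation B v b' \<noteq> 0.
      if b' = b then scA (V.representation B v b) 1 else 0)"
    unfolding vec_def lookup_sum by (rule sum.cong) (auto simp: w lookup_single when_def)
  also have "\<dots> = scA (V.representation B v b) 1"
    by (simp add: V.finite_representation)
  finally show ?thesis by (simp add: w)
next
  case False
  then have "lookup (vec v) w = 0"
    unfolding vec_def lookup_sum by (intro sum.neutral) (auto simp: lookup_single when_def)
  moreover have "letters w \<noteq> [b]" for b
    using False FWord_letters[of w] by metis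
  ultimately show ?thesis by (simp split: list.split)
qed

lemma vec_basis: "b \<in> B \<Longrightarrow> vec b = single (FWord [b]) 1"
  by (simp add: vec_def V.representation_basis[OF independent_B] cong: if_cong)

lemma linear_vec: "linear_mod scV scN {0} vec"
proof (rule linear_modI, unfold cong_mod_zero)
  show "vec (v + w) = vec v + vec w" for v w
    by (rule poly_mapping_eqI)
      (auto simp: lookup_vec lookup_add V.representation_add[OF independent_B span_B span_B]
        scale_left_distrib split: list.split)
  show "vec (scV c v) = scN c (vec v)" for c v
    by (rule poly_mapping_eqI)
      (auto simp: lookup_vec lookup_scN V.representation_scale[OF independent_B span_B] split: list.split)
qed

lemma linear_vec_comp [linear_intros]:
  "linear_mod s scV {0} g \<Longrightarrow> linear_mod s scN {0} (\<lambda>x. vec (g x))"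
  by (rule linear_mod_comp[OF add_subgroup_zero linear_vec])

lemmas N_sweedler2_linear = sweedler2_linear[OF module_scN subspace_zero]
lemmas N_sweedler2_fun_add = sweedler2_fun_add[OF module_scN subspace_zero]
lemmas N_hom_sweedler2 = hom_sweedler2[OF module_scN subspace_zero]

text \<open>
  The left action of \<open>A\<close>. On \<open>x w \<otimes> 1\<close> it is forced by the relation \<open>a x = \<Sum> a\<^sub>(\<^sub>1\<^sub>)(x) a\<^sub>(\<^sub>2\<^sub>) + \<lambda>(a, x)\<close>
  (\<open>Lword\<close>), and \<open>L\<close> extends it to a right \<open>A\<close>-linear map.
\<close>

primrec Lword :: "'v list \<Rightarrow> 'a \<Rightarrow> ('v fword \<Rightarrow>\<^sub>0 'a)" where
  "Lword [] = coeff"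
| "Lword (x # xs) = (\<lambda>a. sweedler2 scN \<Delta> (\<lambda>p q. vec (act p x) * Lword xs q) a + Lword xs (l a x))"

definition L :: "'a \<Rightarrow> ('v fword \<Rightarrow>\<^sub>0 'a) \<Rightarrow> ('v fword \<Rightarrow>\<^sub>0 'a)" where
  "L a n = keys_sum (\<lambda>w c. Lword (letters w) a * coeff c) n"

lemma linear_Lword: "linear_mod scA scN {0} (Lword xs)"
proof (induction xs)
  case Nil
  show ?case by (simp add: linear_mod_def scN_coeff)
next
  case (Cons x xs)
  note comp = linear_mod_comp[OF add_subgroup_zero Cons.IH]
  have "bilinear_mod scA scA scN {0} (\<lambda>p q. vec (act p x) * Lword xs q)"
    unfolding bilinear_mod_def by (intro conjI allI linear_intros comp)
  then show ?case
    unfolding Lword.simps by (intro linear_intros N_sweedler2_linear comp)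
qed

lemma L_add: "L a (m + n) = L a m + L a n"
  unfolding L_def using keys_sum_add[OF add_subgroup_zero, of "\<lambda>w c. Lword (letters w) a * coeff c" m n]
  by (simp add: distrib_left)

lemma L_single: "L a (single w c) = Lword (letters w) a * coeff c"
  unfolding L_def by (rule keys_sum_single) simp

lemma L_zero [simp]: "L a 0 = 0"
  by (simp add: L_def keys_sum_def)

lemma L_times_coeff: "L a (n * coeff b) = L a n * coeff b"
  by (induction n rule: poly_mapping_additive_induct)
    (simp_all add: single_times_coeff L_single L_add distrib_right mult.assoc)

lemma L_on_one [simp]: "L a 1 = coeff a"
  using L_single[of a 0 1] by simp

lemma linear_L_right [linear_intros]:
  "linear_mod s scN {0} f \<Longrightarrow> linear_mod s scN {0} (\<lambda>x. L a (f x))"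
  unfolding linear_mod_def by (simp add: L_add) (simp add: scN_def L_times_coeff)

lemma hom_L: "module_hom scN scN (L a)"
  by (rule module_homI) (simp_all add: module_scN L_add scN_def L_times_coeff)

lemma linear_L: "linear_mod scA scN {0} (\<lambda>a. L a n)"
proof (induction n rule: poly_mapping_additive_induct)
  case zero
  show ?case by (simp add: linear_mod_def scN_def)
next
  case (single w c)
  show ?case unfolding L_single by (intro linear_intros linear_Lword)
next
  case (add m n)
  then show ?case unfolding L_add by (rule linear_scN_add)
qed

lemma linear_L_left [linear_intros]:
  "linear_mod s scA {0} g \<Longrightarrow> linear_mod s scN {0} (\<lambda>x. L (g x) n)"
  by (rule linear_mod_comp[OF add_subgroup_zero linear_L])

lemma L_add_left: "L (a + b) n = L a n + L b n"
  using linear_modD(1)[OF linear_L] by simp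

lemma L_zero_left [simp]: "L 0 n = 0"
  using L_add_left[of 0 0 n] by simp

lemma vec_zero [simp]: "vec 0 = 0"
  using linear_modD(1)[OF linear_vec, of 0 0] by simp

lemma bilinear_vec_L: "bilinear_mod scA scA scN {0} (\<lambda>p q. vec (act p v) * L q n)"
  unfolding bilinear_mod_def by (intro conjI allI linear_intros)

lemma L_letter: "L a (single (FWord [x]) 1 * n) =
    sweedler2 scN \<Delta> (\<lambda>p q. vec (act p x) * L q n) a + L (l a x) n"
proof (induction n rule: poly_mapping_additive_induct)
  case zero
  show ?case
    using sweedler2_mem[OF module_scN subspace_zero, where f = "\<lambda>p q. 0" and a = a] by simp
next
  case (single w c)
  have "L a (single (FWord [x]) 1 * single w c) = Lword (x # letters w) a * coeff c"
    by (simp add: mult_single L_single)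
  also have "\<dots> = sweedler2 scN \<Delta> (\<lambda>p q. vec (act p x) * Lword (letters w) q * coeff c) a
      + Lword (letters w) (l a x) * coeff c"
    by (simp add: distrib_right N_hom_sweedler2[OF hom_scN_mult_right])
  finally show ?case by (simp add: L_single mult.assoc)
next
  case (add m n)
  then show ?case by (simp add: distrib_left L_add N_sweedler2_fun_add)
qed

text \<open>
  The relation for \<open>av\<close> holds for a letter by definition of \<open>L\<close>. Both sides are linear in \<open>v\<close>, so it holds for all
  vectors.
\<close>

lemma L_vec: "L a (vec v * n) = sweedler2 scN \<Delta> (\<lambda>p q. vec (act p v) * L q n) a + L (l a v) n"
proof -
  let ?d = "\<lambda>v. L a (vec v * n) - (sweedler2 scN \<Delta> (\<lambda>p q. vec (act p v) * L q n) a + L (l a v) n)"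
  have "?d v \<in> {0}"
  proof (rule basis_linear_memI[OF B V.module_axioms module_scN subspace_zero _ subspace_zero order.refl])
    show "linear_mod scV scN {0} ?d"
      by (intro linear_intros sweedler2_param_linear[OF module_scN subspace_zero])
    show "?d b \<in> {0}" if "b \<in> B" for b
      using that by (simp add: vec_basis L_letter)
  qed
  then show ?thesis by simp
qed

subsection \<open>Supports\<close>

text \<open>
  \<open>tens_B k\<close> is the genuine part of \<open>T(V) \<otimes> A\<close> (letters from \<open>B\<close>) in degrees at most \<open>k\<close>. The operators \<open>L a\<close> do not
  raise the degree, which makes the rewriting of \<open>\<kappa>\<close>-terms terminate.
\<close>

definition words_in :: "'v fword set \<Rightarrow> ('v fword \<Rightarrow>\<^sub>0 'a) set" where
  "words_in S = {n. keys n \<subseteq> S}"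

definition Bwords :: "nat \<Rightarrow> 'v fword set" where
  "Bwords k = {w. set (letters w) \<subseteq> B \<and> length (letters w) \<le> k}"

definition tens_B :: "nat \<Rightarrow> ('v fword \<Rightarrow>\<^sub>0 'a) set" where
  "tens_B k = words_in (Bwords k)"

lemma words_in_add: "m \<in> words_in S \<Longrightarrow> n \<in> words_in S \<Longrightarrow> m + n \<in> words_in S"
  using keys_add[of m n] by (auto simp: words_in_def)

lemma words_in_times_coeff: "n \<in> words_in S \<Longrightarrow> n * coeff b \<in> words_in S"
  using keys_times_coeff[of n b] by (auto simp: words_in_def)

lemma subspace_words_in: "scN.subspace (words_in S)"
  unfolding scN.subspace_def
  by (auto simp: words_in_add scN_def words_in_times_coeff) (simp add: words_in_def)

lemma words_in_mult:
  assumes "m \<in> words_in S" "n \<in> words_in T" "\<And>u w. u \<in> S \<Longrightarrow> w \<in> T \<Longrightarrow> u + w \<in> U"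
  shows "m * n \<in> words_in U"
  using keys_mult[of m n] assms unfolding words_in_def by blast

lemma Bwords_plus: "u \<in> Bwords i \<Longrightarrow> w \<in> Bwords j \<Longrightarrow> u + w \<in> Bwords (i + j)"
  by (auto simp: Bwords_def)

lemma tens_B_mult: "m \<in> tens_B i \<Longrightarrow> n \<in> tens_B j \<Longrightarrow> m * n \<in> tens_B (i + j)"
  unfolding tens_B_def by (erule words_in_mult) (auto intro: Bwords_plus)

lemma tens_B_mono: "i \<le> j \<Longrightarrow> tens_B i \<subseteq> tens_B j"
  by (auto simp: tens_B_def words_in_def Bwords_def)

lemmas subspace_tens_B = subspace_words_in[of "Bwords _", folded tens_B_def]

lemma tens_B_add: "m \<in> tens_B k \<Longrightarrow> n \<in> tens_B k \<Longrightarrow> m + n \<in> tens_B k"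
  unfolding tens_B_def by (rule words_in_add)

lemma tens_B_times_coeff: "n \<in> tens_B k \<Longrightarrow> n * coeff b \<in> tens_B k"
  unfolding tens_B_def by (rule words_in_times_coeff)

lemma tens_B_single: "w \<in> Bwords k \<Longrightarrow> single w a \<in> tens_B k"
  by (simp add: tens_B_def words_in_def)

lemma vec_in_tens_B: "vec v \<in> tens_B 1"
  unfolding vec_def
  by (intro scN.subspace_sum[OF subspace_tens_B] tens_B_single)
    (auto simp: Bwords_def dest: V.representation_ne_zero)

lemma vec_mult_in_tens_B: "n \<in> tens_B k \<Longrightarrow> vec v * n \<in> tens_B (Suc k)"
  using tens_B_mult[OF vec_in_tens_B, of n k v] by simp

lemma Lword_in_tens_B: "Lword xs a \<in> tens_B (length xs)"
proof (induction xs arbitrary: a)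
  case Nil
  show ?case using tens_B_single[of 0 0 a] by (simp add: coeff_def Bwords_def)
next
  case (Cons x xs)
  have "Lword xs b \<in> tens_B (Suc (length xs))" for b
    using Cons tens_B_mono[of "length xs" "Suc (length xs)"] by auto
  then show ?case
    by (auto intro!: tens_B_add sweedler2_mem[OF module_scN subspace_tens_B] vec_mult_in_tens_B Cons)
qed

lemma tens_B_induct [consumes 1, case_names zero single add]:
  assumes "n \<in> tens_B k" "P 0" "\<And>w a. w \<in> Bwords k \<Longrightarrow> P (single w a)"
    "\<And>m n. P m \<Longrightarrow> P n \<Longrightarrow> P (m + n)"
  shows "P n"
  using assms(1) unfolding tens_B_def words_in_def mem_Collect_eq
  by (rule poly_mapping_support_induct) (use assms in auto)

lemma L_in_tens_B:
  assumes "n \<in> tens_B k" shows "L a n \<in> tens_B k"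
  using assms
proof (induction n rule: tens_B_induct)
  case (single w c)
  then have "length (letters w) \<le> k" by (simp add: Bwords_def)
  then show ?case
    unfolding L_single using Lword_in_tens_B[of "letters w" a] tens_B_mono
    by (blast intro: tens_B_times_coeff)
qed (auto simp: L_add tens_B_add scN.subspace_0[OF subspace_tens_B])

subsection \<open>The representation of the free algebra\<close>

definition op_word :: "('v \<times> 'a) fword \<Rightarrow> ('v fword \<Rightarrow>\<^sub>0 'a) \<Rightarrow> ('v fword \<Rightarrow>\<^sub>0 'a)" where
  "op_word w = foldr (\<lambda>(v, a) n. vec v * n + L a n) (letters w)"

definition rep :: "(('v \<times> 'a) fword \<Rightarrow>\<^sub>0 'k) \<Rightarrow> ('v fword \<Rightarrow>\<^sub>0 'a) \<Rightarrow> ('v fword \<Rightarrow>\<^sub>0 'a)" where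
  "rep p n = lin_ext scN (\<lambda>w. op_word w n) p"

lemma op_word_plus: "op_word (u + w) n = op_word u (op_word w n)"
  by (simp add: op_word_def)

lemma op_word_zero [simp]: "op_word 0 n = n"
  by (simp add: op_word_def)

lemma op_word_add: "op_word w (m + n) = op_word w m + op_word w n"
proof -
  have "foldr (\<lambda>(v, a) n. vec v * n + L a n) xs (m + n) = foldr (\<lambda>(v, a) n. vec v * n + L a n) xs m
      + foldr (\<lambda>(v, a) n. vec v * n + L a n) xs n" for xs
    by (induction xs) (auto simp: distrib_left L_add)
  then show ?thesis by (simp add: op_word_def)
qed

lemma op_word_times_coeff: "op_word w (n * coeff b) = op_word w n * coeff b"
proof -
  have "foldr (\<lambda>(v, a) n. vec v * n + L a n) xs (n * coeff b) =
      foldr (\<lambda>(v, a) n. vec v * n + L a n) xs n * coeff b" for xs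
    by (induction xs) (auto simp: distrib_right mult.assoc L_times_coeff)
  then show ?thesis by (simp add: op_word_def)
qed

lemma hom_op_word: "module_hom scN scN (op_word w)"
  by (rule module_homI) (simp_all add: module_scN op_word_add scN_def op_word_times_coeff)

lemma hom_rep: "module_hom fscale scN (\<lambda>p. rep p n)"
  unfolding rep_def by (rule lin_ext_hom[OF module_scN])

lemmas rep_add_left = module_hom.add[OF hom_rep]
lemmas rep_diff_left = module_hom.diff[OF hom_rep]
lemmas rep_zero_left = module_hom.zero[OF hom_rep]

lemma rep_single: "rep (single w c) n = scN c (op_word w n)"
  by (simp add: rep_def lin_ext_single[OF module_scN])

lemma rep_add: "rep p (m + n) = rep p m + rep p n"
  by (simp add: rep_def op_word_add lin_ext_fun_add[OF module_scN])

lemma rep_times_coeff: "rep p (n * coeff b) = rep p n * coeff b"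
  by (simp add: rep_def op_word_times_coeff hom_lin_ext[OF module_scN hom_scN_mult_right])

lemma rep_scN: "rep p (scN c n) = scN c (rep p n)"
  by (simp add: scN_def rep_times_coeff)

lemma hom_rep_right: "module_hom scN scN (rep p)"
  by (rule module_homI) (simp_all add: module_scN rep_add rep_scN)

lemmas rep_zero = module_hom.zero[OF hom_rep_right]
lemmas rep_diff = module_hom.diff[OF hom_rep_right]

lemma rep_mult: "rep (p * q) n = rep p (rep q n)"
proof (induction p rule: poly_mapping_additive_induct)
  case (single u c)
  show ?case
  proof (induction q rule: poly_mapping_additive_induct)
    case (single w d)
    show ?case
      by (simp add: mult_single rep_single op_word_plus module_hom.scale[OF hom_op_word]
          scN.scale_scale)
  qed (simp_all add: rep_zero_left rep_zero distrib_left rep_add_left rep_add)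
qed (simp_all add: rep_zero_left distrib_right rep_add_left)

lemma rep_one: "rep 1 n = n"
  using rep_single[of 0 1 n] by (simp add: scN.scale_one)

lemma rep_pt: "rep (pt w) n = op_word w n"
  by (simp add: pt_def rep_single scN.scale_one)

lemma rep_inV: "rep (inV v) n = vec v * n"
  by (simp add: inV_def gen_def rep_pt op_word_def)

lemma rep_inA: "rep (inA a) n = L a n"
  by (simp add: inA_def gen_def rep_pt op_word_def)

lemma rep_sweedler2: "rep (sweedler2 fscale \<Delta> f a) n = sweedler2 scN \<Delta> (\<lambda>x y. rep (f x y) n) a"
  by (rule N_hom_sweedler2[OF hom_rep])

lemma rep_sweedler3: "rep (sweedler3 fscale \<Delta> f a) n = sweedler3 scN \<Delta> (\<lambda>x y z. rep (f x y z) n) a"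
  by (rule hom_sweedler3[OF module_scN subspace_zero hom_rep])

lemma op_word_in_tens_B:
  assumes "n \<in> tens_B k" shows "op_word w n \<in> tens_B (k + length (letters w))"
proof -
  have "foldr (\<lambda>(v, a) n. vec v * n + L a n) xs n \<in> tens_B (k + length xs)" for xs
  proof (induction xs)
    case (Cons x xs)
    then show ?case
      using tens_B_mono[of "k + length xs" "Suc (k + length xs)"]
      by (cases x) (auto intro!: tens_B_add vec_mult_in_tens_B dest: L_in_tens_B)
  qed (use assms in simp)
  then show ?thesis by (simp add: op_word_def)
qed

lemma rep_in_tens_B: "n \<in> tens_B k \<Longrightarrow> \<exists>j. rep p n \<in> tens_B j"
proof (induction p rule: poly_mapping_additive_induct)
  case zero
  then show ?case by (metis rep_zero_left scN.subspace_0[OF subspace_tens_B])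
next
  case (single w c)
  then show ?case
    by (metis rep_single op_word_in_tens_B scN.subspace_scale[OF subspace_tens_B])
next
  case (add p q)
  then obtain i j where "rep p n \<in> tens_B i" "rep q n \<in> tens_B j" by blast
  then have "rep (p + q) n \<in> tens_B (max i j)"
    unfolding rep_add_left using tens_B_mono[of i "max i j"] tens_B_mono[of j "max i j"]
    by (intro tens_B_add) auto
  then show ?case by blast
qed

context
  assumes cond_a: cond_a
begin

lemma l_mult: "l (a * a') v = a * l a' v + sweedler2 scA \<Delta> (\<lambda>x y. l a (act x v) * y) a'"
  using cond_a by (simp add: cond_a_def)

text \<open>
  Condition (a) with \<open>a = a' = 1\<close> reads \<open>\<lambda>(1, v) = \<lambda>(1, v) + \<lambda>(1, v)\<close>.
\<close>

lemma l_one: "l 1 v = 0"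
proof -
  have "bilinear_mod scA scA scA {0} (\<lambda>x y. l 1 (act x v) * y)"
    unfolding bilinear_mod_def by (intro conjI allI linear_intros)
  from sweedler2_one[OF module_axioms _ this] l_mult[of 1 1 v]
  show ?thesis by (simp add: act_one)
qed

text \<open>
  Induction on the length of the word. For \<open>x w\<close>, both sides are expanded with \<open>L_letter\<close> and \<open>L_vec\<close>;
  the leading terms agree since \<open>\<Delta>\<close> is multiplicative, and the others by condition (a).
\<close>

lemma L_mult: "L (a * b) n = L a (L b n)"
proof (induction n arbitrary: a b rule: poly_mapping_additive_induct)
  case (single w c)
  have "L (a * b) (single (FWord xs) 1) = L a (L b (single (FWord xs) 1))" for a b xs
  proof (induction xs arbitrary: a b)
    case Nil
    have "L a (coeff b) = coeff a * coeff b"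
      using L_times_coeff[of a 1 b] by simp
    then show ?case by (simp add: L_single)
  next
    case (Cons x xs)
    define n :: "'v fword \<Rightarrow>\<^sub>0 'a" where "n = single (FWord xs) 1"
    let ?S = "sweedler2 scN \<Delta>"
    let ?f = "\<lambda>p q. vec (act p x) * L q n"
    have n: "single (FWord (x # xs)) 1 = single (FWord [x]) 1 * n"
      by (simp add: n_def mult_single)
    have IH: "L (a * b) n = L a (L b n)" for a b
      unfolding n_def by (rule Cons.IH)
    have "L a (L b (single (FWord [x]) 1 * n)) =
        ?S (\<lambda>p q. L a (vec (act p x) * L q n)) b + L a (L (l b x) n)"
      by (simp add: L_letter L_add N_hom_sweedler2[OF hom_L])
    also have "\<dots> = ?S (\<lambda>p q. ?S (\<lambda>p' q'. ?f (p' * p) (q' * q)) a) b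
        + (?S (\<lambda>p q. L (l a (act p x) * q) n) b + L (a * l b x) n)"
      by (simp add: L_vec IH act_mult N_sweedler2_fun_add add.assoc)
    also have "?S (\<lambda>p q. ?S (\<lambda>p' q'. ?f (p' * p) (q' * q)) a) b = ?S ?f (a * b)"
      using sweedler2_mult[OF module_scN subspace_zero bilinear_vec_L[of x n], of a b]
      by (subst sweedler2_swap[OF module_scN subspace_zero]) simp
    also have "?S (\<lambda>p q. L (l a (act p x) * q) n) b = L (sweedler2 scA \<Delta> (\<lambda>p q. l a (act p x) * q) b) n"
      using linear_mod_sweedler2[OF module_scN subspace_zero module_axioms linear_L] by simp
    also have "\<dots> + L (a * l b x) n = L (l (a * b) x) n"
      by (simp add: l_mult L_add_left add.commute)
    finally show ?case by (simp add: n L_letter)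
  qed
  from this[of a b "letters w"] show ?case
    using single_times_coeff[of w 1 c] by (metis FWord_letters L_times_coeff mult_1)
qed (simp_all add: L_add)

text \<open>
  Only words in \<open>B\<close> are fixed by \<open>L 1\<close>: a letter \<open>x\<close> outside \<open>B\<close> is replaced by \<open>vec x\<close>.
\<close>

lemma L_one: "n \<in> tens_B k \<Longrightarrow> L 1 n = n"
proof (induction n rule: tens_B_induct)
  case (single w c)
  have "Lword xs 1 = single (FWord xs) 1" if "set xs \<subseteq> B" for xs
    using that
  proof (induction xs)
    case Nil
    show ?case by (simp flip: zero_fword_def)
  next
    case (Cons x xs)
    have "bilinear_mod scA scA scN {0} (\<lambda>p q. vec (act p x) * Lword xs q)"
      unfolding bilinear_mod_def by (intro conjI allI linear_intros linear_Lword)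
    from sweedler2_one[OF module_scN subspace_zero this] Cons show ?case
      using linear_modD(1)[OF linear_Lword, of xs 0 0]
      by (simp add: l_one act_one vec_basis mult_single)
  qed
  with single show ?case by (simp add: L_single Bwords_def single_times_coeff)
qed (simp_all add: L_add)

lemma rep_skew:
  assumes "p \<in> skew_ideal" "n \<in> tens_B k" shows "rep p n = 0"
proof -
  let ?I = "{p. \<forall>k. \<forall>n\<in>tens_B k. rep p n = 0}"
  have "two_sided_ideal ?I"
    using rep_in_tens_B
    by (auto simp: two_sided_ideal_def rep_zero_left rep_add_left rep_mult rep_zero) blast
  moreover have "skew_rels \<subseteq> ?I"
  proof -
    have "rep p n = 0" if "p \<in> tensor_algebra_rels (sum_scale scV scA)" for p n
    proof -
      have "linear_mod (sum_scale scV scA) scN {0} (\<lambda>m. op_word (FWord [m]) n)"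
        using linear_modD[OF linear_vec] linear_modD[OF linear_L[of n]]
        by (auto simp: linear_mod_def op_word_def sum_scale_def distrib_right scN_mult_left
            scN.scale_right_distrib)
      from lin_rels_mem[OF module_scN, where f = "\<lambda>w. op_word w n" and g = "\<lambda>m. FWord [m]", OF this] that
      show ?thesis
        by (simp add: rep_def tensor_algebra_rels_def)
    qed
    then show ?thesis
      unfolding skew_rels_def
      by (auto simp: rep_diff_left rep_mult rep_inA rep_inV rep_one rep_sweedler2 L_mult L_one L_vec)
  qed
  ultimately have "skew_ideal \<subseteq> ?I"
    unfolding skew_ideal_def by (intro hull_minimal)
  then show ?thesis using assms by blast
qed

lemma rep_skew_cong: "p \<doteq> q \<Longrightarrow> n \<in> tens_B k \<Longrightarrow> rep p n = rep q n"
  using rep_skew[where p = "p - q" and n = n and k = k] by (simp add: cong_mod_def rep_diff_left)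

end
end

section \<open>A diamond lemma\<close>

text \<open>
  Right submodules over the noncommutative ring of coefficients. The rewriting rules and the operators on
  \<open>T(V) \<otimes> A\<close> below are right \<open>A\<close>-linear.
\<close>

definition right_submodule :: "('w::monoid_add \<Rightarrow>\<^sub>0 'a::ring_1) set \<Rightarrow> bool" where
  "right_submodule U \<longleftrightarrow> 0 \<in> U \<and> (\<forall>m\<in>U. \<forall>n\<in>U. m + n \<in> U) \<and> (\<forall>n\<in>U. \<forall>a. n * coeff a \<in> U)"

lemma right_submodule_hull: "right_submodule (right_submodule hull S)"
  by (rule hull_in) (auto simp: right_submodule_def)

lemma right_submodule_uminus:
  assumes U: "right_submodule U" and n: "n \<in> U" shows "- n \<in> U"
proof -
  have "n * coeff (- 1) = - n"
    by (simp add: coeff_def single_uminus)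
  then show ?thesis using U n by (metis right_submodule_def)
qed

lemma right_submodule_diff: "right_submodule U \<Longrightarrow> m \<in> U \<Longrightarrow> n \<in> U \<Longrightarrow> m - n \<in> U"
  using right_submodule_uminus[of U n] unfolding right_submodule_def
  by (metis diff_conv_add_uminus)

lemma right_hull_image:
  assumes "n \<in> right_submodule hull S" "right_submodule U" "\<And>s. s \<in> S \<Longrightarrow> f s \<in> U"
    and "\<And>m n. f (m + n) = f m + (f n :: _ :: cancel_comm_monoid_add)"
    and "\<And>n a. f (n * coeff a) = f n * coeff a"
  shows "f n \<in> U"
  using assms(1)
proof (rule hull_induct)
  have "f 0 = 0" using assms(4)[of 0 0] by simp
  then show "right_submodule {x. f x \<in> U}"
    using assms(2,4,5) by (auto simp: right_submodule_def)
qed (rule assms(3))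

text \<open>
  \<open>R w\<close> is the set of possible one-step reductions of the word \<open>w\<close>; each is a combination of smaller words.
  Confluence asks that two reductions of \<open>w\<close> differ by a combination of relations \<open>v - s\<close> with smaller leading
  word \<open>v\<close>. The normal form map \<open>N\<close> is defined by well-founded recursion with an arbitrary choice of the reduction at each
  word; by induction on \<open>w\<close>, every other choice gives the same value, since \<open>N\<close> already kills the
  relations with smaller leading words.
\<close>

lemma diamond_lemma:
  fixes R :: "'w::monoid_add \<Rightarrow> ('w \<Rightarrow>\<^sub>0 'a::ring_1) set"
  assumes wf: "wf ord"
    and less: "\<And>w p v. p \<in> R w \<Longrightarrow> v \<in> keys p \<Longrightarrow> (v, w) \<in> ord"
    and confluent: "\<And>w p q. p \<in> R w \<Longrightarrow> q \<in> R w \<Longrightarrow>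
      p - q \<in> right_submodule hull {single v 1 - s | v s. (v, w) \<in> ord \<and> s \<in> R v}"
  obtains N where "\<And>m n. N (m + n) = N m + N n" "\<And>n a. N (n * coeff a) = N n * coeff a"
    "\<And>w p. p \<in> R w \<Longrightarrow> N (single w 1 - p) = 0"
    "\<And>n. (\<And>w. w \<in> keys n \<Longrightarrow> R w = {}) \<Longrightarrow> N n = n"
proof -
  define ext where "ext f n = keys_sum (\<lambda>w c. f w * coeff c) n"
    for f :: "'w \<Rightarrow> ('w \<Rightarrow>\<^sub>0 'a)" and n
  define F where "F f w = (if R w = {} then single w 1 else ext f (SOME p. p \<in> R w))" for f w
  define nf where "nf = wfrec ord F"
  define N where "N = ext nf"
  have ext_add: "ext f (m + n) = ext f m + ext f n" for f m n
    unfolding ext_def using keys_sum_add[OF add_subgroup_zero, of "\<lambda>w c. f w * coeff c" m n]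
    by (simp add: distrib_left)
  have ext_single: "ext f (single w c) = f w * coeff c" for f w c
    unfolding ext_def by (rule keys_sum_single) simp
  have N_add: "N (m + n) = N m + N n" for m n
    by (simp add: N_def ext_add)
  have N0: "N 0 = 0" using N_add[of 0 0] by simp
  have N_diff: "N (m - n) = N m - N n" for m n
    using N_add[of "m - n" n] by simp
  have N_single: "N (single w c) = nf w * coeff c" for w c
    by (simp add: N_def ext_single)
  have N_coeff: "N (n * coeff a) = N n * coeff a" for n a
    by (induction n rule: poly_mapping_additive_induct)
      (simp_all add: N0 N_add distrib_right N_single single_times_coeff mult.assoc)
  have nf: "nf w = (if R w = {} then single w 1 else N (SOME p. p \<in> R w))" for w
  proof -
    have nf_rec: "nf w = F (cut nf ord w) w"
      unfolding nf_def by (rule wfrec[OF wf])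
    show ?thesis
    proof (cases "R w = {}")
      case False
      then have "(SOME p. p \<in> R w) \<in> R w" by (simp add: some_in_eq)
      then have "ext (cut nf ord w) (SOME p. p \<in> R w) = N (SOME p. p \<in> R w)"
        unfolding N_def ext_def keys_sum_def
        by (intro sum.cong refl) (simp add: cut_apply[OF less])
      with False nf_rec show ?thesis by (simp add: F_def)
    qed (simp add: nf_rec F_def)
  qed
  have main: "\<forall>p\<in>R w. N (single w 1 - p) = 0" for w
    using wf
  proof (induction w rule: wf_induct_rule)
    case (less w)
    show ?case
    proof
      fix p assume p: "p \<in> R w"
      define q where "q = (SOME p. p \<in> R w)"
      have q: "q \<in> R w" using p unfolding q_def by (rule someI)
      have "N (q - p) \<in> {0}"
        using confluent[OF q p]
      proof (rule right_hull_image)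
        fix s assume "s \<in> {single v 1 - s | v s. (v, w) \<in> ord \<and> s \<in> R v}"
        then show "N s \<in> {0}" using less.IH by auto
      qed (simp_all add: right_submodule_def N_add N_coeff)
      moreover have "N (single w 1) = N q"
        using p by (auto simp: N_single nf q_def)
      ultimately show "N (single w 1 - p) = 0"
        by (simp add: N_diff)
    qed
  qed
  have irreducible: "N n = n" if "\<And>w. w \<in> keys n \<Longrightarrow> R w = {}" for n
  proof -
    have "keys n \<subseteq> {w. R w = {}}" using that by blast
    then show ?thesis
      by (induction n rule: poly_mapping_support_induct)
        (simp_all add: N0 N_add N_single nf single_times_coeff)
  qed
  show thesis by (rule that[OF N_add N_coeff _ irreducible]) (use main in auto)
qed

text \<open>
  Two descents of a word coincide, overlap in one letter, or are disjoint; the last two cases are the critical pairs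
  of the sorting rules below.
\<close>

lemma append_two_cases:
  assumes "u @ x # y # t = u' @ x' # y' # t'" "length u \<le> length u'"
  obtains "u' = u" "x' = x" "y' = y" "t' = t"
  | "u' = u @ [x]" "x' = y" "t = y' # t'"
  | s where "u' = u @ [x, y] @ s" "t = s @ x' # y' # t'"
proof -
  from assms obtain d where d: "u' = u @ d" "x # y # t = d @ x' # y' # t'"
    by (auto simp: append_eq_append_conv2)
  show thesis
  proof (cases d)
    case Nil
    with d that(1) show ?thesis by auto
  next
    case (Cons e d')
    show ?thesis
    proof (cases d')
      case Nil
      with Cons d that(2) show ?thesis by auto
    next
      case (Cons e' d'')
      with \<open>d = e # d'\<close> d that(3) show ?thesis by auto
    qed
  qed
qed

context smash_basis
begin

section \<open>Relations in the model\<close>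

abbreviation monomial :: "'v list \<Rightarrow> ('v fword \<Rightarrow>\<^sub>0 'a)" where
  "monomial xs \<equiv> single (FWord xs) 1"

lemma monomial_append: "monomial (xs @ ys) = monomial xs * monomial ys"
  by (simp add: mult_single)

lemma monomial_Cons: "monomial (x # xs) = monomial [x] * monomial xs"
  by (simp add: mult_single)

lemma monomial_Nil: "monomial [] = 1"
  by (simp flip: zero_fword_def)

lemma monomial_in_tens_B: "set xs \<subseteq> B \<Longrightarrow> monomial xs \<in> tens_B (length xs)"
  by (rule tens_B_single) (simp add: Bwords_def)

text \<open>
  The operators by which \<open>\<kappa>(v, w)\<close> and \<open>commutator v w\<close> act (\<open>rep_commutator\<close>).
\<close>

definition kappa_op :: "'v \<Rightarrow> 'v \<Rightarrow> ('v fword \<Rightarrow>\<^sub>0 'a) \<Rightarrow> ('v fword \<Rightarrow>\<^sub>0 'a)" where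
  "kappa_op v w n = vec (kV v w) * n + L (kA v w) n"

definition comm_op :: "'v \<Rightarrow> 'v \<Rightarrow> ('v fword \<Rightarrow>\<^sub>0 'a) \<Rightarrow> ('v fword \<Rightarrow>\<^sub>0 'a)" where
  "comm_op v w n = vec v * (vec w * n) - vec w * (vec v * n) - kappa_op v w n"

lemma rep_commutator: "rep (commutator v w) n = comm_op v w n"
  by (simp add: commutator_def comm_op_def kappa_op_def rep_diff_left rep_add_left rep_mult rep_inV rep_inA)

lemma comm_op_add: "comm_op v w (m + n) = comm_op v w m + comm_op v w n"
  by (simp add: rep_add flip: rep_commutator)

lemma comm_op_diff: "comm_op v w (m - n) = comm_op v w m - comm_op v w n"
  by (simp add: rep_diff flip: rep_commutator)

lemma comm_op_times_coeff: "comm_op v w (n * coeff a) = comm_op v w n * coeff a"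
  by (simp add: rep_times_coeff flip: rep_commutator)

lemma comm_op_zero [simp]: "comm_op v w 0 = 0"
  by (simp add: rep_zero flip: rep_commutator)

lemma comm_op_same: "comm_op v v n = 0"
  by (simp add: comm_op_def kappa_op_def kV_same kA_same)

lemma vec_minus: "vec (- v) = - vec v"
  using linear_modD(1)[OF linear_vec, of "- v" v] by (simp add: eq_neg_iff_add_eq_0)

lemma L_minus: "L (- a) n = - L a n"
  using L_add_left[of "- a" a n] by (simp add: eq_neg_iff_add_eq_0)

lemma comm_op_swap: "comm_op w v n = - comm_op v w n"
  by (simp add: comm_op_def kappa_op_def kV_swap[of w v] kA_swap[of w v] vec_minus L_minus)

lemma linear_comm_op:
  "linear_mod scV scN {0} (\<lambda>v. comm_op v w n)" "linear_mod scV scN {0} (\<lambda>w. comm_op v w n)"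
  unfolding comm_op_def kappa_op_def by (intro linear_intros)+

lemmas model_memI = basis_linear_memI[OF B V.module_axioms module_scN subspace_zero]

text \<open>
  \<open>relator u x y t\<close> is the difference of the two sides of the rewriting rule \<open>u x y t \<rightarrow> u y x t + u \<kappa>(x, y) t\<close>, which is used when
  \<open>y < x\<close>. The predicate \<open>P\<close> in \<open>relators P\<close> bounds the leading word.
\<close>

definition descent :: "'v list \<Rightarrow> 'v \<Rightarrow> 'v \<Rightarrow> 'v list \<Rightarrow> bool" where
  "descent u x y t \<longleftrightarrow> set u \<subseteq> B \<and> x \<in> B \<and> y \<in> B \<and> set t \<subseteq> B \<and> (y, x) \<in> r \<and> x \<noteq> y"

definition relator :: "'v list \<Rightarrow> 'v \<Rightarrow> 'v \<Rightarrow> 'v list \<Rightarrow> ('v fword \<Rightarrow>\<^sub>0 'a)" where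
  "relator u x y t = monomial u * comm_op x y (monomial t)"

definition relators :: "('v list \<Rightarrow> bool) \<Rightarrow> ('v fword \<Rightarrow>\<^sub>0 'a) set" where
  "relators P = right_submodule hull {relator u x y t | u x y t. descent u x y t \<and> P (u @ [x, y] @ t)}"

abbreviation relators_upto :: "nat \<Rightarrow> ('v fword \<Rightarrow>\<^sub>0 'a) set" where
  "relators_upto k \<equiv> relators (\<lambda>w. length w \<le> k)"

lemma right_submodule_relators: "right_submodule (relators P)"
  unfolding relators_def by (rule right_submodule_hull)

lemma relators_add: "m \<in> relators P \<Longrightarrow> n \<in> relators P \<Longrightarrow> m + n \<in> relators P"
  and relators_coeff: "n \<in> relators P \<Longrightarrow> n * coeff a \<in> relators P"
  and relators_zero: "0 \<in> relators P"
  using right_submodule_relators[of P] by (auto simp: right_submodule_def)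

lemmas relators_diff = right_submodule_diff[OF right_submodule_relators]
lemmas relators_uminus = right_submodule_uminus[OF right_submodule_relators]

lemma subspace_relators: "scN.subspace (relators P)"
  by (simp add: scN.subspace_def relators_add relators_zero scN_def relators_coeff)

lemma zero_subset_relators: "{0} \<subseteq> relators P"
  by (simp add: relators_zero)

lemma relatorI: "descent u x y t \<Longrightarrow> P (u @ [x, y] @ t) \<Longrightarrow> relator u x y t \<in> relators P"
  unfolding relators_def by (rule hull_inc) blast

lemma relators_mono: "(\<And>w. P w \<Longrightarrow> Q w) \<Longrightarrow> relators P \<subseteq> relators Q"
  unfolding relators_def by (rule hull_mono) blast

lemma relators_upto_mono: "i \<le> j \<Longrightarrow> relators_upto i \<subseteq> relators_upto j"
  by (rule relators_mono) simp

lemma order_antisym: "(x, y) \<in> r \<Longrightarrow> (y, x) \<in> r \<Longrightarrow> x = y"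
  using r by (auto simp: order_on_defs dest: antisymD)

lemma order_trans: "(x, y) \<in> r \<Longrightarrow> (y, z) \<in> r \<Longrightarrow> (x, z) \<in> r"
  using r by (auto simp: order_on_defs dest: transD)

lemma order_total: "x \<in> B \<Longrightarrow> y \<in> B \<Longrightarrow> (x, y) \<in> r \<or> (y, x) \<in> r"
  using r by (cases "x = y") (auto simp: order_on_defs total_on_def refl_on_def)

text \<open>
  Relators with arbitrary vectors in place of the two letters, and arbitrary elements in place of \<open>t\<close>,
  are combinations of relators of at most the same degree: expand in the basis, and use that
  \<open>comm_op x y\<close> is alternating in \<open>x\<close> and \<open>y\<close>.
\<close>

lemma comm_op_in_relators:
  assumes u: "set u \<subseteq> B" and n: "n \<in> tens_B k" and k: "length u + 2 + k \<le> j"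
  shows "monomial u * comm_op v w n \<in> relators_upto j"
  using n
proof (induction n rule: tens_B_induct)
  case zero
  show ?case by (simp add: relators_zero)
next
  case (add m n)
  then show ?case by (simp add: comm_op_add distrib_left relators_add)
next
  case (single t c)
  let ?t = "letters t"
  have t: "set ?t \<subseteq> B" "length ?t \<le> k" using single by (auto simp: Bwords_def)
  have "monomial u * comm_op x y (monomial ?t) \<in> relators_upto j" if "x \<in> B" "y \<in> B" for x y
  proof -
    have *: "relator u x y ?t \<in> relators_upto j" if "(y, x) \<in> r" "x \<noteq> y" "x \<in> B" "y \<in> B" for x y
      using that u t k by (intro relatorI) (auto simp: descent_def)
    consider "x = y" | "(y, x) \<in> r" "x \<noteq> y" | "(x, y) \<in> r" "x \<noteq> y"
      using order_total \<open>x \<in> B\<close> \<open>y \<in> B\<close> by blast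
    then show ?thesis
    proof cases
      case 1
      then show ?thesis by (simp add: comm_op_same relators_zero)
    next
      case 2
      with *[of y x] that show ?thesis by (simp add: relator_def)
    next
      case 3
      with *[of x y] that show ?thesis
        by (auto simp: relator_def comm_op_swap[of x y] intro: relators_uminus)
    qed
  qed
  then have "monomial u * comm_op v y (monomial ?t) \<in> relators_upto j" if "y \<in> B" for y
    by (rule model_memI[where f = "\<lambda>v. monomial u * comm_op v y (monomial ?t)",
          OF linear_scN_mult_right[OF linear_comm_op(1)] subspace_relators zero_subset_relators]) (use that in auto)
  then have "monomial u * comm_op v w (monomial ?t) \<in> relators_upto j"
    by (rule model_memI[where f = "\<lambda>w. monomial u * comm_op v w (monomial ?t)",
          OF linear_scN_mult_right[OF linear_comm_op(2)] subspace_relators zero_subset_relators])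
  then have "monomial u * comm_op v w (monomial ?t) * coeff c \<in> relators_upto j"
    by (rule relators_coeff)
  also have "monomial u * comm_op v w (monomial ?t) * coeff c = monomial u * comm_op v w (monomial ?t * coeff c)"
    by (simp add: comm_op_times_coeff mult.assoc)
  finally show ?case by (simp add: single_times_coeff)
qed

lemma monomial_times_relators:
  assumes "n \<in> relators_upto k" "set u \<subseteq> B" "length u + k \<le> j"
  shows "monomial u * n \<in> relators_upto j"
  using assms(1) unfolding relators_def[of "\<lambda>w. length w \<le> k"]
proof (rule right_hull_image)
  fix s assume "s \<in> {relator u x y t |u x y t. descent u x y t \<and> length (u @ [x, y] @ t) \<le> k}"
  then obtain u' x y t where s: "s = relator u' x y t" "descent u' x y t" "length (u' @ [x, y] @ t) \<le> k"
    by blast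
  have "monomial u * s = relator (u @ u') x y t"
    unfolding s relator_def monomial_append by (simp add: mult.assoc)
  also have "\<dots> \<in> relators_upto j"
    using s assms by (intro relatorI) (auto simp: descent_def)
  finally show "monomial u * s \<in> relators_upto j" .
qed (simp_all add: right_submodule_relators distrib_left mult.assoc)

lemma vec_times_relators:
  assumes "n \<in> relators_upto k" shows "vec v * n \<in> relators_upto (Suc k)"
proof (rule model_memI[OF _ subspace_relators zero_subset_relators])
  show "linear_mod scV scN {0} (\<lambda>v. vec v * n)" by (intro linear_intros)
  show "vec b * n \<in> relators_upto (Suc k)" if "b \<in> B" for b
    using monomial_times_relators[OF assms, of "[b]"] that by (simp add: vec_basis)
qed

section \<open>Confluence\<close>

text \<open>
  Words are compared by length, then by the number of inversions: the \<open>\<kappa>\<close>-terms are shorter, and a swap of a descent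
  removes exactly one inversion.
\<close>

primrec inversions :: "'v list \<Rightarrow> nat" where
  "inversions [] = 0"
| "inversions (x # xs) = length (filter (\<lambda>y. (y, x) \<in> r \<and> y \<noteq> x) xs) + inversions xs"

lemma inversions_swap:
  assumes "(y, x) \<in> r" "x \<noteq> y"
  shows "inversions (u @ [y, x] @ t) < inversions (u @ [x, y] @ t)"
  using assms order_antisym[of x y] by (induction u) auto

definition word_less :: "'v list \<Rightarrow> 'v list \<Rightarrow> bool" where
  "word_less v w \<longleftrightarrow> length v < length w \<or> length v = length w \<and> inversions v < inversions w"

lemma word_less_trans: "word_less u v \<Longrightarrow> word_less v w \<Longrightarrow> word_less u w"
  by (auto simp: word_less_def)

lemma word_less_swap:
  "(y, x) \<in> r \<Longrightarrow> x \<noteq> y \<Longrightarrow> w = u @ [y, x] @ t \<Longrightarrow> w' = u @ [x, y] @ t \<Longrightarrow> word_less w w'"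
  using inversions_swap[of y x u t] by (simp add: word_less_def)

abbreviation relators_below :: "'v list \<Rightarrow> ('v fword \<Rightarrow>\<^sub>0 'a) set" where
  "relators_below w \<equiv> relators (\<lambda>v. word_less v w)"

lemma relators_upto_below: "n \<in> relators_upto k \<Longrightarrow> k < length w \<Longrightarrow> n \<in> relators_below w"
  using relators_mono[of "\<lambda>v. length v \<le> k" "\<lambda>v. word_less v w"] by (auto simp: word_less_def)

lemma kappa_op_in_tens_B: "n \<in> tens_B k \<Longrightarrow> kappa_op v w n \<in> tens_B (Suc k)"
  unfolding kappa_op_def
  using tens_B_mono[of k "Suc k"] by (auto intro!: tens_B_add vec_mult_in_tens_B dest: L_in_tens_B)

definition sorted_words :: "'v fword set" where
  "sorted_words = {w. set (letters w) \<subseteq> B \<and> sorted_wrt (\<lambda>x y. (x, y) \<in> r) (letters w)}"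

context
  assumes cond_a: cond_a and cond_b: cond_b and cond_c: cond_c
begin

text \<open>
  This is \<open>skew_identity_b\<close> applied to the model, where condition (b) removes the defects.
\<close>

lemma L_comm_op:
  assumes n: "n \<in> tens_B k"
  shows "L a (comm_op v w n) = sweedler3 scN \<Delta> (\<lambda>x y z. comm_op (act x v) (act y w) (L z n)) a"
proof -
  let ?T = "sweedler3 fscale \<Delta> (\<lambda>x y z. commutator (act x v) (act y w) * inA z) a"
  have b: "b_defect_A a v w = 0" "embVA (b_defect_VA a v w) \<in> skew_ideal"
    using cond_b embVA_tens_rel unfolding cond_b_iff by blast+
  have "L a (comm_op v w n) = rep (inA a * commutator v w) n"
    by (simp add: rep_mult rep_inA rep_commutator)
  also have "\<dots> = rep (?T + (embVA (b_defect_VA a v w) + inA (b_defect_A a v w))) n"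
    by (rule rep_skew_cong[OF cond_a skew_identity_b n])
  also have "\<dots> = rep ?T n"
    by (simp add: rep_add_left b rep_inA rep_skew[OF cond_a b(2) n])
  finally show ?thesis
    by (simp add: rep_sweedler3 rep_mult rep_inA rep_commutator)
qed

text \<open>
  Move \<open>a\<close> past the letters of \<open>u\<close> in the relator \<open>u comm_op x y t\<close>, by induction on \<open>u\<close>, and then past \<open>comm_op\<close>
  with \<open>L_comm_op\<close>. At no step does the degree grow.
\<close>

lemma L_relators:
  assumes "n \<in> relators_upto k" shows "L a n \<in> relators_upto k"
  using assms unfolding relators_def
proof (rule right_hull_image)
  fix s assume "s \<in> {relator u x y t |u x y t. descent u x y t \<and> length (u @ [x, y] @ t) \<le> k}"
  then obtain u x y t where s: "s = relator u x y t" "descent u x y t" "length (u @ [x, y] @ t) \<le> k"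
    by blast
  have "L a (monomial u * comm_op v w n) \<in> relators_upto (length u + 2 + j)"
    if "set u \<subseteq> B" "n \<in> tens_B j" for v w n j u
    using that(1)
  proof (induction u arbitrary: a)
    case Nil
    show ?case
      using comm_op_in_relators[of "[]", OF _ L_in_tens_B[OF that(2)]]
      by (auto simp: monomial_Nil L_comm_op[OF that(2)] intro!: sweedler3_mem[OF module_scN subspace_relators])
  next
    case (Cons b u)
    have "L a (monomial (b # u) * comm_op v w n) = L a (monomial [b] * (monomial u * comm_op v w n))"
      by (simp add: monomial_Cons[of b u] mult.assoc)
    also have "\<dots> = sweedler2 scN \<Delta> (\<lambda>p q. vec (act p b) * L q (monomial u * comm_op v w n)) a
        + L (l a b) (monomial u * comm_op v w n)"
      by (rule L_letter)
    also have "\<dots> \<in> relators_upto (Suc (length u + 2 + j))"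
    proof (intro relators_add sweedler2_mem[OF module_scN subspace_relators] vec_times_relators Cons.IH)
      show "L (l a b) (monomial u * comm_op v w n) \<in> relators_upto (Suc (length u + 2 + j))"
        using Cons relators_upto_mono[of "length u + 2 + j" "Suc (length u + 2 + j)"]
        by auto
    qed (use Cons.prems in auto)
    finally show ?case by simp
  qed
  from this[of u "monomial t" "length t" x y]
  have "L a s \<in> relators_upto (length u + 2 + length t)"
    using s(2) monomial_in_tens_B[of t] unfolding s relator_def by (auto simp: descent_def)
  then show "L a s \<in> right_submodule hull {relator u x y t |u x y t. descent u x y t \<and> length (u @ [x, y] @ t) \<le> k}"
    using relators_upto_mono[of "length u + 2 + length t" k] s(3)
    unfolding relators_def by auto
qed (simp_all add: right_submodule_hull L_add L_times_coeff)

lemma kappa_op_relators: "n \<in> relators_upto k \<Longrightarrow> kappa_op v w n \<in> relators_upto (Suc k)"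
  unfolding kappa_op_def
  using relators_upto_mono[of k "Suc k"]
  by (auto intro!: relators_add vec_times_relators dest: L_relators)

lemma comm_op_basis: "x \<in> B \<Longrightarrow> y \<in> B \<Longrightarrow>
    comm_op x y n = monomial [x, y] * n - monomial [y, x] * n - kappa_op x y n"
  by (simp add: comm_op_def vec_basis mult_single mult.assoc[symmetric])

text \<open>
  Expanding \<open>u c(x, y) s c(x', y') t\<close> first in one factor and then in the other gives the two relators of the word
  \<open>u x y s x' y' t\<close>, plus relators of smaller words. The term in which \<open>\<kappa>\<close> stands to the left of a relator is
  small only because relators are stable under \<open>A\<close>.
\<close>

lemma confluent_disjoint:
  assumes 1: "descent u x y (s @ [x', y'] @ t)" and 2: "descent (u @ [x, y] @ s) x' y' t"
  shows "relator u x y (s @ [x', y'] @ t) - relator (u @ [x, y] @ s) x' y' t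
    \<in> relators_below (u @ [x, y] @ s @ [x', y'] @ t)"
proof -
  let ?w = "u @ [x, y] @ s @ [x', y'] @ t"
  have B: "set u \<subseteq> B" "x \<in> B" "y \<in> B" "set s \<subseteq> B" "x' \<in> B" "y' \<in> B" "set t \<subseteq> B"
    and less: "(y, x) \<in> r" "x \<noteq> y" "(y', x') \<in> r" "x' \<noteq> y'"
    using 1 2 by (auto simp: descent_def)
  \<comment> \<open>The second factor is expanded in \<open>e2\<close>, the first one in \<open>e3\<close>.\<close>
  define c' where "c' = comm_op x' y' (monomial t)"
  have e1: "monomial s * c' = monomial (s @ [x', y'] @ t) - monomial (s @ [y', x'] @ t) - monomial s * kappa_op x' y' (monomial t)"
    unfolding c'_def comm_op_basis[OF B(5,6)] monomial_append by (simp add: algebra_simps)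
  have e2: "monomial u * comm_op x y (monomial s * c') =
      relator u x y (s @ [x', y'] @ t) - relator u x y (s @ [y', x'] @ t)
      - monomial u * comm_op x y (monomial s * kappa_op x' y' (monomial t))"
    unfolding e1 relator_def comm_op_diff by (simp add: right_diff_distrib)
  have e3: "monomial u * comm_op x y (monomial s * c') =
      relator (u @ [x, y] @ s) x' y' t - relator (u @ [y, x] @ s) x' y' t
      - monomial u * kappa_op x y (monomial s * c')"
    unfolding comm_op_basis[OF B(2,3)] relator_def monomial_append c'_def
    by (simp add: right_diff_distrib mult.assoc)
  have "relator u x y (s @ [x', y'] @ t) - relator (u @ [x, y] @ s) x' y' t =
      relator u x y (s @ [y', x'] @ t) + monomial u * comm_op x y (monomial s * kappa_op x' y' (monomial t))
      - relator (u @ [y, x] @ s) x' y' t - monomial u * kappa_op x y (monomial s * c')"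
    using e2 e3 by (simp add: algebra_simps)
  also have "\<dots> \<in> relators_below ?w"
  proof (intro relators_diff relators_add)
    show "relator u x y (s @ [y', x'] @ t) \<in> relators_below ?w"
      using B less by (intro relatorI word_less_swap[OF less(3,4), of _ "u @ [x, y] @ s" t])
        (auto simp: descent_def)
    show "relator (u @ [y, x] @ s) x' y' t \<in> relators_below ?w"
      using B less by (intro relatorI word_less_swap[OF less(1,2), of _ u "s @ [x', y'] @ t"])
        (auto simp: descent_def)
    have "monomial s * kappa_op x' y' (monomial t) \<in> tens_B (length s + Suc (length t))"
      using B by (intro tens_B_mult monomial_in_tens_B kappa_op_in_tens_B)
    then have "monomial u * comm_op x y (monomial s * kappa_op x' y' (monomial t))
        \<in> relators_upto (length u + 2 + (length s + Suc (length t)))"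
      using B by (intro comm_op_in_relators) auto
    then show "monomial u * comm_op x y (monomial s * kappa_op x' y' (monomial t)) \<in> relators_below ?w"
      by (rule relators_upto_below) simp
    have "monomial s * c' \<in> relators_upto (length s + 2 + length t)"
      unfolding c'_def using B by (intro comm_op_in_relators[OF _ monomial_in_tens_B]) auto
    then have "monomial u * kappa_op x y (monomial s * c') \<in> relators_upto (length u + Suc (length s + 2 + length t))"
      using B by (intro monomial_times_relators[OF kappa_op_relators]) auto
    then show "monomial u * kappa_op x y (monomial s * c') \<in> relators_below ?w"
      by (rule relators_upto_below) simp
  qed
  finally show ?thesis .
qed

text \<open>
  This is \<open>skew_identity_c\<close> applied to the model, where condition (c) removes the defects.
\<close>

lemma jacobi_comm_op:
  assumes n: "n \<in> tens_B k"
  shows "cyclic_sum (\<lambda>x y z. comm_op x y (vec z * n) - vec z * comm_op x y n + comm_op (kV x y) z n) u v w = 0"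
proof -
  have c: "c_defect_A u v w = 0" "embVA (c_defect_VA u v w) \<in> skew_ideal"
    using cond_c embVA_tens_rel unfolding cond_c_iff by blast+
  have "rep (cyclic_sum (\<lambda>x y z. commutator x y * inV z - inV z * commutator x y + commutator (kV x y) z) u v w) n
      = rep (inA (c_defect_A u v w) + embVA (c_defect_VA u v w)) n"
    by (rule rep_skew_cong[OF cond_a skew_identity_c n])
  also have "\<dots> = 0"
    by (simp add: rep_add_left c rep_inA rep_skew[OF cond_a c(2) n])
  finally show ?thesis
    by (simp add: cyclic_sum_def rep_add_left rep_diff_left rep_mult rep_inV rep_commutator)
qed

text \<open>
  The two reductions of \<open>x y z\<close> with \<open>z < y < x\<close> are compared by \<open>jacobi_comm_op\<close>: besides the two relators in question it
  contains four relators whose leading words have the letters \<open>x\<close>, \<open>y\<close>, \<open>z\<close> in another order with fewer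
  inversions, and relators of smaller degree.
\<close>

lemma confluent_overlap:
  assumes 1: "descent u x y (z # t)" and 2: "descent (u @ [x]) y z t"
  shows "relator u x y (z # t) - relator (u @ [x]) y z t \<in> relators_below (u @ [x, y, z] @ t)"
proof -
  let ?w = "u @ [x, y, z] @ t"
  have B: "set u \<subseteq> B" "x \<in> B" "y \<in> B" "z \<in> B" "set t \<subseteq> B"
    and less: "(y, x) \<in> r" "x \<noteq> y" "(z, y) \<in> r" "y \<noteq> z"
    using 1 2 by (auto simp: descent_def)
  have less': "(z, x) \<in> r" "x \<noteq> z"
    using less order_trans[of z y x] order_antisym[of y z] by auto
  let ?n = "monomial t"
  define D where "D = monomial u * comm_op (kV x y) z ?n + monomial u * comm_op (kV y z) x ?n + monomial u * comm_op (kV z x) y ?n"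
  have "0 = monomial u * cyclic_sum (\<lambda>x y z. comm_op x y (vec z * ?n) - vec z * comm_op x y ?n + comm_op (kV x y) z ?n) x y z"
    using jacobi_comm_op[OF monomial_in_tens_B[OF B(5)], of x y z] by simp
  also have "\<dots> = relator u x y (z # t) - relator (u @ [z]) x y t + relator u y z (x # t)
      - relator (u @ [x]) y z t - relator u x z (y # t) + relator (u @ [y]) x z t + D"
    unfolding relator_def D_def cyclic_sum_def comm_op_swap[of z x] monomial_append monomial_Cons[of _ t]
    using B by (simp add: vec_basis algebra_simps)
  finally have "relator u x y (z # t) - relator (u @ [x]) y z t =
      relator (u @ [z]) x y t - relator u y z (x # t) + relator u x z (y # t) - relator (u @ [y]) x z t - D"
    by (simp add: algebra_simps)
  also have "\<dots> \<in> relators_below ?w"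
  proof (intro relators_diff relators_add)
    have yxz: "word_less (u @ [y, x, z] @ t) ?w"
      by (rule word_less_swap[OF less(1,2), of _ u "z # t"]) auto
    have xzy: "word_less (u @ [x, z, y] @ t) ?w"
      by (rule word_less_swap[OF less(3,4), of _ "u @ [x]" t]) auto
    have zxy: "word_less (u @ [z, x, y] @ t) ?w"
      by (rule word_less_trans[OF _ xzy]) (rule word_less_swap[OF less', of _ u "y # t"]; simp)
    have yzx: "word_less (u @ [y, z, x] @ t) ?w"
      by (rule word_less_trans[OF _ yxz]) (rule word_less_swap[OF less', of _ "u @ [y]" t]; simp)
    show "relator (u @ [z]) x y t \<in> relators_below ?w"
      using B less zxy by (intro relatorI) (auto simp: descent_def)
    show "relator u y z (x # t) \<in> relators_below ?w"
      using B less yzx by (intro relatorI) (auto simp: descent_def)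
    show "relator u x z (y # t) \<in> relators_below ?w"
      using B less' xzy by (intro relatorI) (auto simp: descent_def)
    show "relator (u @ [y]) x z t \<in> relators_below ?w"
      using B less' yxz by (intro relatorI) (auto simp: descent_def)
    have "D \<in> relators_upto (length u + 2 + length t)"
      unfolding D_def using B by (intro relators_add comm_op_in_relators[OF _ monomial_in_tens_B]) auto
    then show "D \<in> relators_below ?w"
      by (rule relators_upto_below) simp
  qed
  finally show ?thesis .
qed

lemma confluent:
  assumes "descent u x y t" "descent u' x' y' t'" and w: "u @ [x, y] @ t = u' @ [x', y'] @ t'"
  shows "relator u x y t - relator u' x' y' t' \<in> relators_below (u @ [x, y] @ t)"
proof -
  have *: "relator u x y t - relator u' x' y' t' \<in> relators_below (u @ [x, y] @ t)"
    if "length u \<le> length u'" "descent u x y t" "descent u' x' y' t'" "u @ [x, y] @ t = u' @ [x', y'] @ t'"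
    for u x y t u' x' y' t'
  proof -
    from that(4) have "u @ x # y # t = u' @ x' # y' # t'" by simp
    then show ?thesis
    proof (rule append_two_cases[OF _ that(1)])
      assume "u' = u" "x' = x" "y' = y" "t' = t"
      then show ?thesis by (simp add: relators_zero)
    next
      assume "u' = u @ [x]" "x' = y" "t = y' # t'"
      then show ?thesis using confluent_overlap[of u x y y' t'] that by simp
    next
      fix s assume "u' = u @ [x, y] @ s" "t = s @ x' # y' # t'"
      then show ?thesis using confluent_disjoint[of u x y s x' y' t'] that by simp
    qed
  qed
  show ?thesis
  proof (cases "length u \<le> length u'")
    case True
    then show ?thesis using assms by (rule *)
  next
    case False
    then have "relator u' x' y' t' - relator u x y t \<in> relators_below (u @ [x, y] @ t)"
      using *[of u' u x' y' t' x y t] assms by simp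
    from relators_uminus[OF this] show ?thesis by simp
  qed
qed

text \<open>
  The diamond lemma for the rules above. A sorted word has no descent and is irreducible.
\<close>

lemma normal_form_exists:
  obtains N where "\<And>k n. n \<in> relators_upto k \<Longrightarrow> N n = (0 :: 'v fword \<Rightarrow>\<^sub>0 'a)"
    "\<And>n. n \<in> words_in sorted_words \<Longrightarrow> N n = n"
proof -
  \<comment> \<open>The right sides of all rules that apply to \<open>w\<close>.\<close>
  define R where "R w = {monomial (u @ [y, x] @ t) + monomial u * kappa_op x y (monomial t) | u x y t.
      descent u x y t \<and> w = FWord (u @ [x, y] @ t)}" for w
  define ord where "ord = {(v, w). word_less (letters v) (letters w)}"
  have relator_eq: "relator u x y t = monomial (u @ [x, y] @ t) - (monomial (u @ [y, x] @ t) + monomial u * kappa_op x y (monomial t))"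
    if "descent u x y t" for u x y t
    using that unfolding relator_def monomial_append descent_def
    by (simp add: comm_op_basis algebra_simps)
  have below: "relators_below w \<subseteq> right_submodule hull
      {single v 1 - s | v s. (v, FWord w) \<in> ord \<and> s \<in> R v}" for w
    unfolding relators_def
  proof (rule hull_mono, clarify)
    fix u x y t assume "descent u x y t" "word_less (u @ [x, y] @ t) w"
    then show "\<exists>v s. relator u x y t = single v 1 - s \<and> (v, FWord w) \<in> ord \<and> s \<in> R v"
      unfolding R_def ord_def
      by (intro exI[of _ "FWord (u @ [x, y] @ t)"]
          exI[of _ "monomial (u @ [y, x] @ t) + monomial u * kappa_op x y (monomial t)"])
        (auto simp: relator_eq)
  qed
  obtain N where N: "\<And>m n. N (m + n) = N m + N n" "\<And>n a. N (n * coeff a) = N n * coeff a"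
    "\<And>w p. p \<in> R w \<Longrightarrow> N (single w 1 - p) = 0"
    "\<And>n. (\<And>w. w \<in> keys n \<Longrightarrow> R w = {}) \<Longrightarrow> N n = n"
  proof (rule diamond_lemma[of ord R])
    have "ord = measures [\<lambda>w. length (letters w), \<lambda>w. inversions (letters w)]"
      by (auto simp: ord_def word_less_def)
    then show "wf ord" by (simp add: wf_measures)
  next
    fix w p v assume "p \<in> R w" "v \<in> keys p"
    then obtain u x y t where d: "descent u x y t" "w = FWord (u @ [x, y] @ t)"
      and v: "v \<in> keys (monomial (u @ [y, x] @ t) + monomial u * kappa_op x y (monomial t))"
      by (auto simp: R_def)
    have B: "set u \<subseteq> B" "set t \<subseteq> B" and less: "(y, x) \<in> r" "x \<noteq> y"
      using d by (auto simp: descent_def)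
    have "monomial u * kappa_op x y (monomial t) \<in> tens_B (length u + Suc (length t))"
      using B by (intro tens_B_mult kappa_op_in_tens_B monomial_in_tens_B)
    then have "v = FWord (u @ [y, x] @ t) \<or> length (letters v) \<le> length u + Suc (length t)"
      using v keys_add[of "monomial (u @ [y, x] @ t)" "monomial u * kappa_op x y (monomial t)"]
      by (auto simp: tens_B_def words_in_def Bwords_def)
    then show "(v, w) \<in> ord"
      using word_less_swap[OF less, of _ u t] d by (auto simp: ord_def word_less_def)
  next
    fix w p q assume "p \<in> R w" "q \<in> R w"
    then obtain u x y t u' x' y' t' where d: "descent u x y t" "descent u' x' y' t'"
      and w: "w = FWord (u @ [x, y] @ t)" "u @ [x, y] @ t = u' @ [x', y'] @ t'"
      and p: "p = monomial (u @ [y, x] @ t) + monomial u * kappa_op x y (monomial t)"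
      and q: "q = monomial (u' @ [y', x'] @ t') + monomial u' * kappa_op x' y' (monomial t')"
      by (auto simp: R_def)
    have "p - q = relator u' x' y' t' - relator u x y t"
      unfolding relator_eq[OF d(1)] relator_eq[OF d(2)] p q w(2) by simp
    also have "\<dots> \<in> relators_below (u @ [x, y] @ t)"
      using confluent[OF d(2,1)] w by simp
    finally show "p - q \<in> right_submodule hull {single v 1 - s | v s. (v, w) \<in> ord \<and> s \<in> R v}"
      using below w(1) by blast
  qed blast
  show thesis
  proof (rule that[of N])
    fix k n assume "n \<in> relators_upto k"
    then have "N n \<in> {0}"
      unfolding relators_def
    proof (rule right_hull_image)
      fix s assume "s \<in> {relator u x y t |u x y t. descent u x y t \<and> length (u @ [x, y] @ t) \<le> k}"
      then obtain u x y t where s: "s = relator u x y t" "descent u x y t" by blast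
      have "monomial (u @ [y, x] @ t) + monomial u * kappa_op x y (monomial t) \<in> R (FWord (u @ [x, y] @ t))"
        using s(2) by (auto simp: R_def)
      from N(3)[OF this] show "N s \<in> {0}" by (simp add: s relator_eq)
    qed (simp_all add: right_submodule_def N)
    then show "N n = 0" by simp
  next
    fix n assume n: "n \<in> words_in sorted_words"
    show "N n = n"
    proof (rule N(4))
      fix w assume "w \<in> keys n"
      then have "sorted_wrt (\<lambda>x y. (x, y) \<in> r) (letters w)"
        using n by (auto simp: words_in_def sorted_words_def)
      then show "R w = {}"
        using order_antisym by (auto simp: R_def descent_def sorted_wrt_append)
    qed
  qed
qed

text \<open>
  The elements of the free algebra that send \<open>T(V) \<otimes> A\<close> into the span of the relators form a two-sided ideal, because
  this span is stable under the action. The ideal contains the defining relations.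
\<close>

lemma rep_H:
  assumes "p \<in> H_ideal" "n \<in> tens_B k" shows "\<exists>j. rep p n \<in> relators_upto j"
proof -
  let ?I = "{p. \<forall>k. \<forall>n\<in>tens_B k. \<exists>j. rep p n \<in> relators_upto j}"
  have up: "\<exists>j. m \<in> relators_upto j \<and> n \<in> relators_upto j"
    if "m \<in> relators_upto i" "n \<in> relators_upto i'" for m n i i'
    using that relators_upto_mono[of i "max i i'"] relators_upto_mono[of i' "max i i'"]
    by (intro exI[of _ "max i i'"]) auto
  have step: "\<exists>j. rep q m \<in> relators_upto j" if "m \<in> relators_upto i" for q m i
  proof (induction q rule: poly_mapping_additive_induct)
    case zero
    show ?case by (simp add: rep_zero_left relators_zero)
  next
    case (single w c)
    have "foldr (\<lambda>(v, a) n. vec v * n + L a n) xs m \<in> relators_upto (i + length xs)" for xs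
    proof (induction xs)
      case (Cons x xs)
      then show ?case
        using relators_upto_mono[of "i + length xs" "Suc (i + length xs)"]
        by (cases x) (auto intro!: relators_add vec_times_relators dest: L_relators)
    qed (use that in simp)
    then show ?case
      unfolding rep_single op_word_def scN_def by (blast intro: relators_coeff)
  next
    case (add p q)
    then obtain i i' where "rep p m \<in> relators_upto i" "rep q m \<in> relators_upto i'" by blast
    from up[OF this] show ?case unfolding rep_add_left by (blast intro: relators_add)
  qed
  have "0 \<in> ?I" by (simp add: rep_zero_left relators_zero)
  moreover have "p + q \<in> ?I" if "p \<in> ?I" "q \<in> ?I" for p q
  proof clarify
    fix k n assume "n \<in> tens_B k"
    with that obtain i i' where "rep p n \<in> relators_upto i" "rep q n \<in> relators_upto i'" by blast
    from up[OF this] show "\<exists>j. rep (p + q) n \<in> relators_upto j"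
      unfolding rep_add_left by (blast intro: relators_add)
  qed
  moreover have "q * p \<in> ?I" if "p \<in> ?I" for p q
    using that step[where q = q] by (simp add: rep_mult) blast
  moreover have "p * q \<in> ?I" if "p \<in> ?I" for p q
    using that rep_in_tens_B[where p = q] by (simp add: rep_mult) blast
  ultimately have "two_sided_ideal ?I"
    unfolding two_sided_ideal_def by blast
  moreover have "p \<in> ?I" if "p \<in> skew_rels \<union> {commutator v w | v w. True}" for p
  proof -
    from that consider "p \<in> skew_rels" | v w where "p = commutator v w" by blast
    then show ?thesis
    proof cases
      case 1
      then show ?thesis
        using rep_skew[OF cond_a rel_skew[OF 1]] relators_zero by auto
    next
      case 2
      have "comm_op v w n \<in> relators_upto (2 + k)" if "n \<in> tens_B k" for n k
        using comm_op_in_relators[of "[]", OF _ that] by (simp add: monomial_Nil)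
      then have "\<exists>j. comm_op v w n \<in> relators_upto j" if "n \<in> tens_B k" for n k
        using that by (intro exI)
      then show ?thesis by (simp add: 2 rep_commutator)
    qed
  qed
  ultimately have "H_ideal \<subseteq> ?I"
    unfolding H_ideal_eq by (intro hull_minimal) auto
  then show ?thesis using assms by blast
qed

end

text \<open>
  The combination of words in \<open>V\<close> with coefficients in \<open>A\<close> on the right, as an element of the free algebra. For sorted words these
  are the combinations of the ordered monomials.
\<close>

definition normal_elt :: "('v fword \<Rightarrow>\<^sub>0 'a) \<Rightarrow> (('v \<times> 'a) fword \<Rightarrow>\<^sub>0 'k)" where
  "normal_elt n = keys_sum (\<lambda>w a. prod_list (map inV (letters w)) * inA a) n"

text \<open>
  Acting on \<open>1 \<otimes> 1\<close> recovers the coefficients.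
\<close>

lemma rep_normal_elt:
  assumes "n \<in> tens_B k" shows "rep (normal_elt n) 1 = n"
proof -
  have "rep (prod_list (map inV xs)) m = monomial xs * m" if "set xs \<subseteq> B" for xs m
    using that
    by (induction xs) (auto simp: monomial_Nil rep_one rep_mult rep_inV vec_basis monomial_Cons[of _ "_ # _"] mult_single mult.assoc[symmetric])
  then have "rep (prod_list (map inV (letters w)) * inA a) 1 = single w a"
    if "set (letters w) \<subseteq> B" for w a
    using that by (simp add: rep_mult rep_inA single_times_coeff)
  then have "rep (normal_elt n) 1 = (\<Sum>w\<in>keys n. single w (lookup n w))"
    unfolding normal_elt_def keys_sum_def module_hom.sum[OF hom_rep]
    using assms by (intro sum.cong) (auto simp: tens_B_def words_in_def Bwords_def)
  then show ?thesis by (simp add: poly_mapping_sum_single)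
qed

lemma sorted_words_in_tens_B:
  assumes "n \<in> words_in sorted_words" shows "\<exists>k. n \<in> tens_B k"
proof -
  have "w \<in> Bwords (\<Sum>w\<in>keys n. length (letters w))" if "w \<in> keys n" for w
    using assms that member_le_sum[OF that, of "\<lambda>w. length (letters w)"]
    by (auto simp: words_in_def Bwords_def sorted_words_def)
  then have "n \<in> tens_B (\<Sum>w\<in>keys n. length (letters w))"
    by (auto simp: tens_B_def words_in_def)
  then show ?thesis by blast
qed

text \<open>
  Independence of the ordered monomials over \<open>A\<close>, without reference to a basis of \<open>A\<close>.
\<close>

definition PBW_independent :: bool where
  "PBW_independent \<longleftrightarrow> (\<forall>n\<in>words_in sorted_words. normal_elt n \<in> H_ideal \<longrightarrow> n = 0)"

lemma conditions_imp_independent: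
  assumes cond_a cond_b cond_c shows PBW_independent
  unfolding PBW_independent_def
proof (intro ballI impI)
  fix n assume n: "n \<in> words_in sorted_words" and H: "normal_elt n \<in> H_ideal"
  obtain N where N: "\<And>k n. n \<in> relators_upto k \<Longrightarrow> N n = (0 :: 'v fword \<Rightarrow>\<^sub>0 'a)"
    "\<And>n. n \<in> words_in sorted_words \<Longrightarrow> N n = n"
    using normal_form_exists[OF assms] by metis
  have "1 \<in> tens_B 0" using monomial_in_tens_B[of "[]"] by (simp add: monomial_Nil)
  from rep_H[OF assms H this] obtain j where "rep (normal_elt n) 1 \<in> relators_upto j" by blast
  moreover have "rep (normal_elt n) 1 = n"
    using sorted_words_in_tens_B[OF n] rep_normal_elt by blast
  ultimately show "n = 0" using N n by metis
qed

end

lemma subspace_span_preimage: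
  assumes "module_hom s t f" "\<And>x. x \<in> S \<Longrightarrow> f x \<in> U" "module.subspace t U" "x \<in> module.span s S"
  shows "f x \<in> U"
proof -
  interpret f: module_hom s t f by (rule assms(1))
  have "f.m1.span S \<subseteq> f -` U"
    using assms(2) f.subspace_vimage[OF assms(3)] by (intro f.m1.span_minimal) auto
  then show ?thesis using assms(4) by blast
qed

section \<open>Filtration by the number of factors from \<open>V\<close>\<close>

lemma gen_word_append: "gen_word (xs @ ys) = gen_word xs * gen_word ys"
  by (simp add: gen_word_def)

lemma gen_word_Cons: "gen_word (x # xs) = gen_word [x] * gen_word xs"
  by (simp add: gen_word_def)

lemma gen_word_single: "gen_word [Inl v] = inV v" "gen_word [Inr a] = inA a"
  by (simp_all add: gen_word_def)

abbreviation V_degree :: "('v + 'a) list \<Rightarrow> nat" where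
  "V_degree xs \<equiv> length (filter isl xs)"

lemma subspace_words: "F.subspace (words_below n)" "F.subspace (words_deg n)"
  unfolding words_below_def words_deg_def
  by (rule F.subspace_span)+

lemma gen_word_in_words: "V_degree xs < n \<Longrightarrow> gen_word xs \<in> words_below n"
    "V_degree xs = n \<Longrightarrow> gen_word xs \<in> words_deg n"
  unfolding words_below_def words_deg_def
  by (auto intro: F.span_base)

lemma words_below_0: "words_below 0 = {0}"
  unfolding words_below_def by (simp add: F.span_empty)

lemma words_deg_below: "n < k \<Longrightarrow> words_deg n \<subseteq> words_below k"
  unfolding words_below_def words_deg_def by (rule F.span_mono) auto

lemma words_below_Suc: "p \<in> words_below (Suc n) \<Longrightarrow> \<exists>q\<in>words_deg n. \<exists>q'\<in>words_below n. p = q + q'"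
proof -
  have "{gen_word xs |xs. V_degree xs < Suc n} =
      {gen_word xs |xs. V_degree xs = n} \<union> ({gen_word xs |xs. V_degree xs < n} :: (('a \<times> 'b) fword \<Rightarrow>\<^sub>0 'c) set)"
    by (auto simp: less_Suc_eq)
  then show "p \<in> words_below (Suc n) \<Longrightarrow> ?thesis" 
    unfolding words_below_def words_deg_def by (auto simp: F.span_Un)
qed

lemma gen_word_times_words_below:
  assumes "p \<in> words_below n" "n + V_degree xs \<le> k"
  shows "gen_word xs * p \<in> words_below k" "p * gen_word xs \<in> words_below k"
proof -
  show "gen_word xs * p \<in> words_below k"
    by (rule subspace_span_preimage[OF hom_fscale_mult_left _ subspace_words(1) assms(1)[unfolded words_below_def]])
      (use assms(2) in \<open>auto simp: gen_word_append[symmetric] intro!: gen_word_in_words\<close>)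
  show "p * gen_word xs \<in> words_below k"
    by (rule subspace_span_preimage[OF hom_fscale_mult_right _ subspace_words(1) assms(1)[unfolded words_below_def]])
      (use assms(2) in \<open>auto simp: gen_word_append[symmetric] intro!: gen_word_in_words\<close>)
qed

context smash_deformation
begin

lemma gr_relI: "x \<in> H_ideal \<Longrightarrow> y \<in> words_below n \<Longrightarrow> x + y \<in> gr_rel n"
  by (auto simp: gr_rel_def)

lemma H_subset_gr_rel: "H_ideal \<subseteq> gr_rel n"
proof
  fix x assume "x \<in> H_ideal"
  from gr_relI[OF this F.subspace_0[OF subspace_words(1)]] show "x \<in> gr_rel n"
    by simp
qed

lemma subspace_gr_rel: "F.subspace (gr_rel n)"
proof (rule F.subspaceI)
  show "0 \<in> gr_rel n"
    using H_subset_gr_rel F.subspace_0[OF subspace_H] by blast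
  fix p assume "p \<in> gr_rel n"
  then obtain x y where p: "p = x + y" "x \<in> H_ideal" "y \<in> words_below n" by (auto simp: gr_rel_def)
  show "fscale c p \<in> gr_rel n" for c
    unfolding p(1) F.scale_right_distrib
    by (intro gr_relI F.subspace_scale subspace_H subspace_words(1) p)
  fix q assume "q \<in> gr_rel n"
  then obtain x' y' where q: "q = x' + y'" "x' \<in> H_ideal" "y' \<in> words_below n" by (auto simp: gr_rel_def)
  have "p + q = (x + x') + (y + y')" by (simp add: p q)
  also have "\<dots> \<in> gr_rel n"
    by (intro gr_relI F.subspace_add subspace_H subspace_words(1) p q)
  finally show "p + q \<in> gr_rel n" .
qed

lemma gen_word_times_gr_rel:
  assumes "p \<in> gr_rel n" "n + V_degree xs \<le> k"
  shows "gen_word xs * p \<in> gr_rel k" "p * gen_word xs \<in> gr_rel k"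
proof -
  obtain x y where "p = x + y" "x \<in> H_ideal" "y \<in> words_below n"
    using assms(1) by (auto simp: gr_rel_def)
  then show "gen_word xs * p \<in> gr_rel k" "p * gen_word xs \<in> gr_rel k"
    using assms(2) by (simp_all add: distrib_left distrib_right
        gr_relI H_ideal_closed(3,4) gen_word_times_words_below)
qed

section \<open>The undeformed algebra\<close>

lemma ideal_H00: "two_sided_ideal H00_ideal"
  by (simp add: H00_ideal_def smash_ideal_def two_sided_ideal_hull)

lemma subspace_H00: "F.subspace H00_ideal"
  by (rule two_sided_ideal_subspace[OF ideal_H00])

lemma H00_closed: "p \<in> H00_ideal \<Longrightarrow> r * p \<in> H00_ideal" "p \<in> H00_ideal \<Longrightarrow> p * r \<in> H00_ideal"
  using ideal_H00 by (auto simp: two_sided_ideal_def)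

text \<open>
  \<open>H\<^sub>\<lambda>\<^sub>,\<^sub>\<kappa>\<close> and \<open>H\<^sub>0\<^sub>,\<^sub>0\<close> are compared by congruences that hold simultaneously in \<open>H\<^sub>0\<^sub>,\<^sub>0\<close> and, up to lower degree, in
  \<open>H\<^sub>\<lambda>\<^sub>,\<^sub>\<kappa>\<close>. The relations of \<open>A\<close> and of the tensor algebra hold in both algebras and in all degrees (\<open>base_ideal\<close>); the other
  two relations hold without \<open>\<lambda>\<close> and \<open>\<kappa>\<close> in a fixed degree (\<open>graded_rel\<close>).
\<close>

definition base_ideal :: "(('v \<times> 'a) fword \<Rightarrow>\<^sub>0 'k) set" where
  "base_ideal = H_ideal \<inter> H00_ideal"

lemma ideal_base: "two_sided_ideal base_ideal"
  using ideal_H ideal_H00 by (auto simp: base_ideal_def two_sided_ideal_def)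

lemma subspace_base: "F.subspace base_ideal"
  by (rule two_sided_ideal_subspace[OF ideal_base])

lemma group_base: "add_subgroup base_ideal"
  by (rule subspace_add_subgroup[OF module_fscale subspace_base])

lemma base_rels:
  "tensor_algebra_rels (sum_scale scV scA) \<subseteq> base_ideal"
  "inA (a * b) \<approx>[base_ideal] inA a * inA b"
  "inA 1 \<approx>[base_ideal] 1"
proof -
  have *: "p \<in> base_ideal" if "p \<in> tensor_algebra_rels (sum_scale scV scA)
      \<union> {inA (a * b) - inA a * inA b | a b. True} \<union> {inA 1 - 1}" for p
    using that unfolding base_ideal_def H_ideal_def H00_ideal_def smash_ideal_def
    by (intro IntI hull_inc) blast+
  show "tensor_algebra_rels (sum_scale scV scA) \<subseteq> base_ideal" using * by blast
  show "inA (a * b) \<approx>[base_ideal] inA a * inA b" unfolding cong_mod_def by (rule *) blast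
  show "inA 1 \<approx>[base_ideal] 1" unfolding cong_mod_def by (rule *) blast
qed

lemmas linear_inV_base = linear_generators(2)[OF base_rels(1)]
lemmas linear_inA_base = linear_generators(3)[OF base_rels(1)]

definition graded_rel :: "nat \<Rightarrow> (('v \<times> 'a) fword \<Rightarrow>\<^sub>0 'k) set" where
  "graded_rel n = H00_ideal \<inter> gr_rel n"

lemma subspace_graded: "F.subspace (graded_rel n)"
  unfolding graded_rel_def by (rule F.subspace_inter[OF subspace_H00 subspace_gr_rel])

lemma group_graded: "add_subgroup (graded_rel n)"
  by (rule subspace_add_subgroup[OF module_fscale subspace_graded])

lemma base_subset_graded: "base_ideal \<subseteq> graded_rel n"
  using H_subset_gr_rel by (auto simp: base_ideal_def graded_rel_def)

lemma base_imp_graded: "p \<approx>[base_ideal] q \<Longrightarrow> p \<approx>[graded_rel n] q"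
  using base_subset_graded by (auto simp: cong_mod_def)

lemma gen_word_times_graded:
  assumes "p \<in> graded_rel n" "n + V_degree xs \<le> k"
  shows "gen_word xs * p \<in> graded_rel k" "p * gen_word xs \<in> graded_rel k"
  using assms by (auto simp: graded_rel_def intro: gen_word_times_gr_rel H00_closed)

lemma inV_times_graded: "p \<in> graded_rel n \<Longrightarrow> inV v * p \<in> graded_rel (Suc n)"
  using gen_word_times_graded(1)[of p n "[Inl v]" "Suc n"] by (simp add: gen_word_single)

lemma inA_times_graded: "p \<in> graded_rel n \<Longrightarrow> inA a * p \<in> graded_rel n"
  using gen_word_times_graded(1)[of p n "[Inr a]" n] by (simp add: gen_word_single)

lemma zero_mem_base: "inV 0 \<in> base_ideal" "inA 0 \<in> base_ideal"
  using additive_mod_zero[OF group_base, of inV] additive_mod_zero[OF group_base, of inA]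
    linear_modD(1)[OF linear_inV_base] linear_modD(1)[OF linear_inA_base]
  by (auto simp: cong_mod_def)

lemma graded_smash:
  "inA a * inV v \<approx>[graded_rel 1] sweedler2 fscale \<Delta> (\<lambda>x y. inV (act x v) * inA y) a"
proof -
  let ?p = "inA a * inV v - sweedler2 fscale \<Delta> (\<lambda>x y. inV (act x v) * inA y) a"
  have "?p - inA 0 \<in> H00_ideal"
    unfolding H00_ideal_def smash_ideal_def by (rule hull_inc) blast
  moreover have "inA 0 \<in> H00_ideal" using zero_mem_base by (auto simp: base_ideal_def)
  ultimately have "?p - inA 0 + inA 0 \<in> H00_ideal"
    using ideal_H00 unfolding two_sided_ideal_def by blast
  moreover have "?p - inA (l a v) + inA (l a v) \<in> gr_rel 1"
    using skew_imp_H_cong[OF inA_inV[of a v]] gen_word_in_words(1)[of "[Inr (l a v)]" 1]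
    by (intro gr_relI) (auto simp: cong_mod_def diff_diff_eq gen_word_single)
  ultimately show ?thesis by (simp add: graded_rel_def cong_mod_def)
qed

lemma graded_commute: "inV v * inV w - inV w * inV v \<in> graded_rel 2"
proof -
  let ?p = "inV v * inV w - inV w * inV v"
  have "?p - (inV 0 + inA 0) \<in> H00_ideal"
    unfolding H00_ideal_def smash_ideal_def by (rule hull_inc) blast
  moreover have "inV 0 + inA 0 \<in> H00_ideal"
    using zero_mem_base ideal_H00 by (auto simp: base_ideal_def two_sided_ideal_def)
  ultimately have "?p - (inV 0 + inA 0) + (inV 0 + inA 0) \<in> H00_ideal"
    using ideal_H00 unfolding two_sided_ideal_def by blast
  moreover have "inV (kV v w) + inA (kA v w) \<in> words_below 2"
    using gen_word_in_words(1)[of "[Inr (kA v w)]" 2] gen_word_in_words(1)[of "[Inl (kV v w)]" 2]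
    by (intro F.subspace_add[OF subspace_words(1)]) (auto simp: gen_word_single)
  then have "commutator v w + (inV (kV v w) + inA (kA v w)) \<in> gr_rel 2"
    by (intro gr_relI commutator_in_H)
  ultimately show ?thesis by (simp add: graded_rel_def commutator_def)
qed

end

context smash_basis
begin

section \<open>The ordered monomials span\<close>

abbreviation wordV :: "'v list \<Rightarrow> (('v \<times> 'a) fword \<Rightarrow>\<^sub>0 'k)" where
  "wordV xs \<equiv> prod_list (map inV xs)"

lemma wordV_gen_word: "wordV xs = gen_word (map Inl xs)"
  by (simp add: gen_word_def comp_def)

lemma degree_map_Inl [simp]: "V_degree (map Inl xs) = length xs"
  by (simp add: filter_map comp_def)

lemmas base_mult = cong_mult[OF ideal_base group_base]

lemma keys_sum_single_mod:
  assumes N: "F.subspace N" and g: "linear_mod scA fscale N (g w)"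
  shows "keys_sum g (single w a) \<approx>[N] g w a"
proof (cases "a = 0")
  case True
  note G = subspace_add_subgroup[OF module_fscale N]
  show ?thesis
    using True cong_sym[OF G additive_mod_zero[OF G, of "g w"]] linear_modD(1)[OF g]
    by (simp add: keys_sum_def)
next
  case False
  then show ?thesis
    by (simp add: keys_sum_def cong_refl[OF subspace_add_subgroup[OF module_fscale N]])
qed

text \<open>
  Maps out of the model may be given on coefficients, one word at a time.
\<close>

lemma keys_sum_linear:
  assumes N: "F.subspace N" and g: "\<And>w. linear_mod scA fscale N (g w)"
  shows "linear_mod scN fscale N (keys_sum g)"
proof (rule linear_modI)
  note G = subspace_add_subgroup[OF module_fscale N]
  note trans = cong_trans[OF G] and sym = cong_sym[OF G]
  show additive: "keys_sum g (m + n) \<approx>[N] keys_sum g m + keys_sum g n" for m n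
    using G linear_modD(1)[OF g] by (rule keys_sum_add)
  show "keys_sum g (scN c n) \<approx>[N] fscale c (keys_sum g n)" for c n
  proof (induction n rule: poly_mapping_additive_induct)
    case zero
    show ?case by (simp add: keys_sum_def cong_refl[OF G])
  next
    case (single w a)
    show ?case
      unfolding scN_single
      using trans[OF keys_sum_single_mod[OF N g] trans[OF linear_modD(2)[OF g]
          cong_scale[OF module_fscale N sym[OF keys_sum_single_mod[OF N g]]]]] .
  next
    case (add m n)
    then show ?case
      unfolding scN.scale_right_distrib
      using trans[OF additive trans[OF cong_add[OF G] sym[OF cong_scale[OF module_fscale N additive, of c m n,
          unfolded F.scale_right_distrib]]]] by blast
  qed
qed

lemma linear_word_inA: "linear_mod scA fscale base_ideal (\<lambda>a. wordV xs * inA a)"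
  using base_mult[OF cong_refl[OF group_base] linear_modD(1)[OF linear_inA_base]]
    base_mult[OF cong_refl[OF group_base] linear_modD(2)[OF linear_inA_base]]
  by (intro linear_modI) (simp_all add: distrib_left fscale_mult_right)

lemma normal_elt_single: "normal_elt (single w a) \<approx>[base_ideal] wordV (letters w) * inA a"
  unfolding normal_elt_def
  by (rule keys_sum_single_mod[where g = "\<lambda>w a. wordV (letters w) * inA a"])
    (rule subspace_base linear_word_inA)+

lemma linear_normal_elt: "linear_mod scN fscale base_ideal normal_elt"
  unfolding normal_elt_def[abs_def] by (rule keys_sum_linear[OF subspace_base linear_word_inA])

lemma normal_elt_zero [simp]: "normal_elt 0 = 0"
  by (simp add: normal_elt_def keys_sum_def)

lemmas normal_elt_add = linear_modD(1)[OF linear_normal_elt]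

definition sorted_deg :: "nat \<Rightarrow> 'v fword set" where
  "sorted_deg n = {w \<in> sorted_words. length (letters w) = n}"

text \<open>
  The elements that have a homogeneous normal form of degree \<open>n\<close> which is the same in \<open>H\<^sub>0\<^sub>,\<^sub>0\<close> and in the associated graded algebra.
\<close>

definition reducible :: "nat \<Rightarrow> (('v \<times> 'a) fword \<Rightarrow>\<^sub>0 'k) set" where
  "reducible n = {p. \<exists>m\<in>words_in (sorted_deg n). p \<approx>[graded_rel n] normal_elt m}"

lemma reducible_cong:
  assumes "p \<approx>[graded_rel n] q" "q \<in> reducible n" shows "p \<in> reducible n"
  using assms cong_trans[OF group_graded] unfolding reducible_def by blast

lemma linear_normal_elt_graded: "linear_mod scN fscale (graded_rel n) normal_elt"
  using linear_modD[OF linear_normal_elt] by (intro linear_modI base_imp_graded)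

lemma subspace_reducible: "F.subspace (reducible n)"
  unfolding reducible_def
  by (rule subspace_cong_image[OF module_scN module_fscale subspace_graded linear_normal_elt_graded
        subspace_words_in])

lemma graded_subset_reducible: "graded_rel n \<subseteq> reducible n"
  using scN.subspace_0[OF subspace_words_in]
  unfolding reducible_def by (force simp: cong_mod_def)

text \<open>
  Sorting by induction on the number of inversions. Modulo \<open>graded_rel\<close>, vectors commute.
\<close>

lemma wordV_reducible:
  assumes "set xs \<subseteq> B" shows "wordV xs * inA a \<in> reducible (length xs)"
  using assms
proof (induction xs rule: measure_induct_rule[of inversions])
  case (less xs)
  show ?case
  proof (cases "sorted_wrt (\<lambda>x y. (x, y) \<in> r) xs")
    case True
    have "single (FWord xs) a \<in> words_in (sorted_deg (length xs))"
      using True less.prems by (auto simp: words_in_def sorted_deg_def sorted_words_def)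
    then show ?thesis
      using cong_sym[OF group_graded base_imp_graded[OF normal_elt_single[of "FWord xs" a]]]
      by (auto simp: reducible_def)
  next
    case False
    then have "\<not> successively (\<lambda>x y. (x, y) \<in> r) xs"
      using successively_iff_sorted_wrt_strong[of xs "\<lambda>x y. (x, y) \<in> r"] order_trans by blast
    then obtain u x y t where xs: "xs = u @ [x, y] @ t" and "(x, y) \<notin> r"
    proof (induction xs arbitrary: thesis rule: induct_list012)
      case (3 x y zs)
      show ?case
      proof (cases "(x, y) \<in> r")
        case True
        then have "\<not> successively (\<lambda>x y. (x, y) \<in> r) (y # zs)" using 3 by simp
        from 3(2)[OF _ this] obtain u x' y' t where "y # zs = u @ [x', y'] @ t" "(x', y') \<notin> r"
          by blast
        then show ?thesis using 3(3)[of "x # u"] by simp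
      next
        case False
        then show ?thesis using 3(3)[of "[]"] by simp
      qed
    qed auto
    have B: "x \<in> B" "y \<in> B" using less.prems xs by auto
    then have desc: "(y, x) \<in> r" "x \<noteq> y" using \<open>(x, y) \<notin> r\<close> order_total[of x y] order_total[of x x] by auto
    let ?ys = "u @ [y, x] @ t"
    have "gen_word (map Inl u) * (inV x * inV y - inV y * inV x) * gen_word (map Inl t @ [Inr a])
        \<in> graded_rel (length xs)"
      by (rule gen_word_times_graded[OF gen_word_times_graded(1)[OF graded_commute order.refl]])
        (simp add: xs)
    also have "gen_word (map Inl u) * (inV x * inV y - inV y * inV x) * gen_word (map Inl t @ [Inr a])
        = wordV xs * inA a - wordV ?ys * inA a"
      by (simp add: xs gen_word_append gen_word_single wordV_gen_word gen_word_Cons[of _ "_ # _"]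
          algebra_simps gen_word_Cons[of "Inl _" "map Inl t"])
    finally have "wordV xs * inA a \<approx>[graded_rel (length xs)] wordV ?ys * inA a"
      by (simp add: cong_mod_def)
    moreover have "inversions ?ys < inversions xs"
      unfolding xs by (rule inversions_swap[OF desc])
    then have "wordV ?ys * inA a \<in> reducible (length ?ys)"
      by (rule less.IH) (use less.prems xs in auto)
    then have "wordV ?ys * inA a \<in> reducible (length xs)" by (simp add: xs)
    ultimately show ?thesis by (rule reducible_cong)
  qed
qed

lemma reducible_preimage:
  assumes p: "p \<in> reducible n" and f: "module_hom fscale fscale f"
    and graded: "\<And>q. q \<in> graded_rel n \<Longrightarrow> f q \<in> reducible k"
    and words: "\<And>xs a. set xs \<subseteq> B \<Longrightarrow> length xs = n \<Longrightarrow> f (wordV xs * inA a) \<in> reducible k"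
  shows "f p \<in> reducible k"
proof -
  interpret f: module_hom fscale fscale f by (rule f)
  obtain m where m: "m \<in> words_in (sorted_deg n)" "p - normal_elt m \<in> graded_rel n"
    using p by (auto simp: reducible_def cong_mod_def)
  have "f (normal_elt m) \<in> reducible k"
    unfolding normal_elt_def keys_sum_def f.sum
  proof (rule F.subspace_sum[OF subspace_reducible])
    fix w assume "w \<in> keys m"
    then have "set (letters w) \<subseteq> B" "length (letters w) = n"
      using m(1) by (auto simp: words_in_def sorted_deg_def sorted_words_def)
    then show "f (wordV (letters w) * inA (lookup m w)) \<in> reducible k" by (rule words)
  qed
  moreover have "f (p - normal_elt m) \<in> reducible k" using m(2) by (rule graded)
  ultimately have "f (p - normal_elt m) + f (normal_elt m) \<in> reducible k"
    by (intro F.subspace_add[OF subspace_reducible])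
  then show ?thesis by (simp add: f.diff)
qed

lemma inV_times_reducible:
  assumes "p \<in> reducible n" shows "inV v * p \<in> reducible (Suc n)"
  using assms hom_fscale_mult_left
proof (rule reducible_preimage)
  show "inV v * q \<in> reducible (Suc n)" if "q \<in> graded_rel n" for q
    using inV_times_graded[OF that] graded_subset_reducible by blast
  fix xs a assume xs: "set xs \<subseteq> B" "length xs = n"
  let ?q = "wordV xs * inA a"
  show "inV v * ?q \<in> reducible (Suc n)"
  proof (rule basis_linear_memI[OF B V.module_axioms module_fscale subspace_base _ subspace_reducible])
    show "linear_mod scV fscale base_ideal (\<lambda>v. inV v * ?q)"
      using base_mult[OF linear_modD(1)[OF linear_inV_base] cong_refl[OF group_base]]
        base_mult[OF linear_modD(2)[OF linear_inV_base] cong_refl[OF group_base]]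
      by (intro linear_modI) (simp_all add: distrib_right fscale_mult_left)
    show "base_ideal \<subseteq> reducible (Suc n)"
      using base_subset_graded graded_subset_reducible by blast
    show "inV b * ?q \<in> reducible (Suc n)" if "b \<in> B" for b
      using wordV_reducible[of "b # xs" a] that xs by (simp add: mult.assoc)
  qed
qed

lemma inA_times_wordV_reducible:
  "set xs \<subseteq> B \<Longrightarrow> inA a * (wordV xs * inA b) \<in> reducible (length xs)"
proof (induction xs arbitrary: a)
  case Nil
  have "inA a * inA b \<approx>[graded_rel 0] inA (a * b)"
    by (rule cong_sym[OF group_graded base_imp_graded[OF base_rels(2)]])
  then show ?case using wordV_reducible[of "[]" "a * b"] by (auto intro: reducible_cong)
next
  case (Cons x xs)
  let ?q = "wordV xs * inA b"
  let ?s = "sweedler2 fscale \<Delta> (\<lambda>y z. inV (act y x) * inA z) a"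
  have "(inA a * inV x - ?s) * gen_word (map Inl xs @ [Inr b]) \<in> graded_rel (Suc (length xs))"
    using graded_smash[of a x] by (intro gen_word_times_graded[of _ 1]) (auto simp: cong_mod_def)
  also have "(inA a * inV x - ?s) * gen_word (map Inl xs @ [Inr b]) = inA a * (wordV (x # xs) * inA b)
      - sweedler2 fscale \<Delta> (\<lambda>y z. inV (act y x) * (inA z * ?q)) a"
    by (simp add: gen_word_append gen_word_single wordV_gen_word[symmetric] left_diff_distrib
        sweedler2_mult_right mult.assoc)
  finally have "inA a * (wordV (x # xs) * inA b) \<approx>[graded_rel (Suc (length xs))]
      sweedler2 fscale \<Delta> (\<lambda>y z. inV (act y x) * (inA z * ?q)) a"
    by (simp add: cong_mod_def)
  moreover have "sweedler2 fscale \<Delta> (\<lambda>y z. inV (act y x) * (inA z * ?q)) a \<in> reducible (Suc (length xs))"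
    using Cons by (intro sweedler2_mem[OF module_fscale subspace_reducible] inV_times_reducible) auto
  ultimately show ?case by (auto intro: reducible_cong)
qed

lemma inA_times_reducible:
  assumes "p \<in> reducible n" shows "inA a * p \<in> reducible n"
  using assms hom_fscale_mult_left
proof (rule reducible_preimage)
  show "inA a * q \<in> reducible n" if "q \<in> graded_rel n" for q
    using inA_times_graded[OF that] graded_subset_reducible by blast
qed (use inA_times_wordV_reducible in auto)

lemma gen_word_reducible: "gen_word xs \<in> reducible (V_degree xs)"
proof (induction xs)
  case Nil
  have "1 \<approx>[graded_rel 0] inA 1"
    by (rule cong_sym[OF group_graded base_imp_graded[OF base_rels(3)]])
  then show ?case using wordV_reducible[of "[]" 1] by (auto simp: gen_word_def intro: reducible_cong)
next
  case (Cons x xs)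
  then show ?case
    by (cases x) (auto simp: gen_word_Cons[of _ xs] gen_word_single inV_times_reducible inA_times_reducible)
qed

lemma words_deg_reducible: "words_deg n \<subseteq> reducible n"
  unfolding words_deg_def
  by (rule F.span_minimal[OF _ subspace_reducible]) (auto simp: gen_word_reducible)

lemma base_imp_H: "p \<approx>[base_ideal] q \<Longrightarrow> p \<approx>[H_ideal] q"
  by (auto simp: base_ideal_def cong_mod_def)

text \<open>
  Induction on the degree: the part of top degree has a normal form up to terms of lower degree.
\<close>

lemma words_below_normal:
  assumes "p \<in> words_below n"
  shows "\<exists>m\<in>words_in {w \<in> sorted_words. length (letters w) < n}. p \<approx>[H_ideal] normal_elt m"
  using assms
proof (induction n arbitrary: p)
  case 0
  then show ?case
    using cong_refl[OF group_H, of 0] scN.subspace_0[OF subspace_words_in]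
    by (intro bexI[of _ 0]) (auto simp: words_below_0)
next
  case (Suc n)
  obtain q q' where q: "q \<in> words_deg n" "q' \<in> words_below n" "p = q + q'"
    using words_below_Suc[OF Suc.prems] by blast
  obtain m where m: "m \<in> words_in (sorted_deg n)" "q - normal_elt m \<in> gr_rel n"
    using words_deg_reducible q(1) by (auto simp: reducible_def graded_rel_def cong_mod_def)
  then obtain x y where xy: "x \<in> H_ideal" "y \<in> words_below n" "q - normal_elt m = x + y"
    by (auto simp: gr_rel_def)
  obtain m' where m': "m' \<in> words_in {w \<in> sorted_words. length (letters w) < n}" "y + q' \<approx>[H_ideal] normal_elt m'"
    using Suc.IH F.subspace_add[OF subspace_words(1) xy(2) q(2)] by blast
  have "p = normal_elt m + x + (y + q')"
    using q(3) xy(3) by (simp add: algebra_simps)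
  also have "normal_elt m + x + (y + q') \<approx>[H_ideal] normal_elt m + 0 + normal_elt m'"
    using xy(1) by (intro cong_add[OF group_H] cong_refl[OF group_H] m'(2)) (simp add: cong_mod_def)
  finally have "p \<approx>[H_ideal] normal_elt (m + m')"
    using cong_trans[OF group_H _ cong_sym[OF group_H base_imp_H[OF normal_elt_add]]] by simp
  moreover have "m + m' \<in> words_in {w \<in> sorted_words. length (letters w) < Suc n}"
    using m(1) m'(1) by (intro words_in_add) (auto simp: words_in_def sorted_deg_def less_Suc_eq)
  ultimately show ?case by blast
qed

lemma every_element_normal: "\<exists>m\<in>words_in sorted_words. p \<approx>[H_ideal] normal_elt m"
proof -
  let ?S = "{p. \<exists>m\<in>words_in sorted_words. p \<approx>[H_ideal] normal_elt m}"
  have S: "F.subspace ?S"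
    using linear_modD[OF linear_normal_elt]
    by (intro subspace_cong_image[OF module_scN module_fscale subspace_H _ subspace_words_in] linear_modI base_imp_H)
  have "\<exists>q\<in>words_below (Suc (length xs)). pt (FWord xs) \<approx>[H_ideal] q" for xs :: "('v \<times> 'a) list"
  proof (induction xs)
    case Nil
    let ?e = "gen_word [] :: ('v \<times> 'a) fword \<Rightarrow>\<^sub>0 'k"
    have "pt (FWord []) = ?e"
      by (simp add: pt_def gen_word_def flip: zero_fword_def)
    moreover have "?e \<in> words_below 1" by (rule gen_word_in_words) simp
    ultimately show ?case using cong_refl[OF group_H, of ?e] by auto
  next
    case (Cons x xs)
    obtain v a where x: "x = (v, a)" by force
    obtain q where q: "q \<in> words_below (Suc (length xs))" "pt (FWord xs) \<approx>[H_ideal] q" using Cons by blast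
    have "pt (FWord (x # xs)) = gen (v, a) * pt (FWord xs)"
      by (simp add: x gen_def pt_def mult_single)
    also have "\<dots> \<approx>[H_ideal] (gen_word [Inl v] + gen_word [Inr a]) * q"
      unfolding gen_word_single
      by (rule cong_mult[OF ideal_H group_H skew_imp_H_cong[OF gen_eq] q(2)])
    finally have "pt (FWord (x # xs)) \<approx>[H_ideal] gen_word [Inl v] * q + gen_word [Inr a] * q"
      by (simp add: distrib_right)
    moreover have "gen_word [Inl v] * q + gen_word [Inr a] * q \<in> words_below (Suc (length (x # xs)))"
      by (intro F.subspace_add[OF subspace_words(1)] gen_word_times_words_below[OF q(1)]) auto
    ultimately show ?case by blast
  qed
  note in_words = this
  have S_word: "pt (FWord xs) \<in> ?S" for xs
  proof -
    obtain q where q: "q \<in> words_below (Suc (length xs))" "pt (FWord xs) \<approx>[H_ideal] q"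
      using in_words by blast
    from words_below_normal[OF q(1)] obtain m
      where m: "m \<in> words_in {w \<in> sorted_words. length (letters w) < Suc (length xs)}" "q \<approx>[H_ideal] normal_elt m"
      by blast
    then have "m \<in> words_in sorted_words" by (auto simp: words_in_def)
    then show ?thesis using cong_trans[OF group_H q(2) m(2)] by blast
  qed
  have word: "pt w \<in> ?S" for w
    using S_word[of "letters w"] by (simp only: FWord_letters)
  have "p \<in> ?S"
  proof (induction p rule: poly_mapping_additive_induct)
    case (single w c)
    show ?case unfolding fscale_pt[symmetric] by (rule F.subspace_scale[OF S word])
  qed (use F.subspace_0[OF S] F.subspace_add[OF S] in auto)
  then show ?thesis by blast
qed

section \<open>Independence of the ordered monomials and bases of \<open>A\<close>\<close>

text \<open>
  Combinations of the monomials \<open>X \<cdot> a\<close>, with \<open>a\<close> in a basis of \<open>A\<close>, correspond bijectively to elements of the model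
  supported on sorted words (\<open>comb_model_inj\<close>, \<open>comb_model_surj\<close>).
\<close>

definition comb_model :: "('v list \<times> 'a \<Rightarrow>\<^sub>0 'k) \<Rightarrow> ('v fword \<Rightarrow>\<^sub>0 'a)" where
  "comb_model = lin_ext scN (\<lambda>(w, a). single (FWord w) a)"

lemma PBW_comb_normal_elt: "PBW_comb c \<approx>[H_ideal] normal_elt (comb_model c)"
proof (rule base_imp_H[OF cong_sym[OF group_base]])
  have "normal_elt (comb_model c) \<approx>[base_ideal]
      lin_ext fscale (\<lambda>x. normal_elt (case x of (w, a) \<Rightarrow> single (FWord w) a)) c"
    unfolding comb_model_def
    by (rule linear_mod_lin_ext[OF module_fscale module_scN subspace_base linear_normal_elt])
  moreover have "\<dots> \<approx>[base_ideal] PBW_comb c"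
    unfolding PBW_comb_def
  proof (rule lin_ext_cong_mod[OF module_fscale subspace_base])
    fix x :: "'v list \<times> 'a"
    show "normal_elt (case x of (w, a) \<Rightarrow> single (FWord w) a) \<approx>[base_ideal]
        (case x of (w, a) \<Rightarrow> wordV w * inA a)"
      using normal_elt_single[of "FWord (fst x)" "snd x"] by (simp add: case_prod_unfold)
  qed
  ultimately show "normal_elt (comb_model c) \<approx>[base_ideal] PBW_comb c"
    by (rule cong_trans[OF group_base])
qed

lemma comb_model_sorted:
  assumes "keys c \<subseteq> PBW_index B r J" shows "comb_model c \<in> words_in sorted_words"
  unfolding comb_model_def lin_ext_def
proof (rule scN.subspace_sum[OF subspace_words_in])
  fix x assume "x \<in> keys c"
  then have "(case x of (w, a) \<Rightarrow> single (FWord w) a) \<in> words_in sorted_words"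
    using assms by (cases x) (auto simp: PBW_index_def words_in_def sorted_words_def split: if_splits)
  then show "scN (lookup c x) (case x of (w, a) \<Rightarrow> single (FWord w) a)
      \<in> words_in sorted_words"
    by (rule scN.subspace_scale[OF subspace_words_in])
qed

context
  fixes J :: "'a set"
  assumes J: "is_basis scA UNIV J"
begin

lemma comb_model_inj:
  assumes keys: "keys c \<subseteq> PBW_index B r J" and zero: "comb_model c = 0"
  shows "c = 0"
proof (rule poly_mapping_eqI)
  fix x :: "'v list \<times> 'a"
  obtain w b where x: "x = (w, b)" by force
  define T where "T = {a. (w, a) \<in> keys c}"
  have T: "finite T" "T \<subseteq> J"
    using keys finite_subset[of T "snd ` keys c"]
    by (force simp: T_def PBW_index_def)+
  have "0 = lookup (comb_model c) (FWord w)" using zero by simp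
  also have "\<dots> = (\<Sum>x\<in>keys c. if fst x = w then scA (lookup c x) (snd x) else 0)"
    unfolding comb_model_def lin_ext_def lookup_sum
    by (rule sum.cong) (auto simp: lookup_scN lookup_single when_def)
  also have "\<dots> = (\<Sum>x\<in>{x \<in> keys c. fst x = w}. scA (lookup c x) (snd x))"
    by (rule sum.inter_filter[symmetric]) simp
  also have "\<dots> = (\<Sum>a\<in>T. scA (lookup c (w, a)) a)"
    by (rule sum.reindex_bij_witness[of _ "Pair w" snd]) (auto simp: T_def)
  finally have sum0: "(\<Sum>a\<in>T. scA (lookup c (w, a)) a) = 0" by simp
  have "lookup c (w, b) = 0" if "b \<in> T"
    using independentD[OF _ T sum0 that] J by (simp add: is_basis_def)
  then show "lookup c x = lookup 0 x"
    by (auto simp: x T_def in_keys_iff)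
qed

lemma keys_pt: "keys (pt x :: 'x \<Rightarrow>\<^sub>0 'k) = {x}"
  by (simp add: pt_def)

lemma keys_fscale: "keys (fscale c p) \<subseteq> keys p"
  by (auto simp: in_keys_iff lookup_fscale)

lemma comb_model_surj:
  assumes "n \<in> words_in sorted_words"
  shows "\<exists>c. keys c \<subseteq> PBW_index B r J \<and> comb_model c = n"
  using assms unfolding words_in_def mem_Collect_eq
proof (induction n rule: poly_mapping_support_induct)
  case zero
  show ?case by (intro exI[of _ 0]) (simp add: comb_model_def lin_ext_zero[OF module_scN])
next
  case (add m n)
  then obtain c d where "keys c \<subseteq> PBW_index B r J" "comb_model c = m"
    "keys d \<subseteq> PBW_index B r J" "comb_model d = n" by blast
  then show ?case
    using keys_add[of c d] by (intro exI[of _ "c + d"]) (auto simp: comb_model_def lin_ext_add[OF module_scN])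
next
  case (single w a)
  let ?P = "\<lambda>a. \<exists>c. keys c \<subseteq> PBW_index B r J \<and> comb_model c = single w a"
  have "subspace {a. ?P a}"
  proof (rule subspaceI; clarify)
    show "?P 0" by (intro exI[of _ 0]) (simp add: comb_model_def lin_ext_zero[OF module_scN])
  next
    fix a b c d assume "keys c \<subseteq> PBW_index B r J" "comb_model c = single w a"
      "keys d \<subseteq> PBW_index B r J" "comb_model d = single w b"
    then show "?P (a + b)"
      using keys_add[of c d]
      by (intro exI[of _ "c + d"]) (auto simp: comb_model_def lin_ext_add[OF module_scN] single_add)
  next
    fix k a c assume "keys c \<subseteq> PBW_index B r J" "comb_model c = single w a"
    then show "?P (scA k a)"
      using keys_fscale[of k c]
      by (intro exI[of _ "fscale k c"]) (auto simp: comb_model_def lin_ext_scale[OF module_scN] scN_single)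
  qed
  moreover have "?P a" if "a \<in> J" for a
    using that single
    by (intro exI[of _ "pt (letters w, a)"])
      (auto simp: comb_model_def lin_ext_pt[OF module_scN] PBW_index_def sorted_words_def keys_pt)
  ultimately have "span J \<subseteq> {a. ?P a}" by (intro span_minimal) auto
  then show ?case using J by (auto simp: is_basis_def)
qed

lemma PBW_for_bases_iff: "PBW_for_bases B r J \<longleftrightarrow> PBW_independent"
proof -
  have spanning: "\<forall>h\<in>range (qcls H_ideal). \<exists>c. keys c \<subseteq> PBW_index B r J \<and> h = qcls H_ideal (PBW_comb c)"
  proof
    fix h assume "h \<in> range (qcls H_ideal)"
    then obtain p where h: "h = qcls H_ideal p" by blast
    obtain m where m: "m \<in> words_in sorted_words" "p \<approx>[H_ideal] normal_elt m"
      using every_element_normal by blast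
    obtain c where c: "keys c \<subseteq> PBW_index B r J" "comb_model c = m"
      using comb_model_surj[OF m(1)] by blast
    have "p \<approx>[H_ideal] PBW_comb c"
      using cong_trans[OF group_H m(2) cong_sym[OF group_H]] PBW_comb_normal_elt[of c] c(2) by simp
    then show "\<exists>c. keys c \<subseteq> PBW_index B r J \<and> h = qcls H_ideal (PBW_comb c)"
      using c(1) h by (auto simp: qcls_eq_iff[OF group_H])
  qed
  have vanish: "qcls H_ideal (PBW_comb c) = qcls H_ideal 0 \<longleftrightarrow> normal_elt (comb_model c) \<in> H_ideal" for c
    unfolding qcls_eq_iff[OF group_H] cong_0_iff[OF group_H]
    by (rule cong_mem_iff[OF group_H PBW_comb_normal_elt])
  have "(\<forall>c. keys c \<subseteq> PBW_index B r J \<longrightarrow> normal_elt (comb_model c) \<in> H_ideal \<longrightarrow> c = 0)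
      \<longleftrightarrow> PBW_independent" (is "?L \<longleftrightarrow> _")
  proof
    assume L: ?L
    show PBW_independent
      unfolding PBW_independent_def
    proof (intro ballI impI)
      fix n assume n: "n \<in> words_in sorted_words" "normal_elt n \<in> H_ideal"
      obtain c where c: "keys c \<subseteq> PBW_index B r J" "comb_model c = n"
        using comb_model_surj[OF n(1)] by blast
      with L n have "c = 0" by blast
      then show "n = 0" using c(2) by (simp add: comb_model_def lin_ext_zero[OF module_scN])
    qed
  next
    assume PBW_independent
    then show ?L
      using comb_model_sorted[of _ J] comb_model_inj unfolding PBW_independent_def by blast
  qed
  then show ?thesis using spanning unfolding PBW_for_bases_def vanish by simp
qed

end

section \<open>Independence implies injectivity of the natural map\<close>

text \<open>
  The inverse, on representatives, of the identification of \<open>V \<otimes> A\<close> with the words of length one in the model.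
\<close>

definition VA_of_model :: "('v fword \<Rightarrow>\<^sub>0 'a) \<Rightarrow> ('v \<times> 'a \<Rightarrow>\<^sub>0 'k)" where
  "VA_of_model = keys_sum (\<lambda>w a. pt (hd (letters w), a))"

lemma group_tens: "add_subgroup (tens_rel scV scA)"
  by (rule subspace_add_subgroup[OF module_fscale subspace_tens_rel])

lemma pt_linear: "linear_mod scA fscale (tens_rel scV scA) (\<lambda>a. pt (v, a))"
  "linear_mod scV fscale (tens_rel scV scA) (\<lambda>v. pt (v, a))"
  using bilinear_mod_pt[of scV scA] by (auto simp: bilinear_mod_def)

lemma VA_of_model_zero [simp]: "VA_of_model 0 = 0"
  by (simp add: VA_of_model_def keys_sum_def)

abbreviation one_letter_words :: "'v fword set" where
  "one_letter_words \<equiv> {w. \<exists>b\<in>B. w = FWord [b]}"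

lemma tensor_in_model:
  "\<exists>m\<in>words_in one_letter_words. \<tau> \<approx>[tens_rel scV scA] VA_of_model m"
proof -
  let ?N = "tens_rel scV scA"
  let ?S = "{\<tau>. \<exists>m\<in>words_in one_letter_words. \<tau> \<approx>[?N] VA_of_model m}"
  have S: "F.subspace ?S"
    unfolding VA_of_model_def
    by (intro subspace_cong_image[OF module_scN module_fscale subspace_tens_rel _ subspace_words_in]
        keys_sum_linear subspace_tens_rel pt_linear)
  have "pt (v, a) \<in> ?S" for v a
  proof (rule basis_linear_memI[OF B V.module_axioms module_fscale subspace_tens_rel pt_linear(2) S])
    show "?N \<subseteq> ?S"
      using scN.subspace_0[OF subspace_words_in] by (force simp: cong_mod_def)
    fix b assume b: "b \<in> B"
    have "pt (b, a) \<approx>[?N] VA_of_model (single (FWord [b]) a)"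
      using cong_sym[OF group_tens keys_sum_single_mod[where g = "\<lambda>w a. pt (hd (letters w), a)" and w = "FWord [b]",
            OF subspace_tens_rel pt_linear(1)]] by (simp add: VA_of_model_def)
    moreover have "single (FWord [b]) a \<in> words_in one_letter_words"
      using b by (simp add: words_in_def)
    ultimately show "pt (b, a) \<in> ?S" by blast
  qed
  then have "\<tau> \<in> ?S"
  proof (induction \<tau> rule: poly_mapping_additive_induct)
    case (single x c)
    then show ?case unfolding fscale_pt[symmetric] by (cases x) (simp only: F.subspace_scale[OF S])
  qed (use F.subspace_0[OF S] F.subspace_add[OF S] in auto)
  then show ?thesis by blast
qed

lemma embVA_VA_of_model:
  assumes "m \<in> words_in one_letter_words" shows "embVA (VA_of_model m) = normal_elt m"
  unfolding VA_of_model_def normal_elt_def keys_sum_def module_hom.sum[OF hom_embVA]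
  using assms by (intro sum.cong) (auto simp: words_in_def)

text \<open>
  An element \<open>a + \<tau>\<close> of \<open>A \<oplus> (V \<otimes> A)\<close> is sent to the ordered combination with coefficient \<open>a\<close> at the empty word and those of
  \<open>\<tau>\<close> at the words of length one.
\<close>

lemma independent_imp_injective:
  assumes PBW_independent shows natural_map_injective
  unfolding natural_map_injective_iff
proof (intro allI impI)
  fix a \<tau> assume H: "inA a + embVA \<tau> \<in> H_ideal"
  obtain m where m: "m \<in> words_in one_letter_words" "\<tau> \<approx>[tens_rel scV scA] VA_of_model m"
    using tensor_in_model by blast
  let ?n = "coeff a + m"
  have "embVA \<tau> \<approx>[H_ideal] normal_elt m"
    using embVA_tens_rel[of "\<tau> - VA_of_model m"] m skew_subset_H
    by (auto simp: cong_mod_def embVA_diff embVA_VA_of_model)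
  moreover have "normal_elt (coeff a) \<approx>[H_ideal] inA a"
    using base_imp_H[OF normal_elt_single[of 0 a]] by (simp add: coeff_def)
  ultimately have "inA a + embVA \<tau> \<approx>[H_ideal] normal_elt (coeff a) + normal_elt m"
    by (intro cong_add[OF group_H]) (auto intro: cong_sym[OF group_H])
  then have "inA a + embVA \<tau> \<approx>[H_ideal] normal_elt ?n"
    using cong_trans[OF group_H _ cong_sym[OF group_H base_imp_H[OF normal_elt_add]]] by blast
  with H have "normal_elt ?n \<in> H_ideal" using cong_mem_iff[OF group_H] by blast
  moreover have "?n \<in> words_in sorted_words"
    using m(1) by (intro words_in_add) (auto simp: words_in_def sorted_words_def coeff_def)
  ultimately have n: "?n = 0" using assms by (auto simp: PBW_independent_def)
  have "lookup m 0 = 0"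
    using m(1) by (auto simp: words_in_def zero_fword_def in_keys_iff)
  then have a: "a = 0"
    using arg_cong[OF n, of "\<lambda>n. lookup n 0"] by (simp add: lookup_add coeff_def)
  then have "m = 0" using n by simp
  then show "a = 0 \<and> \<tau> \<in> tens_rel scV scA"
    using a m(2) by (simp add: cong_mod_def)
qed

end

section \<open>The associated graded algebra\<close>

context smash_deformation
begin

lemma undeformed: "smash_deformation scA \<Delta> scV act (\<lambda>_. 0) (\<lambda>_. 0)"
proof
  show "quot_linear fscale scA (tens_rel scA scV) UNIV (\<lambda>_. 0)"
    by (simp add: quot_linear_def)
  show "quot_linear fscale (sum_scale scV scA) (tens_rel scV scV) wedge_span (\<lambda>_. 0)"
    by (simp add: quot_linear_def sum_scale_def zero_prod_def)
qed

lemma undeformed_maps: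
  "smash_deformation.l scA scV (\<lambda>_. 0) a v = (0 :: 'a)"
  "smash_deformation.kV scV (\<lambda>_. 0 :: 'v \<times> 'a) v w = 0"
  "smash_deformation.kA scV (\<lambda>_. 0 :: 'v \<times> 'a) v w = 0"
  by (simp_all add: smash_deformation.l_def[OF undeformed] smash_deformation.kV_def[OF undeformed]
      smash_deformation.kA_def[OF undeformed])

lemma H00_ideal_eq: "H00_ideal = smash_deformation.H_ideal scA \<Delta> scV act (\<lambda>_. 0) (\<lambda>_. 0)"
  unfolding H00_ideal_def smash_deformation.H_ideal_def[OF undeformed] undeformed_maps[abs_def] ..

text \<open>
  All terms of the conditions contain \<open>\<lambda>\<close> or \<open>\<kappa>\<close>. In \<open>V \<otimes> A\<close> they are represented by sums of tensors with a factor \<open>0\<close>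
  or by Sweedler sums over \<open>0\<close>, which are relations of the tensor product but need not be zero.
\<close>

lemma trivial_conditions:
  assumes l: "\<And>a v. l a v = 0" and kV: "\<And>v w. kV v w = 0" and kA: "\<And>v w. kA v w = 0"
  shows "cond_a \<and> cond_b \<and> cond_c"
proof (intro conjI)
  have sw2: "sweedler2 scA \<Delta> (\<lambda>x y. 0) a = 0" and sw3: "sweedler3 scA \<Delta> (\<lambda>x y z. 0) a = 0" for a
    using sweedler2_mem[OF module_axioms, of "{0}" "\<lambda>x y. 0"] sweedler3_mem[OF module_axioms, of "{0}" "\<lambda>x y z. 0"]
    by auto
  let ?N = "tens_rel scV scA"
  note N = subspace_tens_rel[of scV scA]
  have G: "add_subgroup ?N" by (rule subspace_add_subgroup[OF module_fscale N])
  have B: "bilinear_mod scV scA fscale ?N (\<lambda>x y. pt (x, y))" by (rule bilinear_mod_pt)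
  have pt0: "pt (0, a) \<in> ?N" "pt (v, 0) \<in> ?N" for a v
    using additive_mod_zero[OF G, of "\<lambda>v. pt (v, a)"] additive_mod_zero[OF G, of "\<lambda>a. pt (v, a)"] B
    by (auto simp: bilinear_mod_def linear_mod_def cong_mod_def)
  have sw0: "sweedler2 fscale \<Delta> (\<lambda>x y. pt (act x v, y)) 0 \<in> ?N" for v
  proof -
    have "linear_mod scA fscale ?N (\<lambda>x. pt (act x v, y))" for y
      by (rule linear_mod_comp[OF G, of scV fscale "\<lambda>x. pt (x, y)" scA "\<lambda>x. act x v"])
        (use B linear_act_left[OF linear_id] in \<open>auto simp: bilinear_mod_def\<close>)
    then have "bilinear_mod scA scA fscale ?N (\<lambda>x y. pt (act x v, y))"
      using B by (simp add: bilinear_mod_def)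
    from sweedler2_linear[OF module_fscale N this]
    show ?thesis
      using additive_mod_zero[OF G, of "sweedler2 fscale \<Delta> (\<lambda>x y. pt (act x v, y))"]
      by (simp add: linear_mod_def cong_mod_def)
  qed
  have act0: "act a 0 = 0" for a using act_add_right[of a 0 0] by simp
  have times0: "(*) (0 :: 'a) = (\<lambda>y. 0)" by (rule ext) simp
  show cond_a unfolding cond_a_def by (simp add: l times0 sw2)
  show cond_b
    unfolding cond_b_iff b_defect_A_def b_defect_VA_def
    by (auto simp: l kV kA times0 sw2 sw3 act0 intro!: F.subspace_diff[OF N] F.subspace_add[OF N] sw0 pt0
        sweedler2_mem[OF module_fscale N] sweedler3_mem[OF module_fscale N])
  show cond_c
    unfolding cond_c_iff
  proof (intro allI conjI)
    show "c_defect_A u v w = 0" for u v w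
      by (simp add: c_defect_A_def cyclic_sum_def l kA)
    show "c_defect_VA u v w \<in> ?N" for u v w
      unfolding c_defect_VA_def cyclic_sum_def kV kA
      by (intro F.subspace_diff[OF N] F.subspace_add[OF N] sw0 pt0)
  qed
qed

lemma undeformed_conditions:
  "smash_deformation.cond_a scA \<Delta> scV act (\<lambda>_. 0) \<and> smash_deformation.cond_b scA \<Delta> scV act (\<lambda>_. 0) (\<lambda>_. 0)
    \<and> smash_deformation.cond_c scA \<Delta> scV act (\<lambda>_. 0) (\<lambda>_. 0)"
  using undeformed
  by (intro smash_deformation.trivial_conditions)
    (simp_all add: undeformed_maps)

end

context smash_basis
begin

lemma undeformed_basis: "smash_basis scA \<Delta> scV act (\<lambda>_. 0) (\<lambda>_. 0) B r"
  using undeformed B r by (simp add: smash_basis_def smash_basis_axioms_def)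

lemma undeformed_independent: "n \<in> words_in sorted_words \<Longrightarrow> normal_elt n \<in> H00_ideal \<Longrightarrow> n = 0"
  using smash_basis.conditions_imp_independent[OF undeformed_basis] undeformed_conditions
  unfolding smash_basis.PBW_independent_def[OF undeformed_basis] H00_ideal_eq by blast

lemma undeformed_injective: "inA a + embVA \<tau> \<in> H00_ideal \<Longrightarrow> a = 0 \<and> \<tau> \<in> tens_rel scV scA"
  using smash_basis.independent_imp_injective[OF undeformed_basis]
    smash_basis.conditions_imp_independent[OF undeformed_basis] undeformed_conditions
  unfolding smash_deformation.natural_map_injective_iff[OF undeformed] H00_ideal_eq by blast

lemma sorted_deg_subset: "words_in (sorted_deg n) \<subseteq> words_in sorted_words"
  by (auto simp: words_in_def sorted_deg_def)

text \<open>
  The natural surjection is well defined: an element of degree \<open>n\<close> that vanishes in \<open>H\<^sub>0\<^sub>,\<^sub>0\<close> has normal form \<open>0\<close> there, and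
  the same normal form in the associated graded algebra.
\<close>

lemma H00_words_deg_gr_rel:
  assumes "p \<in> words_deg n" "p \<in> H00_ideal" shows "p \<in> gr_rel n"
proof -
  obtain m where m: "m \<in> words_in (sorted_deg n)" "p - normal_elt m \<in> graded_rel n"
    using words_deg_reducible assms(1) by (auto simp: reducible_def cong_mod_def)
  have "p - (p - normal_elt m) \<in> H00_ideal"
    by (rule F.subspace_diff[OF subspace_H00])
      (use m(2) assms(2) in \<open>auto simp: graded_rel_def\<close>)
  then have "m = 0" using undeformed_independent[of m] sorted_deg_subset m(1) by auto
  then show ?thesis using m(2) by (simp add: graded_rel_def)
qed

lemma gr_map_qcls:
  assumes p: "p \<in> words_deg n" shows "gr_map n (qcls H00_ideal p) = qcls (gr_rel n) p"
proof -
  let ?q = "qrep (qcls H00_ideal p \<inter> words_deg n)"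
  have "p \<in> qcls H00_ideal p \<inter> words_deg n"
    using p F.subspace_0[OF subspace_H00] by (simp add: qcls_def)
  then have q: "?q \<in> qcls H00_ideal p \<inter> words_deg n"
    unfolding qrep_def by (rule someI)
  have "?q - p \<in> gr_rel n"
    using q p by (intro H00_words_deg_gr_rel F.subspace_diff[OF subspace_words(2)])
      (auto simp: qcls_def)
  then show ?thesis
    by (simp add: gr_map_def qcls_eq_iff[OF subspace_add_subgroup[OF module_fscale subspace_gr_rel]] cong_mod_def)
qed

lemma gr_map_image: "gr_map n ` H00_component n = gr_component n"
proof -
  note G = subspace_add_subgroup[OF module_fscale subspace_gr_rel[of n]]
  have "qcls (gr_rel n) ` words_below (Suc n) = qcls (gr_rel n) ` words_deg n"
  proof
    show "qcls (gr_rel n) ` words_deg n \<subseteq> qcls (gr_rel n) ` words_below (Suc n)"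
      using words_deg_below[of n "Suc n"] by blast
    show "qcls (gr_rel n) ` words_below (Suc n) \<subseteq> qcls (gr_rel n) ` words_deg n"
    proof (rule image_subsetI)
      fix p :: "('v \<times> 'a) fword \<Rightarrow>\<^sub>0 'k" assume "p \<in> words_below (Suc n)"
      then obtain q q' where q: "q \<in> words_deg n" "q' \<in> words_below n" "p = q + q'"
        using words_below_Suc by blast
      have "q' \<in> gr_rel n"
        using gr_relI[OF F.subspace_0[OF subspace_H] q(2)] by simp
      then have "qcls (gr_rel n) p = qcls (gr_rel n) q"
        unfolding qcls_eq_iff[OF G] by (simp add: q(3) cong_mod_def)
      then show "qcls (gr_rel n) p \<in> qcls (gr_rel n) ` words_deg n" using q(1) by blast
    qed
  qed
  then show ?thesis
    unfolding gr_component_def H00_component_def image_image by (simp add: gr_map_qcls cong: image_cong)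
qed

text \<open>
  The natural surjection is onto in every degree, so that only its kernel matters.
\<close>

lemma PBW_property_iff:
  "PBW_property \<longleftrightarrow> (\<forall>n. words_deg n \<inter> gr_rel n \<subseteq> H00_ideal)"
proof -
  have "inj_on (gr_map n) (H00_component n) \<longleftrightarrow> words_deg n \<inter> gr_rel n \<subseteq> H00_ideal" for n
  proof -
    note G = subspace_add_subgroup[OF module_fscale subspace_gr_rel[of n]]
    note G0 = subspace_add_subgroup[OF module_fscale subspace_H00]
    have "inj_on (gr_map n) (H00_component n) \<longleftrightarrow>
        (\<forall>p\<in>words_deg n. \<forall>q\<in>words_deg n. p - q \<in> gr_rel n \<longrightarrow> p - q \<in> H00_ideal)"
      unfolding inj_on_def H00_component_def
      by (simp add: gr_map_qcls qcls_eq_iff[OF G] qcls_eq_iff[OF G0] cong_mod_def)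
    also have "\<dots> \<longleftrightarrow> words_deg n \<inter> gr_rel n \<subseteq> H00_ideal"
    proof
      assume L: "\<forall>p\<in>words_deg n. \<forall>q\<in>words_deg n. p - q \<in> gr_rel n \<longrightarrow> p - q \<in> H00_ideal"
      show "words_deg n \<inter> gr_rel n \<subseteq> H00_ideal"
        using L[rule_format, of _ 0] F.subspace_0[OF subspace_words(2)] by auto
    qed (use F.subspace_diff[OF subspace_words(2)] in blast)
    finally show ?thesis .
  qed
  then show ?thesis by (simp add: PBW_property_def bij_betw_def gr_map_image)
qed

text \<open>
  The normal form \<open>m\<close> of an element of degree \<open>n\<close> that lies in lower filtration of \<open>H\<^sub>\<lambda>\<^sub>,\<^sub>\<kappa>\<close> equals a combination \<open>m'\<close> of shorter
  sorted words, so it is \<open>0\<close> by independence.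
\<close>

lemma independent_imp_PBW_property:
  assumes PBW_independent shows PBW_property
  unfolding PBW_property_iff
proof (intro allI subsetI)
  fix n p assume p: "p \<in> words_deg n \<inter> gr_rel n"
  obtain m where m: "m \<in> words_in (sorted_deg n)" "p - normal_elt m \<in> graded_rel n"
    using words_deg_reducible p by (auto simp: reducible_def cong_mod_def)
  have "p - (p - normal_elt m) \<in> gr_rel n"
    by (rule F.subspace_diff[OF subspace_gr_rel])
      (use m(2) p in \<open>auto simp: graded_rel_def\<close>)
  then obtain x y where xy: "normal_elt m = x + y" "x \<in> H_ideal" "y \<in> words_below n"
    by (auto simp: gr_rel_def)
  obtain m' where m': "m' \<in> words_in {w \<in> sorted_words. length (letters w) < n}" "y \<approx>[H_ideal] normal_elt m'"
    using words_below_normal[OF xy(3)] by blast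
  have "normal_elt m \<approx>[H_ideal] normal_elt m'"
    using cong_add[OF group_H _ m'(2), of x 0] xy(1,2) by (simp add: cong_mod_def)
  moreover have "normal_elt (m - m') \<approx>[H_ideal] normal_elt m - normal_elt m'"
    by (rule base_imp_H[OF linear_mod_diff[OF linear_normal_elt group_base]])
  ultimately have "normal_elt (m - m') \<in> H_ideal"
    using cong_mem_iff[OF group_H] by (simp add: cong_mod_def)
  moreover have "m - m' \<in> words_in sorted_words"
    using m(1) m'(1)
    by (intro scN.subspace_diff[OF subspace_words_in]) (auto simp: words_in_def sorted_deg_def)
  ultimately have "m - m' = 0" using assms unfolding PBW_independent_def by blast
  then have "m = m'" by simp
  then have "keys m = {}"
    using m(1) m'(1) by (fastforce simp: words_in_def sorted_deg_def)
  then have "m = 0" by simp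
  then show "p \<in> H00_ideal" using m(2) by (simp add: graded_rel_def)
qed

text \<open>
  If \<open>a + \<tau>\<close> is in the kernel of the natural map, then \<open>\<tau>\<close> is zero in degree \<open>1\<close> of the associated graded algebra, hence in
  \<open>H\<^sub>0\<^sub>,\<^sub>0\<close>, where the natural map is injective. Then the same argument in degree \<open>0\<close> applies to \<open>a\<close>.
\<close>

lemma PBW_property_imp_injective:
  assumes PBW_property shows natural_map_injective
  unfolding natural_map_injective_iff
proof (intro allI impI)
  fix a \<tau> assume H: "inA a + embVA \<tau> \<in> H_ideal"
  note PBW = assms[unfolded PBW_property_iff]
  have a: "inA a \<in> words_deg 0"
    using gen_word_in_words(2)[of "[Inr a]" 0] by (simp add: gen_word_single)
  have "inV v * inA b \<in> (words_deg 1 :: (('v \<times> 'a) fword \<Rightarrow>\<^sub>0 'k) set)" for v b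
    using gen_word_in_words(2)[of "[Inl v, Inr b]" 1] by (simp add: gen_word_def)
  then have \<tau>: "embVA \<tau> \<in> words_deg 1"
    unfolding embVA_def by (intro lin_ext_mem[OF module_fscale subspace_words(2)]) auto
  have "- inA a \<in> words_below 1"
    using a words_deg_below[of 0 1] by (intro F.subspace_neg[OF subspace_words(1)]) auto
  from gr_relI[OF H this] have "embVA \<tau> \<in> gr_rel 1" by simp
  then have "embVA \<tau> \<in> H00_ideal" using PBW \<tau> by blast
  moreover have "inA 0 \<in> H00_ideal" using zero_mem_base by (simp add: base_ideal_def)
  ultimately have "inA 0 + embVA \<tau> \<in> H00_ideal"
    by (intro F.subspace_add[OF subspace_H00])
  then have \<tau>0: "\<tau> \<in> tens_rel scV scA" using undeformed_injective by blast
  then have "embVA \<tau> \<in> H_ideal" using embVA_tens_rel skew_subset_H by blast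
  from H_ideal_closed(2)[OF H this] have "inA a \<in> gr_rel 0"
    using H_subset_gr_rel by auto
  then have "inA a \<in> H00_ideal" using PBW a by blast
  then have "a = 0" using undeformed_injective[of a 0] by (simp add: embVA_zero)
  with \<tau>0 show "a = 0 \<and> \<tau> \<in> tens_rel scV scA" by simp
qed

lemma injective_iff_independent: "natural_map_injective \<longleftrightarrow> PBW_independent"
  using injective_imp_conditions conditions_imp_independent independent_imp_injective by blast

end

section \<open>The PBW theorem\<close>

theorem theorem2p5:
  fixes scA :: "'k::comm_ring_1 \<Rightarrow> 'a::ring_1 \<Rightarrow> 'a"
    and \<Delta> :: "'a \<Rightarrow> ('a \<times> 'a \<Rightarrow>\<^sub>0 'k) set"
    and scV :: "'k \<Rightarrow> 'v::ab_group_add \<Rightarrow> 'v"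
    and act :: "'a \<Rightarrow> 'v \<Rightarrow> 'v"
    and lam :: "('a \<times> 'v \<Rightarrow>\<^sub>0 'k) set \<Rightarrow> 'a"
    and kap :: "('v \<times> 'v \<Rightarrow>\<^sub>0 'k) set \<Rightarrow> 'v \<times> 'a"
    and A' :: "'a set"
  assumes "smash_deformation scA \<Delta> scV act lam kap"
    and "is_free scA UNIV"
    and "is_free scV UNIV"
    and "is_free scA A'"
    and "\<forall>a. \<exists>c. \<exists>a'\<in>A'. a = scA c 1 + a'"
    and "range (\<lambda>c. scA c 1) \<inter> A' = {0}"
  shows "(smash_deformation.PBW_property scA \<Delta> scV act lam kap
            \<longleftrightarrow> smash_deformation.natural_map_injective scA \<Delta> scV act lam kap)
       \<and> (\<forall>B r J. is_basis scV UNIV B \<and> linear_order_on B r \<and> is_basis scA UNIV J \<and> 1 \<in> J \<longrightarrow>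
            (smash_deformation.PBW_for_bases scA \<Delta> scV act lam kap B r J
              \<longleftrightarrow> smash_deformation.natural_map_injective scA \<Delta> scV act lam kap))
       \<and> (smash_deformation.natural_map_injective scA \<Delta> scV act lam kap
            \<longleftrightarrow> smash_deformation.cond_a scA \<Delta> scV act lam
              \<and> smash_deformation.cond_b scA \<Delta> scV act lam kap
              \<and> smash_deformation.cond_c scA \<Delta> scV act lam kap)"
proof -
  interpret smash_deformation scA \<Delta> scV act lam kap by (rule assms(1))
  have basis: "smash_basis scA \<Delta> scV act lam kap B r" if "is_basis scV UNIV B" "linear_order_on B r" for B r
    using that assms(1) by (simp add: smash_basis_def smash_basis_axioms_def)
  \<comment> \<open>Two of the statements mention no basis of \<open>V\<close>; any ordered basis proves them.\<close>
  obtain B0 where B0: "is_basis scV UNIV B0" using assms(3) by (auto simp: is_free_def)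
  obtain r0 where "well_order_on B0 r0" using well_order_on by blast
  then interpret W: smash_basis scA \<Delta> scV act lam kap B0 r0
    using B0 by (intro basis) (simp_all add: well_order_on_def)
  have "PBW_property \<longleftrightarrow> natural_map_injective"
    using W.independent_imp_PBW_property W.PBW_property_imp_injective W.injective_iff_independent by blast
  moreover have "natural_map_injective \<longleftrightarrow> cond_a \<and> cond_b \<and> cond_c"
    using W.injective_iff_independent W.conditions_imp_independent injective_imp_conditions by blast
  moreover have "PBW_for_bases B r J \<longleftrightarrow> natural_map_injective"
    if "is_basis scV UNIV B" "linear_order_on B r" "is_basis scA UNIV J" for B r J
    using smash_basis.PBW_for_bases_iff[OF basis[OF that(1,2)] that(3)]
      smash_basis.injective_iff_independent[OF basis[OF that(1,2)]] by simp
  ultimately show ?thesis by blast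
qed

end
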